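(* Let $(G,F)$ be a temporal cost graph where $G$ is a tree with $n$ vertices and the lifetime of $(G,F)$ is $T$, and let $E'$ be a subset of edges of $G$ such that the subgraph induced by $E'$ is a forest containing at most $\ell$ leaves. If every edge in $E(G)\setminus E'$ has maximum traversal number $3$, then \textsc{Changing Cost Temporal Orienteering} can be solved on any instance $((G,F),v_s,v_t,k,f)$ in $O(k^2T^2n^{2\ell+2})$ time.
   Context: A temporal cost graph is a pair $(G,F)$ where $G=(V,E)$ is a static graph and $F:V\times V\times[T]\times[T]\to\mathbb{N}_0\cup\{\infty\}$ ($F(v_1,v_2,t_1,t_2)$ is the cost of departing $v_1$ at time $t_1$ and arriving at $v_2$ at time $t_2$), with $F(v_1,v_2,t_1,t_2)=\infty$ whenever $t_1\ge t_2$, $F(v,v,t_1,t_2)=0$ for all $v$ and $t_1<t_2$, and $F(v_1,v_2,t_1,t_2)>0$ whenever $v_1\ne v_2$; values of $F$ can be looked up in constant time. The lifetime $T$ is the latest time $t'$ such that $F(v,u,t,t')<\infty$ for some $v,u,t$. A valid walk is a sequence $(u_1,v_1,t_1,t_1'),\dots,(u_\ell,v_\ell,t_\ell,t_\ell')$ with $v_i=u_{i+1}$ and $t_i'\le t_{i+1}$ for consecutive entries, and $t_i<t_i'$, $F(u_i,v_i,t_i,t_i')<\infty$ for all $i$; its cost is $\sum_iF(u_i,v_i,t_i,t_i')$. The maximum traversal number of an edge $uv$ of $G$ is the largest $j$ for which there is a sequence of time pairs $(t_1,t_1'),\dots,(t_j,t_j')$ with $\min\{F(u,v,t_i,t_i'),F(v,u,t_i,t_i')\}<\infty$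 for each $i$ and $t_i'\le t_{i+1}$ for each $i\le j-1$. \textsc{Changing Cost Temporal Orienteering}, on instance $((G,F),v_s,v_t,k,f)$: decide whether there is a valid walk from source $v_s$ to sink $v_t$ visiting at least $k$ distinct vertices (source and sink counted) with cost at most the budget $f$. *)

theory Defs
  imports Main "HOL-Library.Extended_Nat"
begin

section \<open>Graphs\<close>

definition simple_graph :: "'v set \<Rightarrow> 'v set set \<Rightarrow> bool" where
  "simple_graph V E \<longleftrightarrow>
     finite V \<and> (\<forall>e\<in>E. \<exists>u\<in>V. \<exists>v\<in>V. u \<noteq> v \<and> e = {u, v})"

definition connected_graph :: "'v set \<Rightarrow> 'v set set \<Rightarrow> bool" where
  "connected_graph V E \<longleftrightarrow>
     V \<noteq> {} \<and> (\<forall>u\<in>V. \<forall>v\<in>V. (u, v) \<in> {(x, y). {x, y} \<in> E}\<^sup>*)"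

definition is_cycle :: "'v set set \<Rightarrow> 'v list \<Rightarrow> bool" where
  "is_cycle E p \<longleftrightarrow>
     3 \<le> length p \<and> distinct p \<and>
     (\<forall>i<length p. {p ! i, p ! (Suc i mod length p)} \<in> E)"

definition forest :: "'v set \<Rightarrow> 'v set set \<Rightarrow> bool" where
  "forest V E \<longleftrightarrow> simple_graph V E \<and> \<not> (\<exists>p. is_cycle E p)"

definition tree :: "'v set \<Rightarrow> 'v set set \<Rightarrow> bool" where
  "tree V E \<longleftrightarrow> forest V E \<and> connected_graph V E"

definition leaves :: "'v set \<Rightarrow> 'v set set \<Rightarrow> 'v set" where
  "leaves V E = {v \<in> V. card {e \<in> E. v \<in> e} = 1}"


section \<open>Temporal cost graphs\<close>

text \<open>
  \<open>F u v t t'\<close> is the cost of departing \<open>u\<close> at time \<open>t\<close> and arriving at \<open>v\<close> at time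
  \<open>t'\<close>.  It is meaningful only on vertices in \<open>V\<close> and times in \<open>{1..T}\<close>; all definitions
  below look at no other values.  The last condition says that one can move only along edges
  of the static graph (or stay where one is).
\<close>

type_synonym 'v cost = "'v \<Rightarrow> 'v \<Rightarrow> nat \<Rightarrow> nat \<Rightarrow> enat"

definition temporal_cost_graph :: "'v set \<Rightarrow> 'v set set \<Rightarrow> nat \<Rightarrow> 'v cost \<Rightarrow> bool" where
  "temporal_cost_graph V E T F \<longleftrightarrow>
     simple_graph V E \<and>
     (\<forall>u\<in>V. \<forall>v\<in>V. \<forall>t\<in>{1..T}. \<forall>t'\<in>{1..T}.
        (t \<ge> t' \<longrightarrow> F u v t t' = \<infinity>) \<and>
        (u = v \<and> t < t' \<longrightarrow> F u v t t' = 0) \<and>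
        (u \<noteq> v \<longrightarrow> F u v t t' > 0) \<and>
        (u \<noteq> v \<and> {u, v} \<notin> E \<longrightarrow> F u v t t' = \<infinity>))"

text \<open>
  \<open>T\<close> is attained as a finite-cost arrival time.  As all times are in \<open>{1..T}\<close>, it is then
  the latest such time.
\<close>

definition has_lifetime :: "'v set \<Rightarrow> 'v cost \<Rightarrow> nat \<Rightarrow> bool" where
  "has_lifetime V F T \<longleftrightarrow> (\<exists>v\<in>V. \<exists>u\<in>V. \<exists>t\<in>{1..T}. F v u t T < \<infinity>)"

definition traversal_sequence ::
  "nat \<Rightarrow> 'v cost \<Rightarrow> 'v \<Rightarrow> 'v \<Rightarrow> (nat \<times> nat) list \<Rightarrow> bool" where
  "traversal_sequence T F u v ts \<longleftrightarrow>
     (\<forall>(t, t') \<in> set ts. t \<in> {1..T} \<and> t' \<in> {1..T} \<and> min (F u v t t') (F v u t t') < \<infinity>) \<and>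
     successively (\<lambda>(t, t') (s, s'). t' \<le> s) ts"

definition max_traversal_number :: "nat \<Rightarrow> 'v cost \<Rightarrow> 'v \<Rightarrow> 'v \<Rightarrow> nat" where
  "max_traversal_number T F u v = Max {length ts | ts. traversal_sequence T F u v ts}"

type_synonym 'v step = "'v \<times> 'v \<times> nat \<times> nat"

definition valid_walk :: "'v set \<Rightarrow> nat \<Rightarrow> 'v cost \<Rightarrow> 'v step list \<Rightarrow> bool" where
  "valid_walk V T F w \<longleftrightarrow>
     w \<noteq> [] \<and>
     (\<forall>(u, v, t, t') \<in> set w.
        u \<in> V \<and> v \<in> V \<and> t \<in> {1..T} \<and> t' \<in> {1..T} \<and> t < t' \<and> F u v t t' < \<infinity>) \<and>
     successively (\<lambda>(u, v, t, t') (x, y, s, s'). v = x \<and> t' \<le> s) w"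

definition walk_start :: "'v step list \<Rightarrow> 'v" where
  "walk_start w = (case hd w of (u, v, t, t') \<Rightarrow> u)"

definition walk_end :: "'v step list \<Rightarrow> 'v" where
  "walk_end w = (case last w of (u, v, t, t') \<Rightarrow> v)"

definition walk_cost :: "'v cost \<Rightarrow> 'v step list \<Rightarrow> enat" where
  "walk_cost F w = (\<Sum>(u, v, t, t')\<leftarrow>w. F u v t t')"

definition visited :: "'v step list \<Rightarrow> 'v set" where
  "visited w = (\<Union>(u, v, t, t') \<in> set w. {u, v})"

definition temporal_orienteering ::
  "'v set \<Rightarrow> nat \<Rightarrow> 'v cost \<Rightarrow> 'v \<Rightarrow> 'v \<Rightarrow> nat \<Rightarrow> nat \<Rightarrow> bool" where
  "temporal_orienteering V T F vs vt k f \<longleftrightarrow>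
     (\<exists>w. valid_walk V T F w \<and> walk_start w = vs \<and> walk_end w = vt \<and>
          card (visited w) \<ge> k \<and> walk_cost F w \<le> enat f)"


section \<open>Model of computation\<close>

text \<open>
  A structured unit-cost RAM: finitely many scalar variables and one-dimensional arrays, all
  holding natural numbers.  The arithmetic operations are addition and truncated subtraction.
  Multiplication is left out on purpose, since at unit cost on unbounded numbers it would make
  the machine unreasonably powerful.  Each assignment and each evaluation of a test takes one
  time unit; this is exact up to a constant factor because a fixed program contains only
  finitely many expressions, each of constant size.

  The cost function \<open>F\<close> is accessible through \<open>CostAt\<close>, which takes constant time and yields
  \<open>c + 1\<close> for a finite cost \<open>c\<close> and \<open>0\<close> for an infinite one.
\<close>

type_synonym vname = string

datatype aexp =
    Num nat
  | Var vname
  | Arr vname aexp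
  | Plus aexp aexp
  | Minus aexp aexp
  | CostAt aexp aexp aexp aexp

datatype bexp = Less aexp aexp | Neg bexp | Conj bexp bexp

datatype com =
    Skip
  | Assign vname aexp
  | Store vname aexp aexp
  | Seq com com
  | Cond bexp com com
  | While bexp com

record store =
  scalar :: "vname \<Rightarrow> nat"
  arr :: "vname \<Rightarrow> nat \<Rightarrow> nat"

definition encode_cost :: "enat \<Rightarrow> nat" where
  "encode_cost c = (case c of enat m \<Rightarrow> Suc m | \<infinity> \<Rightarrow> 0)"

fun aval :: "nat cost \<Rightarrow> store \<Rightarrow> aexp \<Rightarrow> nat" where
  "aval F s (Num m) = m"
| "aval F s (Var x) = scalar s x"
| "aval F s (Arr x a) = arr s x (aval F s a)"
| "aval F s (Plus a b) = aval F s a + aval F s b"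
| "aval F s (Minus a b) = aval F s a - aval F s b"
| "aval F s (CostAt a b c d) =
     encode_cost (F (aval F s a) (aval F s b) (aval F s c) (aval F s d))"

fun bval :: "nat cost \<Rightarrow> store \<Rightarrow> bexp \<Rightarrow> bool" where
  "bval F s (Less a b) \<longleftrightarrow> aval F s a < aval F s b"
| "bval F s (Neg b) \<longleftrightarrow> \<not> bval F s b"
| "bval F s (Conj b c) \<longleftrightarrow> bval F s b \<and> bval F s c"

text \<open>\<open>exec F c s m s'\<close>: started in \<open>s\<close>, the program \<open>c\<close> halts in \<open>s'\<close> after \<open>m\<close> time units.\<close>

inductive exec :: "nat cost \<Rightarrow> com \<Rightarrow> store \<Rightarrow> nat \<Rightarrow> store \<Rightarrow> bool" for F where
  Skip: "exec F Skip s 1 s"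
| Assign: "exec F (Assign x a) s 1 (s\<lparr>scalar := (scalar s)(x := aval F s a)\<rparr>)"
| Store: "exec F (Store x a b) s 1
            (s\<lparr>arr := (arr s)(x := (arr s x)(aval F s a := aval F s b))\<rparr>)"
| Seq: "exec F c1 s1 m1 s2 \<Longrightarrow> exec F c2 s2 m2 s3 \<Longrightarrow> exec F (Seq c1 c2) s1 (m1 + m2) s3"
| CondTrue: "bval F s b \<Longrightarrow> exec F c1 s m s' \<Longrightarrow> exec F (Cond b c1 c2) s (Suc m) s'"
| CondFalse: "\<not> bval F s b \<Longrightarrow> exec F c2 s m s' \<Longrightarrow> exec F (Cond b c1 c2) s (Suc m) s'"
| WhileFalse: "\<not> bval F s b \<Longrightarrow> exec F (While b c) s 1 s"
| WhileTrue: "bval F s1 b \<Longrightarrow> exec F c s1 m1 s2 \<Longrightarrow> exec F (While b c) s2 m2 s3 \<Longrightarrow>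
              exec F (While b c) s1 (Suc (m1 + m2)) s3"

inductive_cases exec_SkipE: "exec F Skip s m s'"
inductive_cases exec_AssignE: "exec F (Assign x a) s m s'"
inductive_cases exec_StoreE: "exec F (Store x a b) s m s'"
inductive_cases exec_SeqE: "exec F (Seq c1 c2) s m s'"
inductive_cases exec_CondE: "exec F (Cond b c1 c2) s m s'"
inductive_cases exec_WhileE: "exec F (While b c) s m s'"

lemma exec_deterministic:
  "exec F c s m s' \<Longrightarrow> exec F c s m2 s2 \<Longrightarrow> m2 = m \<and> s2 = s'"
proof (induction arbitrary: m2 s2 rule: exec.induct)
  case (Skip s)
  then show ?case by (auto elim: exec_SkipE)
next
  case (Assign x a s)
  then show ?case by (auto elim: exec_AssignE)
next
  case (Store x a b s)
  then show ?case by (auto elim: exec_StoreE)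
next
  case (Seq c1 s1 m1 s2' c2 m2' s3)
  from Seq.prems show ?case
    by (rule exec_SeqE) (use Seq.IH in blast)
next
  case (CondTrue s b c1 m s' c2)
  from CondTrue.prems show ?case
    by (rule exec_CondE) (use CondTrue.IH CondTrue.hyps in blast)+
next
  case (CondFalse s b c2 m s' c1)
  from CondFalse.prems show ?case
    by (rule exec_CondE) (use CondFalse.IH CondFalse.hyps in blast)+
next
  case (WhileFalse s b c)
  from WhileFalse.prems show ?case
    by (rule exec_WhileE) (use WhileFalse.hyps in auto)
next
  case (WhileTrue s1 b c m1 s2' m2' s3)
  from WhileTrue.prems show ?case
    by (rule exec_WhileE) (use WhileTrue.IH WhileTrue.hyps in blast)+
qed

text \<open>
  The input store for an instance whose vertices are numbered \<open>0, \<dots>, n - 1\<close>.  The static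
  graph is given by its adjacency matrix in row-major order.  Everything else is zero.
\<close>

definition input_store ::
  "nat \<Rightarrow> nat set set \<Rightarrow> nat \<Rightarrow> nat \<Rightarrow> nat \<Rightarrow> nat \<Rightarrow> nat \<Rightarrow> store" where
  "input_store n E T vs vt k f =
     \<lparr>scalar = (\<lambda>_. 0)(''n'' := n, ''T'' := T, ''vs'' := vs, ''vt'' := vt, ''k'' := k, ''f'' := f),
      arr = (\<lambda>_ _. 0)(''adj'' :=
        (\<lambda>i. if i < n * n \<and> {i div n, i mod n} \<in> E then 1 else 0))\<rparr>"

text \<open>The program halts within the given number of time units, leaving its verdict in
  \<open>answer\<close>.\<close>

definition decides_within ::
  "com \<Rightarrow> nat cost \<Rightarrow> store \<Rightarrow> nat \<Rightarrow> bool \<Rightarrow> bool" where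
  "decides_within prog F s bound verdict \<longleftrightarrow>
     (\<exists>m s'. exec F prog s m s' \<and> m \<le> bound \<and>
             scalar s' ''answer'' = (if verdict then 1 else 0))"

end

theory Submission
  imports Defs "HOL-Library.FuncSet" "HOL-Library.Nat_Bijection"
begin

text \<open>
  Root the tree at the source and let the core \<open>K\<close> consist of all ancestors of the sink and of the
  lower endpoints of edges with maximum traversal number at least 4.  An edge outside the core is
  off the source-sink path, so a walk that ends in the sink traverses it equally often downwards and
  upwards, and at most three times altogether, hence at most once downwards.  So every downward move outside the core discovers a
  new vertex, and only the visited part \<open>S\<close> of the core has to be remembered.  A dynamic program
  over (time, vertex, \<open>S\<close>, number of visited vertices capped at \<open>k\<close>) computes minimum costs.

  As \<open>S\<close> is closed under parents, it is determined by the lowest ancestor in \<open>S\<close> of each leaf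
  of \<open>E'\<close> and of the sink, so there are at most \<open>n\<^sup>l\<^sup>+\<^sup>1\<close> such sets, and the program runs in time
  \<open>O(k T\<^sup>2 n\<^sup>l\<^sup>+\<^sup>2)\<close> without knowing \<open>E'\<close>.  Sets are stored as numbers in binary, and table entries
  are addressed by the binary encoding of a whole state, so no multiplication is needed.
\<close>

section \<open>Rooted trees\<close>

text \<open>The counter of the dynamic program need not equal the number of visited vertices along
  the way: a partial walk that currently stands below an edge outside the core may have descended
  that edge twice. Such overcounts are tolerated, because acceptance is read off only at the sink,
  where \<open>downs\<close> and \<open>ups\<close> agree on every edge outside the core and parity
  does the rest. This is why the sink itself has to lie in the core, and it is the source of the
  extra 1 in the exponent of \<open>n ^ Suc l\<close>. Waiting is free, so walks are padded until
  every step departs at the arrival time of the step before it and the last one arrives at time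
  \<open>T\<close>. A state then needs a single time, and only states at \<open>T\<close> are
  inspected. The machine has no bit test for stored sets. The list of core sets therefore records
  how each set arises from an earlier one, which yields membership of a fixed vertex in all sets in
  one linear pass.\<close>

lemma relpow_shorten:
  assumes f: "\<forall>i<m. (f i, f (Suc i)) \<in> R" and "i < j" "j \<le> m" "f i = f j"
  shows "\<exists>m'<m. (f 0, f m) \<in> R ^^ m'"
proof -
  have seg: "(f a, f (a + d)) \<in> R ^^ d" if "a + d \<le> m" for a d
    using that f by (induction d) (auto intro: relcompI)
  have "(f 0, f i) \<in> R ^^ i" "(f j, f m) \<in> R ^^ (m - j)"
    using seg[of 0 i] seg[of j "m - j"] assms by auto
  then have "(f 0, f m) \<in> R ^^ (i + (m - j))"
    using \<open>f i = f j\<close> by (auto simp: relpow_add intro: relcompI)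
  then show ?thesis using assms(2,3) by (intro exI[of _ "i + (m - j)"]) auto
qed

text \<open>A shortest path from \<open>a\<close> to \<open>b\<close> that avoids the edge repeats
  no vertex and has at least two steps; closed up by the edge itself it is a cycle.\<close>

lemma forest_bridge:
  assumes "forest V E" "{a, b} \<in> E" "a \<noteq> b"
  shows "(a, b) \<notin> {(x, y). {x, y} \<in> E - {{a, b}}}\<^sup>*"
proof
  let ?R = "{(x, y). {x, y} \<in> E - {{a, b}}}"
  assume "(a, b) \<in> ?R\<^sup>*"
  then obtain m0 where "(a, b) \<in> ?R ^^ m0" by (auto simp: rtrancl_power)
  define m where "m = (LEAST m. (a, b) \<in> ?R ^^ m)"
  have m: "(a, b) \<in> ?R ^^ m" unfolding m_def by (rule LeastI) fact
  then obtain f where f: "f 0 = a" "f m = b" "\<forall>i<m. (f i, f (Suc i)) \<in> ?R"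
    by (auto simp: relpow_fun_conv)
  have inj: "inj_on f {..m}"
  proof (rule linorder_inj_onI')
    fix i j assume ij: "i \<in> {..m}" "j \<in> {..m}" "i < j"
    show "f i \<noteq> f j"
    proof
      assume "f i = f j"
      from relpow_shorten[OF f(3) ij(3) _ this] ij f obtain m' where "m' < m" "(a, b) \<in> ?R ^^ m'"
        by auto
      then show False unfolding m_def using not_less_Least by blast
    qed
  qed
  have "m \<noteq> 0" using f assms(3) by auto
  \<comment> \<open>A path of length 1 would be the removed edge itself.\<close>
  moreover have "m \<noteq> 1" using f by auto
  ultimately have m2: "2 \<le> m" by simp
  have "is_cycle E (map f [0..<Suc m])"
    unfolding is_cycle_def
  proof (intro conjI allI impI)
    show "3 \<le> length (map f [0..<Suc m])" using m2 by simp
    show "distinct (map f [0..<Suc m])" using inj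
      by (auto simp: distinct_map atLeast0LessThan lessThan_Suc_atMost inj_on_def
          simp del: upt_Suc)
    fix i assume "i < length (map f [0..<Suc m])"
    then have i: "i \<le> m" by simp
    show "{map f [0..<Suc m] ! i, map f [0..<Suc m] ! (Suc i mod length (map f [0..<Suc m]))} \<in> E"
    proof (cases "i = m")
      case True
      then show ?thesis using f assms(2) by (simp add: insert_commute nth_append del: upt_Suc)
    next
      case False
      with i f(3) have "{f i, f (Suc i)} \<in> E" by auto
      then show ?thesis using i False by (simp del: upt_Suc)
    qed
  qed
  then show False using assms(1) unfolding forest_def by blast
qed

text \<open>The interface to breadth-first search: \<open>ord\<close> lists the vertices, every
  other vertex after its parent. With \<open>par r = r\<close>, iterating \<open>par\<close> ends in
  the root and stays there. The position in \<open>ord\<close> replaces the depth as a measure for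
  inductions.\<close>

locale rooted =
  fixes n r :: nat and par ord :: "nat \<Rightarrow> nat"
  assumes r_less: "r < n"
    and ord_bij: "bij_betw ord {..<n} {..<n}"
    and ord_0: "ord 0 = r"
    and par_r: "par r = r"
    and par_ord: "\<And>j. 0 < j \<Longrightarrow> j < n \<Longrightarrow> \<exists>i<j. par (ord j) = ord i"
begin

definition rank :: "nat \<Rightarrow> nat" where
  "rank = inv_into {..<n} ord"

lemma rank_less: "v < n \<Longrightarrow> rank v < n"
  unfolding rank_def using ord_bij
  by (metis bij_betwE bij_betw_inv_into lessThan_iff)

lemma ord_rank: "v < n \<Longrightarrow> ord (rank v) = v"
  unfolding rank_def using ord_bij by (simp add: bij_betw_inv_into_right)

lemma rank_ord: "j < n \<Longrightarrow> rank (ord j) = j"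
  unfolding rank_def using ord_bij by (simp add: bij_betw_inv_into_left)

lemma ord_less: "j < n \<Longrightarrow> ord j < n"
  using ord_bij by (auto dest: bij_betwE)

lemma par_step:
  assumes "v < n" "v \<noteq> r"
  shows "par v < n" "rank (par v) < rank v"
proof -
  have "rank v \<noteq> 0" using assms ord_0 ord_rank by metis
  then obtain i where "i < rank v" "par v = ord i"
    using par_ord[of "rank v"] rank_less[OF assms(1)] ord_rank[OF assms(1)] by auto
  then show "par v < n" "rank (par v) < rank v"
    using rank_less[OF assms(1)] ord_less rank_ord by auto
qed

lemma par_less: "v < n \<Longrightarrow> par v < n"
  using par_step(1) par_r r_less by (cases "v = r") auto

lemma funpow_par_less: "v < n \<Longrightarrow> (par ^^ i) v < n"
  by (induction i) (auto intro: par_less)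

lemma par_induct [consumes 1, case_names root par]:
  assumes "v < n" "P r" "\<And>v. v < n \<Longrightarrow> v \<noteq> r \<Longrightarrow> P (par v) \<Longrightarrow> P v"
  shows "P v"
  using assms(1)
proof (induction "rank v" arbitrary: v rule: less_induct)
  case less
  then show ?case using assms(2,3) par_step by (cases "v = r") auto
qed

section \<open>Descendants and parent-closed sets\<close>

definition desc :: "nat \<Rightarrow> nat set" where
  "desc u = {x. x < n \<and> (\<exists>i. (par ^^ i) x = u)}"

lemma desc_refl: "u < n \<Longrightarrow> u \<in> desc u"
  unfolding desc_def by (auto intro: exI[of _ 0])

lemma desc_par: "x < n \<Longrightarrow> x \<noteq> u \<Longrightarrow> x \<in> desc u \<longleftrightarrow> par x \<in> desc u"
proof
  assume "x < n" "x \<noteq> u" "x \<in> desc u"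
  then obtain i where i: "(par ^^ i) x = u"
    unfolding desc_def by auto
  with \<open>x \<noteq> u\<close> have "i \<noteq> 0" by (intro notI) simp
  then obtain j where "i = Suc j" by (cases i) auto
  with i have "(par ^^ j) (par x) = u" by (simp add: funpow_swap1)
  then show "par x \<in> desc u" using \<open>x < n\<close> par_less unfolding desc_def by auto
next
  assume "x < n" "x \<noteq> u" "par x \<in> desc u"
  then show "x \<in> desc u" unfolding desc_def
    by (auto simp: funpow_swap1 intro: exI[of _ "Suc _"])
qed

lemma desc_trans: "x \<in> desc u \<Longrightarrow> u \<in> desc w \<Longrightarrow> x \<in> desc w"
  unfolding desc_def by (smt (verit) comp_apply funpow_add mem_Collect_eq)

lemma rank_funpow: "v < n \<Longrightarrow> rank ((par ^^ i) v) \<le> rank v"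
proof (induction i)
  case (Suc i)
  then show ?case using par_step(2)[of "(par ^^ i) v"] funpow_par_less[of v i] par_r
    by (cases "(par ^^ i) v = r") auto
qed simp

lemma par_notin_desc:
  assumes "u < n" "u \<noteq> r"
  shows "par u \<notin> desc u"
proof
  assume "par u \<in> desc u"
  then obtain i where "(par ^^ i) (par u) = u" unfolding desc_def by auto
  then have "rank u \<le> rank (par u)" using rank_funpow[of "par u" i] assms par_less by auto
  then show False using par_step(2)[OF assms] by simp
qed

lemma root_notin_desc: "u \<noteq> r \<Longrightarrow> r \<notin> desc u"
proof -
  have "(par ^^ i) r = r" for i by (induction i) (auto simp: par_r)
  then show "u \<noteq> r \<Longrightarrow> r \<notin> desc u" unfolding desc_def by auto
qed

lemma desc_root: "x < n \<Longrightarrow> x \<in> desc r"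
  by (induction x rule: par_induct) (auto simp: desc_refl r_less desc_par)

definition par_closed :: "nat set \<Rightarrow> bool" where
  "par_closed S \<longleftrightarrow> r \<in> S \<and> S \<subseteq> {..<n} \<and> (\<forall>v\<in>S. par v \<in> S)"

lemma par_closed_funpow: "par_closed S \<Longrightarrow> v \<in> S \<Longrightarrow> (par ^^ i) v \<in> S"
  by (induction i) (auto simp: par_closed_def)

lemma finite_par_closed: "finite {S. par_closed S \<and> S \<subseteq> K}"
  by (rule finite_subset[of _ "Pow {..<n}"]) (auto simp: par_closed_def)

text \<open>A parent-closed subset of \<open>K\<close> is determined by the lowest ancestor of each \<open>y \<in> Y\<close> in it.\<close>

lemma card_par_closed_le:
  assumes "finite Y" "Y \<subseteq> {..<n}" and K: "\<And>v. v \<in> K \<Longrightarrow> v \<noteq> r \<Longrightarrow> \<exists>y\<in>Y. y \<in> desc v"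
  shows "card {S. par_closed S \<and> S \<subseteq> K} \<le> n ^ card Y"
proof -
  \<comment> \<open>The first vertex of \<open>S\<close> met on the way up from \<open>y\<close>; it
    exists because that way ends in the root.\<close>
  define low where "low S y = (par ^^ (LEAST i. (par ^^ i) y \<in> S)) y" for S y
  have ex: "\<exists>i. (par ^^ i) y \<in> S" if "par_closed S" "y \<in> Y" for S y
    using desc_root[of y] that assms(2) unfolding desc_def par_closed_def by force
  have low_in: "low S y \<in> S" if "par_closed S" "y \<in> Y" for S y
    unfolding low_def using ex[OF that] by (rule LeastI_ex)
  \<comment> \<open>The ancestors of \<open>low S y\<close> are in \<open>S\<close> by closure, and
    by minimality no vertex met before it is. So an ancestor \<open>v\<close> of \<open>y\<close>
    lies in \<open>S\<close> exactly if it is \<open>low S y\<close> or above it.\<close>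
  have mem: "v \<in> S \<longleftrightarrow> low S y \<in> desc v" if cl: "par_closed S" "y \<in> Y" "y \<in> desc v" for S y v
  proof
    assume "v \<in> S"
    obtain j where j: "(par ^^ j) y = v" using cl(3) unfolding desc_def by auto
    let ?i = "LEAST i. (par ^^ i) y \<in> S"
    have "?i \<le> j" using \<open>v \<in> S\<close> j by (intro Least_le) auto
    then have "(par ^^ (j - ?i)) (low S y) = v"
      unfolding low_def using j by (metis comp_apply funpow_add le_add_diff_inverse2)
    then show "low S y \<in> desc v" unfolding desc_def
      using low_in[OF cl(1,2)] cl(1) by (auto simp: par_closed_def)
  next
    assume "low S y \<in> desc v"
    then show "v \<in> S" using par_closed_funpow[OF cl(1) low_in[OF cl(1,2)]]
      unfolding desc_def by auto
  qed
  let ?C = "{S. par_closed S \<and> S \<subseteq> K}"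
  have "inj_on (\<lambda>S. restrict (low S) Y) ?C"
  proof (rule inj_onI)
    fix S S' assume S: "S \<in> ?C" "S' \<in> ?C" and eq: "restrict (low S) Y = restrict (low S') Y"
    have "v \<in> S \<longleftrightarrow> v \<in> S'" if "v \<in> K" for v
    proof (cases "v = r")
      case True
      then show ?thesis using S by (auto simp: par_closed_def)
    next
      case False
      then obtain y where y: "y \<in> Y" "y \<in> desc v" using K \<open>v \<in> K\<close> by blast
      have "low S y = low S' y" using eq y(1) by (metis restrict_apply)
      then show ?thesis using mem[of S y v] mem[of S' y v] S y by auto
    qed
    then show "S = S'" using S by blast
  qed
  moreover have "(\<lambda>S. restrict (low S) Y) ` ?C \<subseteq> Y \<rightarrow>\<^sub>E {..<n}"
    using low_in by (auto simp: par_closed_def subset_iff)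
  ultimately have "card ?C \<le> card (Y \<rightarrow>\<^sub>E {..<n})"
    by (meson assms(1) card_inj_on_le finite_PiE finite_lessThan)
  then show ?thesis using assms(1) by (simp add: card_PiE)
qed

text \<open>If \<open>{a, b}\<close> were not a parent edge, every parent edge would survive its
  removal, so \<open>a\<close> and \<open>b\<close> would still be connected through the root,
  although an edge of a forest is a bridge.\<close>

lemma tree_edge_par:
  assumes "tree {..<n} E" and par_E: "\<And>v. v < n \<Longrightarrow> v \<noteq> r \<Longrightarrow> {par v, v} \<in> E"
    and ab: "{a, b} \<in> E"
  shows "a < n \<and> b < n \<and> a \<noteq> b \<and> (par a = b \<or> par b = a)"
proof (rule ccontr)
  have "simple_graph {..<n} E" "forest {..<n} E"
    using assms(1) by (auto simp: tree_def forest_def)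
  then have ab': "a < n" "b < n" "a \<noteq> b"
    using ab unfolding simple_graph_def by (fastforce simp: doubleton_eq_iff)+
  assume "\<not> ?thesis"
  with ab' have np: "par a \<noteq> b" "par b \<noteq> a" by auto
  let ?R = "{(x, y). {x, y} \<in> E - {{a, b}}}"
  have "(v, r) \<in> ?R\<^sup>*" if "v < n" for v
    using that
  proof (induction v rule: par_induct)
    case (par v)
    have "{par v, v} \<noteq> {a, b}" using np by (auto simp: doubleton_eq_iff)
    then have "(v, par v) \<in> ?R" using par_E[OF par(1,2)] by (simp add: insert_commute)
    then show ?case using par(3) by (rule converse_rtrancl_into_rtrancl)
  qed simp
  moreover have "sym (?R\<^sup>*)" by (rule sym_rtrancl) (auto simp: sym_def insert_commute)
  ultimately have "(a, b) \<in> ?R\<^sup>*" using ab' by (meson rtrancl_trans symD)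
  then show False using forest_bridge[OF \<open>forest {..<n} E\<close> ab ab'(3)] by blast
qed

end

section \<open>Walks and the core\<close>

text \<open>Everything that the correctness argument needs about instance and core. The traversal
  bound is stated for the length of every sequence, which is what the program tests, and not through
  the \<open>Max\<close> in \<open>max_traversal_number\<close>.\<close>

locale core = rooted n r par ord
  for n r :: nat and par ord :: "nat \<Rightarrow> nat" +
  fixes T :: nat and F :: "nat cost" and K :: "nat set" and goal k :: nat
  assumes core_closed: "par_closed K" and goal_core: "goal \<in> K"
    and T_ge: "2 \<le> T" and k_pos: "1 \<le> k"
    and F_finite: "\<And>a b t t'. a < n \<Longrightarrow> b < n \<Longrightarrow> t \<in> {1..T} \<Longrightarrow> t' \<in> {1..T} \<Longrightarrow> F a b t t' \<noteq> \<infinity> \<Longrightarrow>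
      t < t' \<and> (a = b \<or> par a = b \<or> par b = a)"
    and F_stay: "\<And>a t t'. a < n \<Longrightarrow> 1 \<le> t \<Longrightarrow> t < t' \<Longrightarrow> t' \<le> T \<Longrightarrow> F a a t t' = 0"
    and few_traversals: "\<And>u ts. u < n \<Longrightarrow> u \<notin> K \<Longrightarrow> traversal_sequence T F (par u) u ts \<Longrightarrow>
      length ts \<le> 3"
begin

text \<open>
  Outside the core every downward move counts as discovering its target: a walk that ends in the
  core cannot make it twice.
\<close>

definition fresh :: "nat set \<Rightarrow> nat \<Rightarrow> nat \<Rightarrow> bool" where
  "fresh S a b \<longleftrightarrow> (if b \<in> K then b \<notin> S else par b = a)"

text \<open>Padded walks: each step departs exactly when the previous one arrived, waiting being an
  explicit step from a vertex to itself. \<open>V\<close> is the full visited set and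
  \<open>c\<close> the uncapped counter, which may exceed \<open>card V\<close> while the walk is
  under way.\<close>

inductive trace :: "nat step list \<Rightarrow> nat \<Rightarrow> nat \<Rightarrow> nat set \<Rightarrow> nat \<Rightarrow> nat \<Rightarrow> bool" where
  trace_Nil: "trace [] 1 r {r} 1 0"
| trace_snoc: "trace w t a V c x \<Longrightarrow> b < n \<Longrightarrow> t' \<in> {t<..T} \<Longrightarrow> F a b t t' = enat y \<Longrightarrow>
    trace (w @ [(a, b, t, t')]) t' b (insert b V) (if fresh V a b then Suc c else c) (x + y)"

text \<open>The same process reduced to the memory of the program: \<open>S\<close> is the visited
  part of the core, and the counter stops at \<open>k\<close>.\<close>

inductive reach :: "nat \<Rightarrow> nat \<Rightarrow> nat set \<Rightarrow> nat \<Rightarrow> nat \<Rightarrow> bool" where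
  reach_init: "reach 1 r {r} 1 0"
| reach_step: "reach t a S c x \<Longrightarrow> b < n \<Longrightarrow> t' \<in> {t<..T} \<Longrightarrow> F a b t t' = enat y \<Longrightarrow>
    reach t' b (if b \<in> K then insert b S else S) (if fresh S a b \<and> c < k then Suc c else c) (x + y)"

lemma root_core: "r \<in> K"
  using core_closed by (simp add: par_closed_def)

lemma F_stepD:
  assumes "a < n" "b < n" "1 \<le> t" "t < t'" "t' \<le> T" "F a b t t' = enat y"
  shows "a = b \<or> par a = b \<or> par b = a"
  using F_finite[of a b t t'] assms by auto

lemma trace_basic:
  "trace w t a V c x \<Longrightarrow> 1 \<le> t \<and> t \<le> T \<and> a \<in> V \<and> par_closed V"
proof (induction rule: trace.induct)
  case trace_Nil
  then show ?case using T_ge r_less par_r by (auto simp: par_closed_def)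
next
  case (trace_snoc w t a V c x b t' y)
  then have "a = b \<or> par a = b \<or> par b = a"
    by (intro F_stepD[of a b t t' y]) (auto simp: par_closed_def)
  then show ?case using trace_snoc by (auto simp: par_closed_def)
qed

lemma trace_less: "trace w t a V c x \<Longrightarrow> a < n"
  using trace_basic[of w t a V c x] by (auto simp: par_closed_def)

lemma trace_step:
  assumes "trace w t a V c x" "b < n" "t' \<in> {t<..T}" "F a b t t' = enat y"
  shows "a = b \<or> par a = b \<or> par b = a"
  using F_stepD[OF trace_less[OF assms(1)]] trace_basic[OF assms(1)] assms by auto

text \<open>Sortedness is recorded for all pairs of steps and not only for consecutive ones, because
  the walk is later filtered to the steps across a single edge, and only the pairwise property
  passes to sublists.\<close>

lemma trace_walk:
  "trace w t a V c x \<Longrightarrow>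
    V = insert r (visited w) \<and> walk_cost F w = enat x \<and>
    (\<forall>(u, v, s, s') \<in> set w. u < n \<and> v < n \<and> 1 \<le> s \<and> s < s' \<and> s' \<le> t \<and> F u v s s' < \<infinity>) \<and>
    sorted_wrt (\<lambda>(u, v, s, s') (u', v', q, q'). s' \<le> q) w \<and>
    successively (\<lambda>(u, v, t, t') (x, y, s, s'). v = x \<and> t' \<le> s) w \<and>
    (if w = [] then t = 1 \<and> a = r else walk_start w = r \<and> walk_end w = a)"
proof (induction rule: trace.induct)
  case trace_Nil
  then show ?case by (simp add: visited_def walk_cost_def zero_enat_def)
next
  case (trace_snoc w t a V c x b t' y)
  note basic = trace_basic[OF trace_snoc(1)] trace_less[OF trace_snoc(1)]
  have V: "V = insert r (visited w)" and cost: "walk_cost F w = enat x"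
    and steps: "\<forall>(u, v, s, s') \<in> set w. u < n \<and> v < n \<and> 1 \<le> s \<and> s < s' \<and> s' \<le> t \<and> F u v s s' < \<infinity>"
    and sorted: "sorted_wrt (\<lambda>(u, v, s, s') (u', v', q, q'). s' \<le> q) w"
    and succ: "successively (\<lambda>(u, v, t, t') (x, y, s, s'). v = x \<and> t' \<le> s) w"
    and ends: "if w = [] then t = 1 \<and> a = r else walk_start w = r \<and> walk_end w = a"
    using trace_snoc.IH by - (elim conjE, assumption)+
  let ?w = "w @ [(a, b, t, t')]"
  have "insert b V = insert r (visited ?w)" using V basic ends by (auto simp: visited_def)
  moreover have "walk_cost F ?w = enat (x + y)" using cost trace_snoc(4) by (simp add: walk_cost_def)
  moreover have "\<forall>(u, v, s, s') \<in> set ?w.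
      u < n \<and> v < n \<and> 1 \<le> s \<and> s < s' \<and> s' \<le> t' \<and> F u v s s' < \<infinity>"
    using steps basic trace_snoc(2-4) by auto
  moreover have "sorted_wrt (\<lambda>(u, v, s, s') (u', v', q, q'). s' \<le> q) ?w"
    using sorted steps by (auto simp: sorted_wrt_append)
  moreover have "successively (\<lambda>(u, v, t, t') (x, y, s, s'). v = x \<and> t' \<le> s) ?w"
  proof (cases "w = []")
    case False
    obtain u v q q' where l: "last w = (u, v, q, q')" by (cases "last w")
    have "last w \<in> set w" using False by simp
    then have "q' \<le> t" using steps l by auto
    then show ?thesis using False succ ends l by (simp add: successively_append_iff walk_end_def)
  qed simp
  moreover have "walk_start ?w = r" using ends by (cases w) (auto simp: walk_start_def)
  moreover have "walk_end ?w = b" by (simp add: walk_end_def)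
  ultimately show ?case by simp
qed

section \<open>Crossings of a single edge and the value of the counter\<close>

definition downs :: "nat \<Rightarrow> nat step list \<Rightarrow> nat" where
  "downs u w = length (filter (\<lambda>(a, b, t, t'). a = par u \<and> b = u) w)"

definition ups :: "nat \<Rightarrow> nat step list \<Rightarrow> nat" where
  "ups u w = length (filter (\<lambda>(a, b, t, t'). a = u \<and> b = par u) w)"

lemma par_neq: "u < n \<Longrightarrow> u \<noteq> r \<Longrightarrow> par u \<noteq> u"
  using par_step(2) less_irrefl by metis

lemma par_par_neq: "u < n \<Longrightarrow> u \<noteq> r \<Longrightarrow> par (par u) \<noteq> u"
  using par_step par_r less_asym by metis

text \<open>The edge above \<open>u\<close> is the only way into and out of \<open>desc u\<close>,
  and the walk starts at the root, outside of it. Crossings therefore alternate, beginning with a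
  descent, and the surplus of descents tells on which side the walk stands.\<close>

lemma trace_crossings:
  assumes "trace w t a V c x" "u < n" "u \<noteq> r"
  shows "downs u w = ups u w + (if a \<in> desc u then 1 else 0) \<and> (u \<in> V \<longleftrightarrow> 0 < downs u w)"
  using assms
proof (induction rule: trace.induct)
  case trace_Nil
  then show ?case using root_notin_desc by (simp add: downs_def ups_def)
next
  case (trace_snoc w t a V c x b t' y)
  note IH = trace_snoc.IH[OF trace_snoc.prems]
  have a: "a < n" "a \<in> V" "par a \<in> V" using trace_less trace_basic trace_snoc(1)
    unfolding par_closed_def by blast+
  have D: "downs u (w @ [(a, b, t, t')]) = downs u w + (if a = par u \<and> b = u then 1 else 0)"
    and U: "ups u (w @ [(a, b, t, t')]) = ups u w + (if a = u \<and> b = par u then 1 else 0)"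
    by (auto simp: downs_def ups_def)
  have nd: "par u \<noteq> u" "par u \<notin> desc u" "u \<in> desc u"
    using par_neq par_notin_desc desc_refl trace_snoc.prems by auto
  consider "a = b" | "a \<noteq> b" "b = par a" | "a \<noteq> b" "a = par b"
    using trace_step[OF trace_snoc(1-4)] by auto
  then show ?case
  proof cases
    case 1
    then show ?thesis using IH D U nd a by (auto simp: insert_absorb)
  next
    case 2
    then have "a \<noteq> r" using par_r by auto
    \<comment> \<open>Prevents the step up from \<open>a\<close> from counting as a descent to
      \<open>b\<close> as well.\<close>
    then have ppa: "par b \<noteq> a" using par_par_neq a 2 by simp
    have V: "insert b V = V" using a 2 by auto
    show ?thesis
    proof (cases "u = a")
      case True
      then show ?thesis using IH nd 2 unfolding V D U by simp
    next
      case False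
      then have "a \<in> desc u \<longleftrightarrow> b \<in> desc u" using desc_par[of a u] a 2 by simp
      then show ?thesis using IH False ppa unfolding V D U by auto
    qed
  next
    case 3
    then have "b \<noteq> r" using par_r by auto
    then have ppb: "par a \<noteq> b" using par_par_neq trace_snoc(2) 3 by simp
    show ?thesis
    proof (cases "u = b")
      case True
      then show ?thesis using IH nd 3 unfolding D U by simp
    next
      case False
      then have "b \<in> desc u \<longleftrightarrow> a \<in> desc u" using desc_par[of b u] trace_snoc(2) 3 by simp
      then show ?thesis using IH False ppb unfolding D U by auto
    qed
  qed
qed

text \<open>Pure bookkeeping, valid wherever the walk ends: outside the core every descent is
  counted, also a repeated one. The summand 1 is the root.\<close>

lemma trace_count:
  "trace w t a V c x \<Longrightarrow> c = 1 + card (V \<inter> K - {r}) + (\<Sum>u\<in>{..<n} - K. downs u w)"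
proof (induction rule: trace.induct)
  case trace_Nil
  then show ?case by (simp add: downs_def)
next
  case (trace_snoc w t a V c x b t' y)
  have V: "r \<in> V" "finite V" using trace_basic[OF trace_snoc(1)]
    by (auto simp: par_closed_def intro: finite_subset)
  have "downs u (w @ [(a, b, t, t')]) = downs u w + (if u = b then if a = par b then 1 else 0 else 0)"
    for u by (auto simp: downs_def)
  then have "(\<Sum>u\<in>{..<n} - K. downs u (w @ [(a, b, t, t')])) =
      (\<Sum>u\<in>{..<n} - K. downs u w) + (if b \<notin> K \<and> a = par b then 1 else 0)"
    using trace_snoc(2) by (simp add: sum.distrib)
  moreover have "card (insert b V \<inter> K - {r}) =
      card (V \<inter> K - {r}) + (if b \<in> K \<and> b \<notin> V then 1 else 0)"
    using V by (auto simp: insert_absorb insert_Diff_if)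
  ultimately show ?case using trace_snoc.IH by (auto simp: fresh_def)
qed

text \<open>At the goal no edge outside the core has been descended more than once, so the descents
  outside the core count the visited vertices there, and with the visited core vertices they make up
  \<open>V\<close>.\<close>

lemma trace_count_goal:
  assumes tr: "trace w t goal V c x"
  shows "c = card V"
proof -
  have V: "r \<in> V" "finite V" "V \<subseteq> {..<n}" using trace_basic[OF tr]
    by (auto simp: par_closed_def intro: finite_subset)
  have "downs u w = (if u \<in> V then 1 else 0)" if u: "u \<in> {..<n} - K" for u
  proof -
    have ur: "u < n" "u \<noteq> r" "u \<notin> K" using u root_core by auto
    \<comment> \<open>A goal below \<open>u\<close> would pull \<open>u\<close> into the
      parent-closed core.\<close>
    have "goal \<notin> desc u"
      using par_closed_funpow[OF core_closed goal_core] ur(3) unfolding desc_def by auto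
    then have cr: "downs u w = ups u w" "u \<in> V \<longleftrightarrow> 0 < downs u w"
      using trace_crossings[OF tr ur(1,2)] by auto
    define P where "P = (\<lambda>(a, b, t :: nat, t' :: nat). a = par u \<and> b = u \<or> a = u \<and> b = par u)"
    \<comment> \<open>The times at which the walk crosses the edge above \<open>u\<close>, in either
      direction.\<close>
    define ts where "ts = map (\<lambda>(a, b, t, t'). (t, t')) (filter P w)"
    have w: "sorted_wrt (\<lambda>(u, v, s, s') (u', v', q, q'). s' \<le> q) w"
      and w2: "\<forall>(u, v, s, s') \<in> set w.
        u < n \<and> v < n \<and> 1 \<le> s \<and> s < s' \<and> s' \<le> t \<and> F u v s s' < \<infinity>"
      using trace_walk[OF tr] by - (elim conjE, assumption)+
    have tT: "t \<le> T" using trace_basic[OF tr] by simp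
    have "sorted_wrt (\<lambda>(t, t') (s, s'). t' \<le> s) ts"
      unfolding ts_def sorted_wrt_map
      using w by (intro sorted_wrt_filter) (simp add: case_prod_unfold)
    then have "successively (\<lambda>(t, t') (s, s'). t' \<le> s) ts"
      by (rule successively_if_sorted_wrt)
    moreover have "t1 \<in> {1..T} \<and> t2 \<in> {1..T} \<and> min (F (par u) u t1 t2) (F u (par u) t1 t2) < \<infinity>"
      if "(t1, t2) \<in> set ts" for t1 t2
    proof -
      obtain a b where ab: "(a, b, t1, t2) \<in> set w" "P (a, b, t1, t2)"
        using \<open>(t1, t2) \<in> set ts\<close> by (auto simp: ts_def)
      have "1 \<le> t1" "t1 < t2" "t2 \<le> t" "F a b t1 t2 < \<infinity>"
        using bspec[OF w2 ab(1)] by simp_all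
      moreover have "min (F (par u) u t1 t2) (F u (par u) t1 t2) < \<infinity>"
        using ab(2) \<open>F a b t1 t2 < \<infinity>\<close> by (auto simp only: P_def prod.case min_less_iff_disj)
      ultimately show ?thesis using tT by simp
    qed
    ultimately have "length ts \<le> 3" using few_traversals ur
      unfolding traversal_sequence_def by blast
    moreover have "length (filter P w) = downs u w + ups u w" for w
      unfolding downs_def ups_def P_def using par_neq[OF ur(1,2)]
      by (induction w) auto
    then have "length ts = downs u w + ups u w" by (simp add: ts_def)
    \<comment> \<open>Twice \<open>downs u w\<close> is at most 3, so there is at most one
      descent.\<close>
    ultimately show ?thesis using cr by auto
  qed
  then have "(\<Sum>u\<in>{..<n} - K. downs u w) = (\<Sum>u\<in>{..<n} - K. if u \<in> V then 1 else 0)" by simp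
  also have "\<dots> = card (V - K)" using V(3)
    by (auto simp: sum.If_cases intro!: arg_cong[of _ _ card])
  finally have "c = 1 + card (V \<inter> K - {r}) + card (V - K)" using trace_count[OF tr] by linarith
  also have "1 + card (V \<inter> K - {r}) = card (V \<inter> K)"
    unfolding plus_1_eq_Suc by (rule card_Suc_Diff1) (use V root_core in auto)
  also have "card (V \<inter> K) + card (V - K) = card V"
    using V(2) by (rule card_Int_Diff[symmetric])
  finally show ?thesis .
qed

section \<open>Valid walks as padded walks\<close>

text \<open>A later departure is bridged by a free waiting step at \<open>a\<close>, which visits
  nothing new.\<close>

lemma trace_extend:
  assumes tr: "trace w t a V c x" and st: "t \<le> s" "s < s'" "s' \<le> T" "b < n" "F a b s s' = enat y"
  shows "\<exists>w' c'. trace w' s' b (insert b V) c' (x + y)"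
proof -
  note a = trace_less[OF tr] trace_basic[OF tr]
  have "\<exists>w' c'. trace w' s a V c' x"
  proof (cases "t = s")
    case False
    have "F a a t s = enat 0" using F_stay[of a t s] a st False by (simp add: zero_enat_def)
    from trace_snoc[OF tr a(1) _ this] False st a(2) show ?thesis
      by (auto simp: insert_absorb)
  qed (use tr in auto)
  then show ?thesis using trace_snoc[of _ s a V _ x b s' y] st by (meson greaterThanAtMost_iff)
qed

text \<open>The arrival time of the last step is part of the claim, because the induction appends
  steps at the end and has to compare it with the next departure.\<close>

lemma valid_walk_trace:
  assumes "valid_walk {..<n} T F w" "walk_start w = r"
  shows "\<exists>w' c x t. trace w' t (walk_end w) (visited w) c x \<and> walk_cost F w = enat x \<and>
    t = snd (snd (snd (last w)))"
  using assms
proof (induction w rule: rev_induct)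
  case (snoc s w)
  obtain a b t t' where s: "s = (a, b, t, t')" by (cases s)
  have st: "a < n" "b < n" "1 \<le> t" "t' \<le> T" "t < t'" "F a b t t' < \<infinity>"
    using snoc.prems by (auto simp: valid_walk_def s)
  then obtain y where y: "F a b t t' = enat y" by auto
  have "\<exists>w' c x q. trace w' q a (insert a (visited w)) c x \<and> walk_cost F w = enat x \<and> q \<le> t"
  proof (cases "w = []")
    case True
    then have "a = r" using snoc.prems(2) by (simp add: s walk_start_def)
    then show ?thesis using trace_Nil True st
      by (fastforce simp: visited_def walk_cost_def zero_enat_def)
  next
    case False
    have succ: "successively (\<lambda>(u, v, t, t') (x, y, s, s'). v = x \<and> t' \<le> s) w"
      "case last w of (u, v, q, q') \<Rightarrow> v = a \<and> q' \<le> t"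
      using snoc.prems(1) False by (auto simp: valid_walk_def successively_append_iff s
          split: prod.splits)
    have vw: "valid_walk {..<n} T F w" using snoc.prems(1) False succ by (auto simp: valid_walk_def)
    have "walk_start w = r" using snoc.prems(2) False by (simp add: walk_start_def)
    from snoc.IH[OF vw this] obtain w' c x q where
      tr: "trace w' q (walk_end w) (visited w) c x" "walk_cost F w = enat x" "q = snd (snd (snd (last w)))"
      by auto
    have "walk_end w = a" "q \<le> t" using succ(2) tr(3) by (auto simp: walk_end_def split: prod.splits)
    then show ?thesis using tr trace_basic[OF tr(1)] by (auto simp: insert_absorb)
  qed
  then obtain w' c x q where tr: "trace w' q a (insert a (visited w)) c x"
    "walk_cost F w = enat x" "q \<le> t" by auto
  from trace_extend[OF tr(1) tr(3) st(5,4,2) y] obtain w'' c' where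
    "trace w'' t' b (insert b (insert a (visited w))) c' (x + y)" by auto
  moreover have "visited (w @ [s]) = insert b (insert a (visited w))" by (auto simp: visited_def s)
  moreover have "walk_cost F (w @ [s]) = enat (x + y)" using tr(2) y by (simp add: walk_cost_def s)
  ultimately show ?case by (auto simp: s walk_end_def)
qed (simp add: valid_walk_def)

section \<open>Projection to the remembered state\<close>

text \<open>\<open>fresh\<close> looks at the visited set only inside the core, so it cannot tell
  \<open>V \<inter> K\<close> from \<open>V\<close>; and capping at \<open>k\<close> commutes with
  counting.\<close>

lemma trace_reach:
  "trace w t a V c x \<Longrightarrow> reach t a (V \<inter> K) (min k c) x"
proof (induction rule: trace.induct)
  case trace_Nil
  then show ?case using reach_init k_pos root_core by simp
next
  case (trace_snoc w t a V c x b t' y)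
  have fr: "fresh (V \<inter> K) a b = fresh V a b" by (auto simp: fresh_def)
  have S: "(if b \<in> K then insert b (V \<inter> K) else V \<inter> K) = insert b V \<inter> K" by auto
  have c: "(if fresh V a b \<and> min k c < k then Suc (min k c) else min k c) =
      min k (if fresh V a b then Suc c else c)" by auto
  show ?case using reach_step[OF trace_snoc.IH trace_snoc(2-4)] unfolding fr S c .
qed

lemma reach_trace:
  "reach t a S c x \<Longrightarrow> \<exists>w V c'. trace w t a V c' x \<and> S = V \<inter> K \<and> c = min k c'"
proof (induction rule: reach.induct)
  case reach_init
  then show ?case using trace_Nil k_pos root_core by fastforce
next
  case (reach_step t a S c x b t' y)
  then obtain w V c' where tr: "trace w t a V c' x" "S = V \<inter> K" "c = min k c'" by auto
  have "fresh S a b = fresh V a b" using tr by (auto simp: fresh_def)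
  with trace_snoc[OF tr(1) reach_step(2-4)] tr(2,3) show ?case
    by (intro exI conjI) (assumption | auto simp: min_def)+
qed

lemma reach_basic:
  assumes "reach t a S c x"
  shows "1 \<le> t" "t \<le> T" "a < n" "par_closed S" "S \<subseteq> K" "c \<le> k"
proof -
  obtain w V c' where tr: "trace w t a V c' x" "S = V \<inter> K" "c = min k c'"
    using reach_trace[OF assms] by auto
  show "1 \<le> t" "t \<le> T" "a < n" "par_closed S" "S \<subseteq> K" "c \<le> k"
    using tr trace_basic[OF tr(1)] trace_less[OF tr(1)] core_closed by (auto simp: par_closed_def)
qed

text \<open>The capped counter equals \<open>k\<close> exactly if the uncapped one is at least
  \<open>k\<close>, and at the goal the uncapped one is the number of visited vertices.\<close>

theorem reach_iff_orienteering:
  "(\<exists>S x. reach T goal S k x \<and> x \<le> f) \<longleftrightarrow> temporal_orienteering {..<n} T F r goal k f"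
proof
  assume "\<exists>S x. reach T goal S k x \<and> x \<le> f"
  then obtain S x w V c where x: "x \<le> f" and tr: "trace w T goal V c x" "k = min k c"
    using reach_trace by metis
  note w = trace_walk[OF tr(1)]
  \<comment> \<open>The empty walk ends at time 1, which is before \<open>T\<close>.\<close>
  have ne: "w \<noteq> []" using w T_ge by auto
  then have "r \<in> visited w" using w by (cases w) (auto simp: walk_start_def visited_def)
  then have "card (visited w) \<ge> k" using w tr trace_count_goal[OF tr(1)] by (simp add: insert_absorb)
  moreover have "valid_walk {..<n} T F w" using w ne by (fastforce simp: valid_walk_def)
  ultimately show "temporal_orienteering {..<n} T F r goal k f"
    unfolding temporal_orienteering_def using w ne x by (intro exI[of _ w]) auto
next
  assume "temporal_orienteering {..<n} T F r goal k f"
  then obtain w where w: "valid_walk {..<n} T F w" "walk_start w = r" "walk_end w = goal"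
    "k \<le> card (visited w)" "walk_cost F w \<le> enat f"
    unfolding temporal_orienteering_def by auto
  from valid_walk_trace[OF w(1,2)] w obtain w' c x t where
    tr: "trace w' t goal (visited w) c x" "x \<le> f" by auto
  \<comment> \<open>Waiting at the goal postpones the arrival to \<open>T\<close>, the only time
    that is inspected.\<close>
  have "\<exists>w' c. trace w' T goal (visited w) c x"
  proof (cases "t = T")
    case False
    have "F goal goal t T = 0"
      using F_stay[of goal t T] trace_less[OF tr(1)] trace_basic[OF tr(1)] False by simp
    then have "F goal goal t T = enat 0" by (simp add: zero_enat_def)
    from trace_snoc[OF tr(1) trace_less[OF tr(1)] _ this] show ?thesis
      using False trace_basic[OF tr(1)] by (auto simp: insert_absorb)
  qed (use tr in auto)
  then obtain w' c where tr': "trace w' T goal (visited w) c x" by auto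
  with trace_reach[OF tr'] trace_count_goal[OF tr'] w(4) tr(2)
  show "\<exists>S x. reach T goal S k x \<and> x \<le> f" by (auto simp: min_def split: if_splits)
qed

end

section \<open>Total correctness with time bounds\<close>

text \<open>\<open>m\<close> is only an upper bound, so that times can be weakened like
  postconditions. What a program leaves untouched need not appear in \<open>Q\<close>:
  \<open>frame\<close> supplies it in the rules for weakening, sequences and loops.\<close>

definition runs :: "nat cost \<Rightarrow> com \<Rightarrow> store \<Rightarrow> nat \<Rightarrow> (store \<Rightarrow> bool) \<Rightarrow> bool" where
  "runs F c s m Q \<longleftrightarrow> (\<exists>m' s'. exec F c s m' s' \<and> m' \<le> m \<and> Q s')"

abbreviation set_var :: "store \<Rightarrow> vname \<Rightarrow> nat \<Rightarrow> store" where
  "set_var s x a \<equiv> s\<lparr>scalar := (scalar s)(x := a)\<rparr>"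

abbreviation set_arr :: "store \<Rightarrow> vname \<Rightarrow> nat \<Rightarrow> nat \<Rightarrow> store" where
  "set_arr s x i a \<equiv> s\<lparr>arr := (arr s)(x := (arr s x)(i := a))\<rparr>"

fun written_vars :: "com \<Rightarrow> vname set" where
  "written_vars Skip = {}"
| "written_vars (Assign x a) = {x}"
| "written_vars (Store x a b) = {}"
| "written_vars (Seq c d) = written_vars c \<union> written_vars d"
| "written_vars (Cond b c d) = written_vars c \<union> written_vars d"
| "written_vars (While b c) = written_vars c"

fun written_arrs :: "com \<Rightarrow> vname set" where
  "written_arrs Skip = {}"
| "written_arrs (Assign x a) = {}"
| "written_arrs (Store x a b) = {x}"
| "written_arrs (Seq c d) = written_arrs c \<union> written_arrs d"
| "written_arrs (Cond b c d) = written_arrs c \<union> written_arrs d"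
| "written_arrs (While b c) = written_arrs c"

definition frame :: "com \<Rightarrow> store \<Rightarrow> store \<Rightarrow> bool" where
  "frame c s s' \<longleftrightarrow>
     (\<forall>x. x \<notin> written_vars c \<longrightarrow> scalar s' x = scalar s x) \<and>
     (\<forall>x. x \<notin> written_arrs c \<longrightarrow> arr s' x = arr s x)"

lemma exec_frame: "exec F c s m s' \<Longrightarrow> frame c s s'"
  by (induction rule: exec.induct) (auto simp: frame_def)

lemma runs_weaken:
  "runs F c s m Q \<Longrightarrow> m \<le> m' \<Longrightarrow> (\<And>s'. frame c s s' \<Longrightarrow> Q s' \<Longrightarrow> Q' s') \<Longrightarrow> runs F c s m' Q'"
  unfolding runs_def using exec_frame by (meson order_trans)

lemma runs_Seq:
  assumes "runs F c s m P" "\<And>s'. frame c s s' \<Longrightarrow> P s' \<Longrightarrow> runs F d s' m' Q" "m + m' \<le> M"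
  shows "runs F (Seq c d) s M Q"
proof -
  obtain k s' where k: "exec F c s k s'" "k \<le> m" "P s'" using assms(1) unfolding runs_def by auto
  obtain k' s'' where k': "exec F d s' k' s''" "k' \<le> m'" "Q s''"
    using assms(2)[OF exec_frame[OF k(1)] k(3)] unfolding runs_def by auto
  have "exec F (Seq c d) s (k + k') s''" using k(1) k'(1) by (rule exec.Seq)
  then show ?thesis unfolding runs_def using k k' assms(3)
    by (intro exI[of _ "k + k'"] exI[of _ s'']) auto
qed

lemma runs_Cond:
  assumes "bval F s b \<Longrightarrow> runs F c s m Q" "\<not> bval F s b \<Longrightarrow> runs F d s m Q" "Suc m \<le> M"
  shows "runs F (Cond b c d) s M Q"
proof (cases "bval F s b")
  case True
  then obtain k s' where "exec F c s k s'" "k \<le> m" "Q s'" using assms(1) unfolding runs_def by auto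
  then show ?thesis unfolding runs_def using exec.CondTrue[OF True] assms(3)
    by (intro exI[of _ "Suc k"] exI[of _ s']) auto
next
  case False
  then obtain k s' where "exec F d s k s'" "k \<le> m" "Q s'" using assms(2) unfolding runs_def by auto
  then show ?thesis unfolding runs_def using exec.CondFalse[OF False] assms(3)
    by (intro exI[of _ "Suc k"] exI[of _ s']) auto
qed

text \<open>A loop-free program is a function on stores. The simplifier can evaluate
  \<open>result\<close>, and \<open>runs_straight\<close> turns this into a statement about
  execution.\<close>

fun straight :: "com \<Rightarrow> bool" where
  "straight Skip = True"
| "straight (Assign x a) = True"
| "straight (Store x a b) = True"
| "straight (Seq c d) = (straight c \<and> straight d)"
| "straight (Cond b c d) = (straight c \<and> straight d)"
| "straight (While b c) = False"

fun straight_time :: "com \<Rightarrow> nat" where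
  "straight_time (Seq c d) = straight_time c + straight_time d"
| "straight_time (Cond b c d) = Suc (max (straight_time c) (straight_time d))"
| "straight_time _ = 1"

fun result :: "nat cost \<Rightarrow> com \<Rightarrow> store \<Rightarrow> store" where
  "result F Skip s = s"
| "result F (Assign x a) s = set_var s x (aval F s a)"
| "result F (Store x a b) s = set_arr s x (aval F s a) (aval F s b)"
| "result F (Seq c d) s = result F d (result F c s)"
| "result F (Cond b c d) s = (if bval F s b then result F c s else result F d s)"
| "result F (While b c) s = s"

lemma runs_straight:
  assumes "straight c" "straight_time c \<le> m" "Q (result F c s)"
  shows "runs F c s m Q"
proof -
  have "\<exists>k. exec F c s k (result F c s) \<and> k \<le> straight_time c" using assms(1)
  proof (induction c arbitrary: s)
    case (Seq c d)
    then show ?case by (fastforce intro: exec.Seq add_mono)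
  next
    case (Cond b c d)
    show ?case
    proof (cases "bval F s b")
      case True
      then show ?thesis using Cond by (fastforce intro: exec.CondTrue max.coboundedI1)
    next
      case False
      then show ?thesis using Cond by (fastforce intro: exec.CondFalse max.coboundedI2)
    qed
  qed (auto intro: exec.intros)
  then show ?thesis using assms(2,3) unfolding runs_def by (meson order_trans)
qed

section \<open>Counting loops\<close>

definition For :: "vname \<Rightarrow> aexp \<Rightarrow> aexp \<Rightarrow> com \<Rightarrow> com" where
  "For x lo hi c =
     Seq (Assign x lo)
       (While (Less (Var x) hi) (Seq c (Assign x (Plus (Var x) (Num 1)))))"

lemma written_For [simp]:
  "written_vars (For x lo hi c) = insert x (written_vars c)"
  "written_arrs (For x lo hi c) = written_arrs c"
  "straight (For x lo hi c) = False"
  by (auto simp: For_def)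

text \<open>\<open>hi\<close> is evaluated anew in every round and so must be constant on all stores
  that the loop can produce. The invariant is re-established for the advanced counter. The time
  consists of one assignment, one failing test and, per round, the body, the test and the
  increment.\<close>

lemma runs_For:
  assumes lo: "aval F s lo = l" "l \<le> B"
    and hi: "\<And>s'. frame (For x lo hi c) s s' \<Longrightarrow> aval F s' hi = B"
    and x: "x \<notin> written_vars c"
    and init: "I l (set_var s x l)"
    and step: "\<And>j s'. l \<le> j \<Longrightarrow> j < B \<Longrightarrow> frame (For x lo hi c) s s' \<Longrightarrow> scalar s' x = j \<Longrightarrow> I j s' \<Longrightarrow>
      runs F c s' m (\<lambda>s''. I (Suc j) (set_var s'' x (Suc j)))"
    and fin: "\<And>s'. I B s' \<Longrightarrow> scalar s' x = B \<Longrightarrow> Q s'"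
    and M: "2 + (B - l) * (m + 2) \<le> M"
  shows "runs F (For x lo hi c) s M Q"
proof -
  let ?w = "While (Less (Var x) hi) (Seq c (Assign x (Plus (Var x) (Num 1))))"
  \<comment> \<open>\<open>d\<close> is the number of remaining rounds.\<close>
  have loop: "runs F ?w s' (1 + d * (m + 2)) (\<lambda>s''. I B s'' \<and> scalar s'' x = B)"
    if "l \<le> j" "j + d = B" "frame (For x lo hi c) s s'" "scalar s' x = j" "I j s'" for d j s'
    using that
  proof (induction d arbitrary: j s')
    case 0
    then have "exec F ?w s' 1 s'" using hi by (intro exec.WhileFalse) auto
    then show ?case using 0 by (auto simp: runs_def)
  next
    case (Suc d)
    then obtain k s1 where k: "exec F c s' k s1" "k \<le> m" "I (Suc j) (set_var s1 x (Suc j))"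
      using step[of j s'] unfolding runs_def by auto
    have fr: "frame c s' s1" using exec_frame[OF k(1)] .
    then have sx: "scalar s1 x = j" using x Suc.prems by (simp add: frame_def)
    let ?s2 = "set_var s1 x (Suc j)"
    have body: "exec F (Seq c (Assign x (Plus (Var x) (Num 1)))) s' (k + 1) ?s2"
      using exec.Seq[OF k(1) exec.Assign[of F x "Plus (Var x) (Num 1)" s1]] sx by simp
    have "frame (For x lo hi c) s ?s2" using fr Suc.prems(3) by (auto simp: frame_def)
    with Suc.IH[of "Suc j" ?s2] Suc.prems k(3) obtain k' s3 where
      k': "exec F ?w ?s2 k' s3" "k' \<le> 1 + d * (m + 2)" "I B s3 \<and> scalar s3 x = B"
      unfolding runs_def by auto
    have "bval F s' (Less (Var x) hi)" using Suc.prems hi by simp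
    from exec.WhileTrue[OF this body k'(1)] k k' show ?case unfolding runs_def
      by (intro exI[of _ "Suc (k + 1 + k')"] exI[of _ s3]) auto
  qed
  show ?thesis unfolding For_def
  proof (rule runs_Seq)
    show "runs F (Assign x lo) s 1 (\<lambda>s'. s' = set_var s x l)"
      using lo by (intro runs_straight) auto
    fix s' assume "s' = set_var s x l"
    then show "runs F ?w s' (1 + (B - l) * (m + 2)) Q"
      using loop[of l "B - l" s'] init lo fin unfolding runs_def
      by (auto simp: frame_def) 
  qed (use M in auto)
qed

section \<open>Rooting the tree\<close>

notation Seq (infixr ";;" 60)

section \<open>Powers of two and row offsets by repeated addition\<close>

text \<open>A state occupies \<open>n\<close> bit positions for the set, \<open>n\<close> for the
  vertex, \<open>k + 1\<close> for the counter and \<open>T + 1\<close> for the time, counting time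
  0; the highest position is \<open>2 * n + k + T + 1\<close>.\<close>

definition powers_prog :: com where
  "powers_prog =
     Store ''p'' (Num 0) (Num 1) ;;
     For ''i'' (Num 0) (Plus (Plus (Var ''n'') (Var ''n'')) (Plus (Plus (Var ''k'') (Var ''T'')) (Num 1)))
       (Store ''p'' (Plus (Var ''i'') (Num 1)) (Plus (Arr ''p'' (Var ''i'')) (Arr ''p'' (Var ''i''))))"

lemma runs_powers:
  assumes "B = 2 * scalar s ''n'' + scalar s ''k'' + scalar s ''T'' + 1"
  shows "runs F powers_prog s (3 + 3 * B) (\<lambda>s'. \<forall>i\<le>B. arr s' ''p'' i = 2 ^ i)"
  unfolding powers_prog_def
proof (rule runs_Seq)
  show "runs F (Store ''p'' (Num 0) (Num 1)) s 1 (\<lambda>s'. s' = set_arr s ''p'' 0 1)"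
    by (rule runs_straight) auto
  fix s' assume s': "s' = set_arr s ''p'' 0 1"
  show "runs F (For ''i'' (Num 0) (Plus (Plus (Var ''n'') (Var ''n'')) (Plus (Plus (Var ''k'') (Var ''T'')) (Num 1)))
       (Store ''p'' (Plus (Var ''i'') (Num 1)) (Plus (Arr ''p'' (Var ''i'')) (Arr ''p'' (Var ''i'')))))
       s' (2 + B * 3) (\<lambda>s'. \<forall>i\<le>B. arr s' ''p'' i = 2 ^ i)"
    by (rule runs_For[where l = 0 and B = B and I = "\<lambda>j s. \<forall>i\<le>j. arr s ''p'' i = 2 ^ i" and m = 1])
      (auto simp: s' assms frame_def le_Suc_eq intro!: runs_straight)
qed auto

definition rows_prog :: com where
  "rows_prog =
     For ''i'' (Num 0) (Var ''n'')
       (Store ''row'' (Plus (Var ''i'') (Num 1)) (Plus (Arr ''row'' (Var ''i'')) (Var ''n'')))"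

lemma runs_rows:
  assumes "scalar s ''n'' = n" "arr s ''row'' 0 = 0"
  shows "runs F rows_prog s (2 + 3 * n) (\<lambda>s'. \<forall>i\<le>n. arr s' ''row'' i = i * n)"
  unfolding rows_prog_def
  by (rule runs_For[where l = 0 and B = n and I = "\<lambda>j s. \<forall>i\<le>j. arr s ''row'' i = i * n" and m = 1])
      (auto simp: assms frame_def le_Suc_eq intro!: runs_straight)

section \<open>Breadth-first search\<close>

definition bfs_body :: com where
  "bfs_body =
     Cond (Conj (Less (Num 0) (Arr ''adj'' (Plus (Arr ''row'' (Var ''v'')) (Var ''u''))))
                (Less (Arr ''seen'' (Var ''u'')) (Num 1)))
       (Store ''seen'' (Var ''u'') (Num 1) ;;
        Store ''par'' (Var ''u'') (Var ''v'') ;;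
        Store ''ord'' (Var ''cnt'') (Var ''u'') ;;
        Assign ''cnt'' (Plus (Var ''cnt'') (Num 1)))
       Skip"

definition bfs_init :: com where
  "bfs_init =
     Store ''ord'' (Num 0) (Var ''vs'') ;;
     Store ''par'' (Var ''vs'') (Var ''vs'') ;;
     Store ''seen'' (Var ''vs'') (Num 1) ;;
     Assign ''cnt'' (Num 1)"

definition bfs_prog :: com where
  "bfs_prog =
     bfs_init ;;
     For ''j'' (Num 0) (Var ''n'')
       (Assign ''v'' (Arr ''ord'' (Var ''j'')) ;; For ''u'' (Num 0) (Var ''n'') bfs_body)"

lemmas prog_simps = bfs_body_def bfs_init_def

text \<open>\<open>ord\<close> doubles as the queue: its first \<open>cnt\<close> entries are the
  discovered vertices in order of discovery, and \<open>seen\<close> marks exactly these, so that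
  discovery is tested in constant time.\<close>

definition bfs_inv :: "nat \<Rightarrow> nat set set \<Rightarrow> nat \<Rightarrow> store \<Rightarrow> bool" where
  "bfs_inv n E r s \<longleftrightarrow>
     (let ord = arr s ''ord''; par = arr s ''par''; c = scalar s ''cnt'' in
      0 < c \<and> ord 0 = r \<and> par r = r \<and> inj_on ord {..<c} \<and> ord ` {..<c} \<subseteq> {..<n} \<and>
      (\<forall>u<n. arr s ''seen'' u > 0 \<longleftrightarrow> u \<in> ord ` {..<c}) \<and>
      (\<forall>i. 0 < i \<longrightarrow> i < c \<longrightarrow> (\<exists>h<i. par (ord i) = ord h \<and> {ord h, ord i} \<in> E)))"

definition scanned :: "nat \<Rightarrow> nat set set \<Rightarrow> nat \<Rightarrow> nat \<Rightarrow> store \<Rightarrow> bool" where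
  "scanned n E v b s \<longleftrightarrow> (\<forall>u<b. {v, u} \<in> E \<longrightarrow> u \<in> arr s ''ord'' ` {..<scalar s ''cnt''})"

text \<open>The queue is only appended to; this keeps earlier scans and queue positions
  valid.\<close>

definition bfs_ext :: "store \<Rightarrow> store \<Rightarrow> bool" where
  "bfs_ext s s' \<longleftrightarrow> scalar s ''cnt'' \<le> scalar s' ''cnt'' \<and>
     (\<forall>i<scalar s ''cnt''. arr s' ''ord'' i = arr s ''ord'' i)"

lemma bfs_body_step:
  assumes inv: "bfs_inv n E r s" and u: "u < n" "scalar s ''u'' = u"
    and v: "scalar s ''v'' = v" "v < n" "h < scalar s ''cnt''" "arr s ''ord'' h = v"
    and row: "arr s ''row'' v = v * n"
    and adj: "\<And>i. arr s ''adj'' i = (if i < n * n \<and> {i div n, i mod n} \<in> E then 1 else 0)"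
  shows "runs F bfs_body s 5 (\<lambda>s'. bfs_inv n E r s' \<and> bfs_ext s s' \<and>
    ({v, u} \<in> E \<longrightarrow> u \<in> arr s' ''ord'' ` {..<scalar s' ''cnt''}))"
proof -
  \<comment> \<open>The index lies inside the matrix; beyond \<open>n * n\<close> the array is zero
    regardless of \<open>E\<close>.\<close>
  have lt: "v * n + u < n * n"
  proof -
    have "v * n + u < Suc v * n" using u by simp
    also have "\<dots> \<le> n * n" using v(2) by (intro mult_right_mono) auto
    finally show ?thesis .
  qed
  have "(v * n + u) div n = v" "(v * n + u) mod n = u" using u by auto
  with lt have a: "arr s ''adj'' (v * n + u) > 0 \<longleftrightarrow> {v, u} \<in> E" by (simp add: adj)
  let ?c = "scalar s ''cnt''" and ?o = "arr s ''ord''" and ?p = "arr s ''par''"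
  show ?thesis
  proof (cases "{v, u} \<in> E \<and> u \<notin> ?o ` {..<?c}")
    case False
    then have "\<not> (arr s ''adj'' (v * n + u) > 0 \<and> arr s ''seen'' u = 0)"
      using a inv u by (auto simp: bfs_inv_def Let_def)
    then have "result F bfs_body s = s" by (auto simp: prog_simps u v row)
    then show ?thesis using inv False
      by (intro runs_straight) (auto simp: prog_simps bfs_ext_def)
  next
    case True
    then have c: "arr s ''adj'' (v * n + u) > 0" "arr s ''seen'' u = 0"
      using a inv u by (auto simp: bfs_inv_def Let_def)
    define s' where "s' = result F bfs_body s"
    have s': "arr s' ''ord'' = ?o(?c := u)" "arr s' ''par'' = ?p(u := v)"
      "arr s' ''seen'' = (arr s ''seen'')(u := 1)" "scalar s' ''cnt'' = Suc ?c"
      using c by (simp_all add: s'_def prog_simps u v row)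
    have inv': "0 < ?c" "?o 0 = r" "?p r = r" "inj_on ?o {..<?c}" "?o ` {..<?c} \<subseteq> {..<n}"
      "\<And>u. u < n \<Longrightarrow> arr s ''seen'' u > 0 \<longleftrightarrow> u \<in> ?o ` {..<?c}"
      "\<And>i. 0 < i \<Longrightarrow> i < ?c \<Longrightarrow> \<exists>h<i. ?p (?o i) = ?o h \<and> {?o h, ?o i} \<in> E"
      using inv by (auto simp: bfs_inv_def Let_def)
    have im: "(?o(?c := u)) ` {..<Suc ?c} = insert u (?o ` {..<?c})"
      by (auto simp: lessThan_Suc)
    \<comment> \<open>The new vertex is not the root, so setting its parent leaves
      \<open>par r = r\<close> intact.\<close>
    have "r \<noteq> u" using True inv'(1,2) by auto
    have "inj_on (?o(?c := u)) {..<Suc ?c}" using inv'(4) True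
      by (auto simp: lessThan_Suc inj_on_def)
    moreover have "\<exists>h<i. (?p(u := v)) ((?o(?c := u)) i) = (?o(?c := u)) h \<and>
        {(?o(?c := u)) h, (?o(?c := u)) i} \<in> E" if i: "0 < i" "i < Suc ?c" for i
    proof (cases "i = ?c")
      case True
      then show ?thesis using v \<open>{v, u} \<in> E \<and> _\<close> by (intro exI[of _ h]) auto
    next
      case False
      then have "i < ?c" "?o i \<noteq> u" using i True by auto
      then obtain h where "h < i" "?p (?o i) = ?o h" "{?o h, ?o i} \<in> E" using inv'(7) i by blast
      then show ?thesis using \<open>i < ?c\<close> \<open>?o i \<noteq> u\<close> by (intro exI[of _ h]) auto
    qed
    ultimately have "bfs_inv n E r s'"
      unfolding bfs_inv_def Let_def s' im using inv' u \<open>r \<noteq> u\<close> by auto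
    moreover have "bfs_ext s s'" by (simp add: bfs_ext_def s')
    moreover have "u \<in> arr s' ''ord'' ` {..<scalar s' ''cnt''}" by (simp add: s' im)
    ultimately show ?thesis unfolding s'_def
      by (intro runs_straight) (simp_all only:, simp_all add: bfs_body_def)
  qed
qed

lemma bfs_set_var [simp]:
  assumes "x \<noteq> ''cnt''"
  shows "bfs_inv n E r (set_var s x a) = bfs_inv n E r s"
    and "scanned n E v b (set_var s x a) = scanned n E v b s"
    and "bfs_ext s (set_var s' x a) = bfs_ext s s'"
    and "bfs_ext (set_var s x a) s' = bfs_ext s s'"
  using assms by (simp_all add: bfs_inv_def scanned_def bfs_ext_def)

lemma bfs_ext_image: "bfs_ext s s' \<Longrightarrow>
    arr s ''ord'' ` {..<scalar s ''cnt''} \<subseteq> arr s' ''ord'' ` {..<scalar s' ''cnt''}"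
  unfolding bfs_ext_def by (metis (no_types, lifting) image_mono image_cong lessThan_iff lessThan_subset_iff)

lemma scanned_ext: "scanned n E v b s \<Longrightarrow> bfs_ext s s' \<Longrightarrow> scanned n E v b s'"
  unfolding scanned_def using bfs_ext_image by blast

lemma bfs_ext_trans: "bfs_ext s s' \<Longrightarrow> bfs_ext s' s'' \<Longrightarrow> bfs_ext s s''"
  by (auto simp: bfs_ext_def)

lemma bfs_scan:
  assumes inv: "bfs_inv n E r s" and n: "scalar s ''n'' = n"
    and v: "scalar s ''v'' = v" "v < n" "h < scalar s ''cnt''" "arr s ''ord'' h = v"
    and row: "arr s ''row'' v = v * n"
    and adj: "\<And>i. arr s ''adj'' i = (if i < n * n \<and> {i div n, i mod n} \<in> E then 1 else 0)"
  shows "runs F (For ''u'' (Num 0) (Var ''n'') bfs_body) s (2 + 7 * n)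
    (\<lambda>s'. bfs_inv n E r s' \<and> bfs_ext s s' \<and> scanned n E v n s')"
proof (rule runs_For[where l = 0 and B = n and m = 5 and
      I = "\<lambda>u s'. bfs_inv n E r s' \<and> bfs_ext s s' \<and> scanned n E v u s'"])
  fix u s'
  assume u: "u < n" "scalar s' ''u'' = u"
    and fr: "frame (For ''u'' (Num 0) (Var ''n'') bfs_body) s s'"
    and I: "bfs_inv n E r s' \<and> bfs_ext s s' \<and> scanned n E v u s'"
  have fr': "scalar s' ''v'' = v" "arr s' ''row'' v = v * n" "arr s' ''adj'' = arr s ''adj''"
    using fr v row by (simp_all add: frame_def bfs_body_def)
  have "runs F bfs_body s' 5 (\<lambda>s''. bfs_inv n E r s'' \<and> bfs_ext s' s'' \<and>
    ({v, u} \<in> E \<longrightarrow> u \<in> arr s'' ''ord'' ` {..<scalar s'' ''cnt''}))"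
    by (rule bfs_body_step[where h = h]) (use I u fr' v adj in \<open>auto simp: bfs_ext_def\<close>)
  then show "runs F bfs_body s' 5 (\<lambda>s''. bfs_inv n E r (set_var s'' ''u'' (Suc u)) \<and>
      bfs_ext s (set_var s'' ''u'' (Suc u)) \<and> scanned n E v (Suc u) (set_var s'' ''u'' (Suc u)))"
  proof (rule runs_weaken)
    fix s''
    assume s'': "bfs_inv n E r s'' \<and> bfs_ext s' s'' \<and>
      ({v, u} \<in> E \<longrightarrow> u \<in> arr s'' ''ord'' ` {..<scalar s'' ''cnt''})"
    then have "scanned n E v u s''" using I scanned_ext by blast
    then have "scanned n E v (Suc u) s''" using s'' by (auto simp: scanned_def less_Suc_eq)
    then show "bfs_inv n E r (set_var s'' ''u'' (Suc u)) \<and>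
      bfs_ext s (set_var s'' ''u'' (Suc u)) \<and> scanned n E v (Suc u) (set_var s'' ''u'' (Suc u))"
      using I s'' bfs_ext_trans by auto
  qed simp
qed (use assms in \<open>auto simp: frame_def bfs_body_def scanned_def bfs_ext_def\<close>)

lemma connected_closed_set:
  assumes "connected_graph {..<n :: nat} E" "r \<in> X" "r < n"
    and cl: "\<And>u v. u \<in> X \<Longrightarrow> v < n \<Longrightarrow> {u, v} \<in> E \<Longrightarrow> v \<in> X" and E: "\<And>u v. {u, v} \<in> E \<Longrightarrow> v < n"
  shows "{..<n} \<subseteq> X"
proof
  fix v assume "v \<in> {..<n}"
  then have "(r, v) \<in> {(x, y). {x, y} \<in> E}\<^sup>*"
    using assms(1,3) by (auto simp: connected_graph_def)
  then show "v \<in> X" by (induction rule: rtrancl_induct) (use assms(2) cl E in auto)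
qed

lemma tree_edge_less: "tree {..<n :: nat} E \<Longrightarrow> {u, v} \<in> E \<Longrightarrow> v < n"
  unfolding tree_def forest_def simple_graph_def by (fastforce simp: doubleton_eq_iff)

text \<open>The queue never runs dry before round \<open>n\<close>: otherwise all discovered
  vertices would have been scanned, and connectivity would make them the whole vertex set.\<close>

lemma runs_bfs:
  assumes tree: "tree {..<n} E" and n: "scalar s ''n'' = n" and r: "scalar s ''vs'' = r" "r < n"
    and row: "\<forall>i\<le>n. arr s ''row'' i = i * n" and seen: "\<forall>i. arr s ''seen'' i = 0"
    and adj: "\<forall>i. arr s ''adj'' i = (if i < n * n \<and> {i div n, i mod n} \<in> E then 1 else 0)"
  shows "runs F bfs_prog s (6 + n * (5 + 7 * n))
    (\<lambda>s'. rooted n r (arr s' ''par'') (arr s' ''ord'') \<and>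
      (\<forall>v<n. v \<noteq> r \<longrightarrow> {arr s' ''par'' v, v} \<in> E))"
  unfolding bfs_prog_def
proof (rule runs_Seq)
  show "runs F bfs_init s 4 (bfs_inv n E r)"
    by (rule runs_straight) (use r seen in \<open>auto simp: prog_simps bfs_inv_def inj_on_def\<close>)
  fix s0 assume fr0: "frame bfs_init s s0" and inv0: "bfs_inv n E r s0"
  let ?c = "For ''u'' (Num 0) (Var ''n'') bfs_body"
  let ?body = "Assign ''v'' (Arr ''ord'' (Var ''j'')) ;; ?c"
  let ?I = "\<lambda>j s'. bfs_inv n E r s' \<and> j \<le> scalar s' ''cnt'' \<and>
     (\<forall>h<j. scanned n E (arr s' ''ord'' h) n s')"
  \<comment> \<open>Once all queue entries are scanned, the queue is closed under adjacency and
    contains the root. This serves twice: round \<open>j\<close> finds an entry to scan, and in the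
    end all vertices are discovered.\<close>
  have full: "arr s' ''ord'' ` {..<scalar s' ''cnt''} = {..<n} \<and> scalar s' ''cnt'' = n"
    if I: "bfs_inv n E r s'" "\<forall>h<j. scanned n E (arr s' ''ord'' h) n s'"
      and j: "scalar s' ''cnt'' \<le> j" for j s'
  proof -
    let ?X = "arr s' ''ord'' ` {..<scalar s' ''cnt''}"
    have inv: "0 < scalar s' ''cnt''" "arr s' ''ord'' 0 = r" "?X \<subseteq> {..<n}"
      "inj_on (arr s' ''ord'') {..<scalar s' ''cnt''}"
      using I(1) by (simp_all add: bfs_inv_def Let_def)
    then have X: "?X \<subseteq> {..<n}" "r \<in> ?X" "inj_on (arr s' ''ord'') {..<scalar s' ''cnt''}"
      by (blast, metis imageI lessThan_iff, blast)
    have "{..<n} \<subseteq> ?X"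
    proof (rule connected_closed_set[of n E r])
      fix u v assume "u \<in> ?X" "v < n" "{u, v} \<in> E"
      from \<open>u \<in> ?X\<close> obtain h where h: "u = arr s' ''ord'' h" "h \<in> {..<scalar s' ''cnt''}" by (rule imageE)
      then have "h < j" using j by simp
      with I(2) h(1) have "scanned n E u n s'" by blast
      with \<open>v < n\<close> \<open>{u, v} \<in> E\<close> show "v \<in> ?X" unfolding scanned_def by blast
    next
      show "connected_graph {..<n} E" using tree by (simp add: tree_def)
    qed (fact X r tree_edge_less[OF tree])+
    then have "?X = {..<n}" using X by auto
    then show ?thesis using card_image[OF X(3)] by simp
  qed
  show "runs F (For ''j'' (Num 0) (Var ''n'') ?body) s0 (2 + n * ((3 + 7 * n) + 2))
    (\<lambda>s'. rooted n r (arr s' ''par'') (arr s' ''ord'') \<and>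
      (\<forall>v<n. v \<noteq> r \<longrightarrow> {arr s' ''par'' v, v} \<in> E))"
  proof (rule runs_For[where l = 0 and B = n and m = "3 + 7 * n" and I = ?I])
    fix j s' assume j: "j < n" "scalar s' ''j'' = j" and fr: "frame (For ''j'' (Num 0) (Var ''n'') ?body) s0 s'"
      and I: "?I j s'"
    have st: "scalar s' ''n'' = n" "arr s' ''row'' = arr s ''row''" "arr s' ''adj'' = arr s ''adj''"
      using fr fr0 n by (simp_all add: frame_def prog_simps)
    have jc: "j < scalar s' ''cnt''"
    proof (rule ccontr)
      assume "\<not> ?thesis"
      with I full[of s' j] j show False by auto
    qed
    define v where "v = arr s' ''ord'' j"
    have v: "v < n" using I jc by (auto simp: v_def bfs_inv_def Let_def)
    show "runs F ?body s' (3 + 7 * n) (\<lambda>s''. ?I (Suc j) (set_var s'' ''j'' (Suc j)))"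
    proof (rule runs_Seq)
      show "runs F (Assign ''v'' (Arr ''ord'' (Var ''j''))) s' 1 (\<lambda>s1. s1 = set_var s' ''v'' v)"
        by (rule runs_straight) (simp_all add: j v_def)
      fix s1 assume s1: "s1 = set_var s' ''v'' v"
      have "runs F ?c s1 (2 + 7 * n)
          (\<lambda>s2. bfs_inv n E r s2 \<and> bfs_ext s1 s2 \<and> scanned n E v n s2)"
        by (rule bfs_scan[where h = j]) (use I jc v st row adj in \<open>auto simp: s1 v_def\<close>)
      then show "runs F ?c s1 (2 + 7 * n) (\<lambda>s''. ?I (Suc j) (set_var s'' ''j'' (Suc j)))"
      proof (rule runs_weaken)
        fix s2 assume s2: "bfs_inv n E r s2 \<and> bfs_ext s1 s2 \<and> scanned n E v n s2"
        then have ext: "bfs_ext s' s2" by (simp add: s1)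
        have "scanned n E (arr s2 ''ord'' h) n s2" if "h < Suc j" for h
        proof (cases "h = j")
          case True
          then show ?thesis using s2 ext jc by (simp add: bfs_ext_def v_def)
        next
          case False
          then have "h < j" "arr s2 ''ord'' h = arr s' ''ord'' h"
            using ext jc that by (auto simp: bfs_ext_def)
          then show ?thesis using I scanned_ext[OF _ ext] by auto
        qed
        then show "?I (Suc j) (set_var s2 ''j'' (Suc j))" using s2 ext jc by (auto simp: bfs_ext_def)
      qed simp
    qed simp
  next
    fix s' assume I: "?I n s'"
    let ?o = "arr s' ''ord''" and ?p = "arr s' ''par''"
    have inv: "?o 0 = r" "?p r = r" "inj_on ?o {..<scalar s' ''cnt''}"
      "\<forall>i. 0 < i \<longrightarrow> i < scalar s' ''cnt'' \<longrightarrow> (\<exists>h<i. ?p (?o i) = ?o h \<and> {?o h, ?o i} \<in> E)"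
      "card (?o ` {..<scalar s' ''cnt''}) \<le> n"
      using I card_mono[of "{..<n}" "?o ` {..<scalar s' ''cnt''}"] by (auto simp: bfs_inv_def Let_def)
    \<comment> \<open>The queue lists distinct vertices, so it has length at most \<open>n\<close>,
      and \<open>full\<close> applies with \<open>j = n\<close>.\<close>
    then have "scalar s' ''cnt'' \<le> n" by (simp add: card_image)
    with full[of s' n] I have c: "?o ` {..<n} = {..<n}" "scalar s' ''cnt'' = n" by auto
    have "rooted n r ?p ?o"
      by unfold_locales (use inv c r in \<open>auto simp: bij_betw_def\<close>)
    moreover have "{?p v, v} \<in> E" if v: "v < n" "v \<noteq> r" for v
    proof -
      obtain i where "i < n" "v = ?o i" using v c by (metis imageE lessThan_iff)
      moreover have "i \<noteq> 0" using v calculation inv by metis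
      ultimately obtain h where "?p (?o i) = ?o h" "{?o h, ?o i} \<in> E" using inv(4) c(2) by blast
      then show ?thesis using \<open>v = ?o i\<close> by simp
    qed
    ultimately show "rooted n r ?p ?o \<and> (\<forall>v<n. v \<noteq> r \<longrightarrow> {?p v, v} \<in> E)" by blast
  qed (use fr0 n inv0 in \<open>auto simp: frame_def prog_simps\<close>)
qed simp

section \<open>Maximum traversal numbers and the core\<close>

text \<open>
  Self-loops stand for waiting.  As the root is its own parent, every vertex contributes exactly
  three entries.
\<close>

definition edges_prog :: com where
  "edges_prog =
     For ''i'' (Num 0) (Var ''n'')
       (Store ''src'' (Var ''i'') (Var ''i'') ;;
        Store ''dst'' (Var ''i'') (Var ''i'') ;;
        Store ''src'' (Plus (Var ''n'') (Var ''i'')) (Var ''i'') ;;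
        Store ''dst'' (Plus (Var ''n'') (Var ''i'')) (Arr ''par'' (Var ''i'')) ;;
        Store ''src'' (Plus (Plus (Var ''n'') (Var ''n'')) (Var ''i'')) (Arr ''par'' (Var ''i'')) ;;
        Store ''dst'' (Plus (Plus (Var ''n'') (Var ''n'')) (Var ''i'')) (Var ''i''))"

lemma runs_edges:
  assumes n: "scalar s ''n'' = n" and par: "arr s ''par'' = par"
  shows "runs F edges_prog s (2 + 8 * n) (\<lambda>s'. \<forall>v<n.
    arr s' ''src'' v = v \<and> arr s' ''dst'' v = v \<and>
    arr s' ''src'' (n + v) = v \<and> arr s' ''dst'' (n + v) = par v \<and>
    arr s' ''src'' (2 * n + v) = par v \<and> arr s' ''dst'' (2 * n + v) = v)"
  unfolding edges_prog_def
  by (rule runs_For[where l = 0 and B = n and m = 6 and I = "\<lambda>j s'. \<forall>v<j.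
    arr s' ''src'' v = v \<and> arr s' ''dst'' v = v \<and>
    arr s' ''src'' (n + v) = v \<and> arr s' ''dst'' (n + v) = par v \<and>
    arr s' ''src'' (2 * n + v) = par v \<and> arr s' ''dst'' (2 * n + v) = v"])
    (auto simp: n par frame_def less_Suc_eq intro!: runs_straight)

section \<open>The recursion for traversal numbers\<close>

definition linked :: "nat cost \<Rightarrow> nat \<Rightarrow> nat \<Rightarrow> nat \<Rightarrow> nat \<Rightarrow> bool" where
  "linked F a v x y \<longleftrightarrow> min (F a v x y) (F v a x y) < \<infinity>"

text \<open>The bound \<open>y\<close> is passed in the place of the lifetime, so all departures and
  arrivals are at most \<open>y\<close>.\<close>

definition has_traversals :: "nat cost \<Rightarrow> nat \<Rightarrow> nat \<Rightarrow> nat \<Rightarrow> nat \<Rightarrow> bool" where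
  "has_traversals F a v y m \<longleftrightarrow> (\<exists>ts. traversal_sequence y F a v ts \<and> length ts = m)"

text \<open>A relational maximum: it includes attainment and asks for no finiteness.\<close>

definition greatest :: "nat set \<Rightarrow> nat \<Rightarrow> bool" where
  "greatest A m \<longleftrightarrow> m \<in> A \<and> (\<forall>m'\<in>A. m' \<le> m)"

lemma traversal_sequence_mono:
  "traversal_sequence y F a v ts \<Longrightarrow> y \<le> z \<Longrightarrow> traversal_sequence z F a v ts"
  by (fastforce simp: traversal_sequence_def)

text \<open>Every traversal arrives after it departs, so times increase along the sequence and the
  last arrival bounds them all.\<close>

lemma traversal_sequence_last:
  assumes "\<And>x y. x \<in> {1..T} \<Longrightarrow> y \<in> {1..T} \<Longrightarrow> linked F a v x y \<Longrightarrow> x < y"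
    and "traversal_sequence T F a v ts" "ts = [] \<or> snd (last ts) \<le> b"
  shows "traversal_sequence b F a v ts"
  using assms(2,3)
proof (induction ts arbitrary: b rule: rev_induct)
  case Nil
  then show ?case by (simp add: traversal_sequence_def)
next
  case (snoc p ts)
  obtain x y where p: "p = (x, y)" by (cases p)
  have xy: "x \<in> {1..T}" "y \<in> {1..T}" "linked F a v x y" "y \<le> b"
    using snoc.prems by (auto simp: traversal_sequence_def linked_def p)
  then have "x < y" using assms(1) by blast
  have "traversal_sequence T F a v ts" "ts = [] \<or> snd (last ts) \<le> x"
    using snoc.prems(1) by (auto simp: traversal_sequence_def successively_append_iff p split: prod.splits)
  then have "traversal_sequence x F a v ts" using snoc.IH by blast
  then have "traversal_sequence b F a v ts"
    by (rule traversal_sequence_mono) (use \<open>x < y\<close> xy in simp)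
  then show ?case using xy \<open>x < y\<close> snoc.prems(1)
    by (auto simp: traversal_sequence_def p linked_def)
qed

text \<open>Either no traversal arrives at \<open>y\<close>, or the last one does; those before it
  have then arrived by its departure \<open>x\<close>. This is the classical recursion for a maximum
  number of disjoint intervals.\<close>

lemma has_traversals_step:
  assumes lt: "\<And>x y. x \<in> {1..T} \<Longrightarrow> y \<in> {1..T} \<Longrightarrow> linked F a v x y \<Longrightarrow> x < y"
    and y: "1 \<le> y" "y \<le> T"
  shows "has_traversals F a v y m \<longleftrightarrow> has_traversals F a v (y - 1) m \<or>
    (\<exists>x m'. m = Suc m' \<and> 1 \<le> x \<and> x < y \<and> linked F a v x y \<and> has_traversals F a v x m')"
proof
  assume "has_traversals F a v y m"
  then obtain ts where ts: "traversal_sequence y F a v ts" "length ts = m"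
    by (auto simp: has_traversals_def)
  have lt': "\<And>x z. x \<in> {1..y} \<Longrightarrow> z \<in> {1..y} \<Longrightarrow> linked F a v x z \<Longrightarrow> x < z" using lt y by auto
  show "has_traversals F a v (y - 1) m \<or>
    (\<exists>x m'. m = Suc m' \<and> 1 \<le> x \<and> x < y \<and> linked F a v x y \<and> has_traversals F a v x m')"
  proof (cases ts rule: rev_cases)
    case Nil
    then show ?thesis using ts by (auto simp: has_traversals_def traversal_sequence_def)
  next
    case (snoc ts' p)
    obtain x z where p: "p = (x, z)" by (cases p)
    show ?thesis
    proof (cases "z = y")
      case False
      then have "snd (last ts) \<le> y - 1" using ts(1) by (auto simp: snoc p traversal_sequence_def)
      then have "traversal_sequence (y - 1) F a v ts"
        using traversal_sequence_last[OF lt' ts(1)] by blast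
      then show ?thesis using ts(2) by (auto simp: has_traversals_def)
    next
      case True
      have x: "1 \<le> x" "x \<le> y" "linked F a v x y"
        using ts(1) True by (auto simp: snoc p traversal_sequence_def linked_def)
      then have "x < y" using lt' y by auto
      have "traversal_sequence y F a v ts'" "ts' = [] \<or> snd (last ts') \<le> x"
        using ts(1) by (auto simp: snoc p traversal_sequence_def successively_append_iff split: prod.splits)
      then have "traversal_sequence x F a v ts'" using traversal_sequence_last[OF lt'] by blast
      then show ?thesis using ts(2) x \<open>x < y\<close> by (auto simp: has_traversals_def snoc)
    qed
  qed
next
  assume "has_traversals F a v (y - 1) m \<or>
    (\<exists>x m'. m = Suc m' \<and> 1 \<le> x \<and> x < y \<and> linked F a v x y \<and> has_traversals F a v x m')"
  then show "has_traversals F a v y m"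
  proof
    assume "has_traversals F a v (y - 1) m"
    then show ?thesis unfolding has_traversals_def
      using traversal_sequence_mono[of "y - 1" F a v _ y] by auto
  next
    assume "\<exists>x m'. m = Suc m' \<and> 1 \<le> x \<and> x < y \<and> linked F a v x y \<and> has_traversals F a v x m'"
    then obtain x ts where x: "1 \<le> x" "x < y" "linked F a v x y" "traversal_sequence x F a v ts"
      "m = Suc (length ts)" by (auto simp: has_traversals_def)
    have "snd p \<le> x" if "p \<in> set ts" for p
      using x(4) that by (auto simp: traversal_sequence_def)
    then have "ts = [] \<or> snd (last ts) \<le> x" using last_in_set by blast
    then have "ts = [] \<or> (case last ts of (t, t') \<Rightarrow> t' \<le> x)" by (auto split: prod.split)
    moreover have "traversal_sequence y F a v ts" using traversal_sequence_mono[OF x(4)] x(2) by simp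
    ultimately have "traversal_sequence y F a v (ts @ [(x, y)])" using x(1-3) y(1)
      unfolding traversal_sequence_def linked_def
      by (auto simp: successively_append_iff case_prod_unfold simp del: enat_ord_simps)
    then show ?thesis using x(5) by (auto simp: has_traversals_def intro!: exI[of _ "ts @ [(x, y)]"])
  qed
qed

lemma has_traversals_0: "has_traversals F a v 0 m \<longleftrightarrow> m = 0"
proof -
  have "traversal_sequence 0 F a v ts \<longleftrightarrow> ts = []" for ts
    by (cases ts) (auto simp: traversal_sequence_def)
  then show ?thesis by (auto simp: has_traversals_def)
qed

lemma greatest_Un_Suc: "greatest A p \<Longrightarrow> greatest B q \<Longrightarrow> greatest (A \<union> Suc ` B) (max p (Suc q))"
  by (fastforce simp: greatest_def max_def)

section \<open>Computing the core\<close>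

text \<open>\<open>mx\<close> at \<open>y\<close> is the largest number of traversals completed by
  time \<open>y\<close>. It starts from the value at \<open>y - 1\<close> and is raised through
  every possible last departure \<open>x\<close>. The sum of the two cost codes is positive exactly
  if one of the two costs is finite.\<close>

definition mtn_relax :: com where
  "mtn_relax =
     Cond (Conj (Less (Num 0) (Plus (CostAt (Var ''a'') (Var ''v'') (Var ''x'') (Var ''y''))
                                    (CostAt (Var ''v'') (Var ''a'') (Var ''x'') (Var ''y''))))
                (Less (Arr ''mx'' (Var ''y'')) (Plus (Arr ''mx'' (Var ''x'')) (Num 1))))
       (Store ''mx'' (Var ''y'') (Plus (Arr ''mx'' (Var ''x'')) (Num 1)))
       Skip"

definition mtn_row :: com where
  "mtn_row =
     Store ''mx'' (Var ''y'') (Arr ''mx'' (Minus (Var ''y'') (Num 1))) ;;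
     For ''x'' (Num 1) (Var ''y'') mtn_relax"

definition mtn_vertex :: com where
  "mtn_vertex =
     Assign ''a'' (Arr ''par'' (Var ''v'')) ;;
     For ''y'' (Num 1) (Plus (Var ''T'') (Num 1)) mtn_row ;;
     Cond (Less (Num 3) (Arr ''mx'' (Var ''T''))) (Store ''K'' (Var ''v'') (Num 1)) Skip"

definition mtn_prog :: com where
  "mtn_prog =
     For ''v'' (Num 0) (Var ''n'') mtn_vertex ;;
     Store ''K'' (Var ''vs'') (Num 1) ;;
     Store ''K'' (Var ''vt'') (Num 1)"

lemmas mtn_defs = mtn_relax_def mtn_row_def mtn_vertex_def

lemma encode_cost_pos: "0 < encode_cost c \<longleftrightarrow> c < \<infinity>"
  by (cases c) (auto simp: encode_cost_def)

lemma linked_encode: "linked F a v x y \<longleftrightarrow> 0 < encode_cost (F a v x y) + encode_cost (F v a x y)"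
  by (simp add: linked_def min_less_iff_disj add_gr_0 encode_cost_pos del: enat_ord_simps)

lemma runs_mtn_row:
  assumes lt: "\<And>x y. x \<in> {1..T} \<Longrightarrow> y \<in> {1..T} \<Longrightarrow> linked F a v x y \<Longrightarrow> x < y"
    and y: "1 \<le> y" "y \<le> T" "scalar s ''y'' = y"
    and av: "scalar s ''a'' = a" "scalar s ''v'' = v"
    and mx: "\<forall>x<y. greatest {m. has_traversals F a v x m} (arr s ''mx'' x)"
  shows "runs F mtn_row s (3 + 4 * T)
    (\<lambda>s'. \<forall>x\<le>y. greatest {m. has_traversals F a v x m} (arr s' ''mx'' x))"
  unfolding mtn_row_def
proof (rule runs_Seq)
  let ?s1 = "set_arr s ''mx'' y (arr s ''mx'' (y - 1))"
  show "runs F (Store ''mx'' (Var ''y'') (Arr ''mx'' (Minus (Var ''y'') (Num 1)))) s 1 (\<lambda>s1. s1 = ?s1)"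
    by (rule runs_straight) (simp_all add: y)
  fix s1 assume s1: "s1 = ?s1"
  \<comment> \<open>The lengths obtainable when a traversal arriving at \<open>y\<close>, if there
    is one, departs before \<open>x\<close>. At \<open>x = 1\<close> none is possible; at
    \<open>x = y\<close> the recursion gives all lengths.\<close>
  define A where "A x = {m. has_traversals F a v (y - 1) m} \<union>
    {Suc m |z m. 1 \<le> z \<and> z < x \<and> linked F a v z y \<and> has_traversals F a v z m}" for x
  have A1: "A 1 = {m. has_traversals F a v (y - 1) m}" by (auto simp: A_def)
  have Ay: "A y = {m. has_traversals F a v y m}"
    unfolding A_def using has_traversals_step[OF lt y(1,2)] by auto
  let ?I = "\<lambda>x s'. (\<forall>z<y. arr s' ''mx'' z = arr s ''mx'' z) \<and> greatest (A x) (arr s' ''mx'' y)"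
  show "runs F (For ''x'' (Num 1) (Var ''y'') mtn_relax) s1 (2 + 4 * T)
    (\<lambda>s'. \<forall>x\<le>y. greatest {m. has_traversals F a v x m} (arr s' ''mx'' x))"
  proof (rule runs_For[where l = 1 and B = y and m = 2 and I = ?I])
    fix x s' assume x: "1 \<le> x" "x < y" "scalar s' ''x'' = x"
      and fr: "frame (For ''x'' (Num 1) (Var ''y'') mtn_relax) s1 s'" and I: "?I x s'"
    have st: "scalar s' ''y'' = y" "scalar s' ''a'' = a" "scalar s' ''v'' = v"
      using fr y av by (simp_all add: frame_def mtn_defs s1)
    have gx: "greatest {m. has_traversals F a v x m} (arr s' ''mx'' x)" using mx I x by simp
    have AS: "A (Suc x) = A x \<union> (if linked F a v x y then Suc ` {m. has_traversals F a v x m} else {})"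
      unfolding A_def using x by (auto simp: less_Suc_eq image_iff)
    show "runs F mtn_relax s' 2 (\<lambda>s''. ?I (Suc x) (set_var s'' ''x'' (Suc x)))"
    proof (cases "linked F a v x y \<and> arr s' ''mx'' y < Suc (arr s' ''mx'' x)")
      case True
      then have "result F mtn_relax s' = set_arr s' ''mx'' y (Suc (arr s' ''mx'' x))"
        unfolding linked_encode by (simp add: mtn_relax_def st x)
      moreover have "greatest (A (Suc x)) (Suc (arr s' ''mx'' x))"
        using greatest_Un_Suc[OF conjunct2[OF I] gx] True by (simp add: AS max_def)
      ultimately show ?thesis using I x by (intro runs_straight) (simp_all, simp_all add: mtn_relax_def)
    next
      case False
      then have "result F mtn_relax s' = s'"
        unfolding linked_encode by (auto simp: mtn_relax_def st x)
      moreover have "greatest (A (Suc x)) (arr s' ''mx'' y)"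
        using greatest_Un_Suc[OF conjunct2[OF I] gx] conjunct2[OF I] False
        by (cases "linked F a v x y") (simp_all add: AS max_def)
      ultimately show ?thesis using I x by (intro runs_straight) (simp_all, simp_all add: mtn_relax_def)
    qed
  qed (use y mx A1 Ay in \<open>auto simp: s1 frame_def mtn_defs le_less\<close>)
qed simp

text \<open>At the root, which is its own parent, this speaks of waiting; the root is put into the
  core anyway.\<close>

definition overused :: "nat cost \<Rightarrow> nat \<Rightarrow> (nat \<Rightarrow> nat) \<Rightarrow> nat \<Rightarrow> bool" where
  "overused F T par v \<longleftrightarrow> (\<exists>ts. traversal_sequence T F (par v) v ts \<and> 3 < length ts)"

text \<open>Entry 0 of \<open>mx\<close> is the base of the recursion, and entries 1 to
  \<open>T\<close> are recomputed for each vertex. So the zero there is all that has to be known of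
  \<open>mx\<close> when the next vertex begins.\<close>

lemma runs_mtn_vertex:
  assumes lt: "\<And>x y. x \<in> {1..T} \<Longrightarrow> y \<in> {1..T} \<Longrightarrow> linked F (par v) v x y \<Longrightarrow> x < y"
    and s: "scalar s ''v'' = v" "scalar s ''T'' = T" "arr s ''par'' = par" "arr s ''mx'' 0 = 0"
  shows "runs F mtn_vertex s (5 + T * (5 + 4 * T)) (\<lambda>s'. arr s' ''mx'' 0 = 0 \<and>
    arr s' ''K'' = (if overused F T par v then (arr s ''K'')(v := 1) else arr s ''K''))"
  unfolding mtn_vertex_def
proof (rule runs_Seq)
  let ?a = "par v"
  show "runs F (Assign ''a'' (Arr ''par'' (Var ''v''))) s 1 (\<lambda>s1. s1 = set_var s ''a'' ?a)"
    by (rule runs_straight) (simp_all add: s)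
  fix s1 assume s1: "s1 = set_var s ''a'' ?a"
  let ?G = "\<lambda>x s'. greatest {m. has_traversals F ?a v x m} (arr s' ''mx'' x)"
  show "runs F (For ''y'' (Num 1) (Plus (Var ''T'') (Num 1)) mtn_row ;;
     Cond (Less (Num 3) (Arr ''mx'' (Var ''T''))) (Store ''K'' (Var ''v'') (Num 1)) Skip) s1
     ((2 + T * (5 + 4 * T)) + 2) (\<lambda>s'. arr s' ''mx'' 0 = 0 \<and>
       arr s' ''K'' = (if overused F T par v then (arr s ''K'')(v := 1) else arr s ''K''))"
  proof (rule runs_Seq)
    show "runs F (For ''y'' (Num 1) (Plus (Var ''T'') (Num 1)) mtn_row) s1 (2 + T * (5 + 4 * T))
        (\<lambda>s'. \<forall>x\<le>T. ?G x s')"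
    proof (rule runs_For[where l = 1 and B = "T + 1" and m = "3 + 4 * T" and I = "\<lambda>y s'. \<forall>x<y. ?G x s'"])
      fix y s' assume y: "1 \<le> y" "y < T + 1" "scalar s' ''y'' = y"
        and fr: "frame (For ''y'' (Num 1) (Plus (Var ''T'') (Num 1)) mtn_row) s1 s'"
        and I: "\<forall>x<y. ?G x s'"
      have "scalar s' ''a'' = ?a" "scalar s' ''v'' = v"
        using fr s by (simp_all add: frame_def mtn_defs s1)
      with runs_mtn_row[of T F ?a v y s'] lt y I
      have "runs F mtn_row s' (3 + 4 * T) (\<lambda>s''. \<forall>x\<le>y. ?G x s'')" by simp
      then show "runs F mtn_row s' (3 + 4 * T) (\<lambda>s''. \<forall>x<Suc y. ?G x (set_var s'' ''y'' (Suc y)))"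
        by (rule runs_weaken) auto
    qed (use s in \<open>auto simp: s1 frame_def mtn_defs greatest_def has_traversals_0\<close>)
    fix s2 assume fr: "frame (For ''y'' (Num 1) (Plus (Var ''T'') (Num 1)) mtn_row) s1 s2"
      and G: "\<forall>x\<le>T. ?G x s2"
    have st: "scalar s2 ''v'' = v" "scalar s2 ''T'' = T" "arr s2 ''K'' = arr s ''K''"
      using fr s by (simp_all add: frame_def mtn_defs s1)
    have "arr s2 ''mx'' 0 = 0" using G by (auto simp: greatest_def has_traversals_0)
    moreover have "3 < arr s2 ''mx'' T \<longleftrightarrow> overused F T par v"
      using G by (fastforce simp: greatest_def has_traversals_def overused_def)
    ultimately show "runs F (Cond (Less (Num 3) (Arr ''mx'' (Var ''T''))) (Store ''K'' (Var ''v'') (Num 1)) Skip) s2 2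
      (\<lambda>s'. arr s' ''mx'' 0 = 0 \<and>
        arr s' ''K'' = (if overused F T par v then (arr s ''K'')(v := 1) else arr s ''K''))"
      by (intro runs_straight) (auto simp: st)
  qed simp
qed simp

lemma runs_mtn:
  assumes lt: "\<And>v x y. v < n \<Longrightarrow> x \<in> {1..T} \<Longrightarrow> y \<in> {1..T} \<Longrightarrow> linked F (par v) v x y \<Longrightarrow> x < y"
    and s: "scalar s ''n'' = n" "scalar s ''T'' = T" "scalar s ''vs'' = r" "scalar s ''vt'' = g"
      "arr s ''par'' = par" "arr s ''mx'' 0 = 0" "\<forall>v. arr s ''K'' v = 0"
  shows "runs F mtn_prog s (4 + n * (7 + T * (5 + 4 * T)))
    (\<lambda>s'. \<forall>v<n. 0 < arr s' ''K'' v \<longleftrightarrow> v = r \<or> v = g \<or> overused F T par v)"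
  unfolding mtn_prog_def
proof (rule runs_Seq)
  let ?I = "\<lambda>v s'. arr s' ''mx'' 0 = 0 \<and>
    (\<forall>u. 0 < arr s' ''K'' u \<longleftrightarrow> u < v \<and> overused F T par u)"
  show "runs F (For ''v'' (Num 0) (Var ''n'') mtn_vertex) s (2 + n * (7 + T * (5 + 4 * T))) (?I n)"
  proof (rule runs_For[where l = 0 and B = n and m = "5 + T * (5 + 4 * T)" and I = ?I])
    fix v s' assume v: "v < n" "scalar s' ''v'' = v"
      and fr: "frame (For ''v'' (Num 0) (Var ''n'') mtn_vertex) s s'" and I: "?I v s'"
    have "scalar s' ''T'' = T" "arr s' ''par'' = par"
      using fr s by (simp_all add: frame_def mtn_defs)
    with runs_mtn_vertex[of T F par v s'] lt v I
    have "runs F mtn_vertex s' (5 + T * (5 + 4 * T)) (\<lambda>s''. arr s'' ''mx'' 0 = 0 \<and>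
      arr s'' ''K'' = (if overused F T par v then (arr s' ''K'')(v := 1) else arr s' ''K''))" by simp
    then show "runs F mtn_vertex s' (5 + T * (5 + 4 * T)) (\<lambda>s''. ?I (Suc v) (set_var s'' ''v'' (Suc v)))"
      by (rule runs_weaken) (use I in \<open>auto simp: less_Suc_eq\<close>)
  qed (use s in \<open>auto simp: frame_def mtn_defs\<close>)
  fix s1 assume fr: "frame (For ''v'' (Num 0) (Var ''n'') mtn_vertex) s s1" and I: "?I n s1"
  have "scalar s1 ''vs'' = r" "scalar s1 ''vt'' = g" using fr s by (simp_all add: frame_def mtn_defs)
  with I show "runs F (Store ''K'' (Var ''vs'') (Num 1) ;; Store ''K'' (Var ''vt'') (Num 1)) s1 2
    (\<lambda>s'. \<forall>v<n. 0 < arr s' ''K'' v \<longleftrightarrow> v = r \<or> v = g \<or> overused F T par v)"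
    by (intro runs_straight) auto
qed simp

text \<open>In reverse search order each vertex has received the marks of all its children when its
  turn comes, so one pass suffices.\<close>

definition closure_prog :: com where
  "closure_prog =
     For ''i'' (Num 0) (Var ''n'')
       (Assign ''v'' (Arr ''ord'' (Minus (Minus (Var ''n'') (Num 1)) (Var ''i''))) ;;
        Cond (Less (Num 0) (Arr ''K'' (Var ''v''))) (Store ''K'' (Arr ''par'' (Var ''v'')) (Num 1)) Skip)"

context rooted
begin

text \<open>Besides closure it is recorded that each marked vertex is, or lies above, one that was
  marked before the pass; the bound on the number of parent-closed sets rests on this.\<close>

lemma runs_closure:
  assumes s: "scalar s ''n'' = n" "arr s ''par'' = par" "arr s ''ord'' = ord" "0 < arr s ''K'' r"
  defines "K \<equiv> (\<lambda>s. {v. v < n \<and> 0 < arr s ''K'' v})"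
  shows "runs F closure_prog s (2 + 5 * n)
    (\<lambda>s'. par_closed (K s') \<and> K s \<subseteq> K s' \<and> (\<forall>v\<in>K s'. \<exists>x\<in>K s. x \<in> desc v))"
  unfolding closure_prog_def
proof (rule runs_For[where l = 0 and B = n and m = 3 and I = "\<lambda>i s'. K s \<subseteq> K s' \<and>
      (\<forall>v\<in>K s'. \<exists>x\<in>K s. x \<in> desc v) \<and> (\<forall>h<n. n - i \<le> h \<longrightarrow> ord h \<in> K s' \<longrightarrow> par (ord h) \<in> K s')"])
  fix i s'
  assume i: "i < n" "scalar s' ''i'' = i"
    and fr: "frame (For ''i'' (Num 0) (Var ''n'')
       (Assign ''v'' (Arr ''ord'' (Minus (Minus (Var ''n'') (Num 1)) (Var ''i''))) ;;
        Cond (Less (Num 0) (Arr ''K'' (Var ''v''))) (Store ''K'' (Arr ''par'' (Var ''v'')) (Num 1)) Skip)) s s'"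
    and I: "K s \<subseteq> K s' \<and> (\<forall>v\<in>K s'. \<exists>x\<in>K s. x \<in> desc v) \<and>
      (\<forall>h<n. n - i \<le> h \<longrightarrow> ord h \<in> K s' \<longrightarrow> par (ord h) \<in> K s')"
  have st: "scalar s' ''n'' = n" "arr s' ''par'' = par" "arr s' ''ord'' = ord"
    using fr s by (simp_all add: frame_def)
  define v where "v = ord (n - 1 - i)"
  have v: "v < n" "rank v = n - 1 - i" unfolding v_def using i ord_less rank_ord by auto
  define K' where "K' = (if v \<in> K s' then insert (par v) (K s') else K s')"
  have "K s \<subseteq> K'" using I by (auto simp: K'_def)
  moreover have "\<exists>x\<in>K s. x \<in> desc u" if u: "u \<in> K'" for u
  proof (cases "u \<in> K s'")
    case False
    then have "u = par v" "v \<in> K s'" using u by (auto simp: K'_def split: if_splits)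
    then obtain x where "x \<in> K s" "x \<in> desc v" using I by blast
    moreover have "v \<in> desc u" using \<open>u = par v\<close> v(1) by (auto simp: desc_def intro: exI[of _ 1])
    ultimately show ?thesis using desc_trans by blast
  qed (use I in auto)
  moreover have "par (ord h) \<in> K'" if h: "h < n" "n - Suc i \<le> h" "ord h \<in> K'" for h
  proof (cases "h = n - 1 - i")
    case True
    then show ?thesis using h(3) par_r by (auto simp: K'_def v_def split: if_splits)
  next
    case False
    then have "n - i \<le> h" "rank v < h" using h v(2) i by auto
    have "rank (par v) \<le> rank v" using rank_funpow[OF v(1), of 1] by simp
    \<comment> \<open>The newly marked \<open>par v\<close> comes before \<open>v\<close> in the
      search order, hence is none of the vertices already treated.\<close>
    then have "ord h \<noteq> par v" using \<open>rank v < h\<close> rank_ord[OF h(1)] by auto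
    then have "ord h \<in> K s'" using h(3) by (auto simp: K'_def split: if_splits)
    then show ?thesis using I \<open>n - i \<le> h\<close> h(1) by (auto simp: K'_def)
  qed
  moreover define s'' where "s'' = result F (Assign ''v'' (Arr ''ord'' (Minus (Minus (Var ''n'') (Num 1)) (Var ''i''))) ;;
        Cond (Less (Num 0) (Arr ''K'' (Var ''v''))) (Store ''K'' (Arr ''par'' (Var ''v'')) (Num 1)) Skip) s'"
  moreover have "K (set_var s'' ''i'' (Suc i)) = K'"
    using v(1) par_less by (auto simp: s''_def K_def K'_def st i v_def)
  ultimately show "runs F (Assign ''v'' (Arr ''ord'' (Minus (Minus (Var ''n'') (Num 1)) (Var ''i''))) ;;
        Cond (Less (Num 0) (Arr ''K'' (Var ''v''))) (Store ''K'' (Arr ''par'' (Var ''v'')) (Num 1)) Skip) s' 3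
    (\<lambda>s''. K s \<subseteq> K (set_var s'' ''i'' (Suc i)) \<and>
      (\<forall>v\<in>K (set_var s'' ''i'' (Suc i)). \<exists>x\<in>K s. x \<in> desc v) \<and>
      (\<forall>h<n. n - Suc i \<le> h \<longrightarrow> ord h \<in> K (set_var s'' ''i'' (Suc i)) \<longrightarrow> par (ord h) \<in> K (set_var s'' ''i'' (Suc i))))"
    by (intro runs_straight) (simp, simp, simp only: s''_def[symmetric], blast)
next
  fix s' assume I: "K s \<subseteq> K s' \<and> (\<forall>v\<in>K s'. \<exists>x\<in>K s. x \<in> desc v) \<and>
      (\<forall>h<n. n - n \<le> h \<longrightarrow> ord h \<in> K s' \<longrightarrow> par (ord h) \<in> K s')"
  have "r \<in> K s'" using I s(4) r_less by (auto simp: K_def)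
  moreover have "par v \<in> K s'" if "v \<in> K s'" for v
  proof -
    have "v < n" using that by (simp add: K_def)
    then show ?thesis using I that rank_less[of v] ord_rank[of v] by auto
  qed
  ultimately show "par_closed (K s') \<and> K s \<subseteq> K s' \<and> (\<forall>v\<in>K s'. \<exists>x\<in>K s. x \<in> desc v)"
    using I by (auto simp: par_closed_def K_def)
qed (use s desc_refl in \<open>auto simp: K_def frame_def\<close>)

end

section \<open>Enumerating the parent-closed subsets of the core\<close>

abbreviation Eq :: "aexp \<Rightarrow> aexp \<Rightarrow> bexp" where
  "Eq a b \<equiv> Conj (Neg (Less a b)) (Neg (Less b a))"

abbreviation "code_set s i \<equiv> set_decode (arr s ''sets'' i)"

lemma set_decode_power_2: "set_decode (2 ^ v) = {v}"
  using set_decode_plus_power_2[of v 0] by simp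

text \<open>Each set is an earlier one plus a vertex, entry 0 being a singleton. This history
  replaces bit tests: membership of a fixed vertex propagates along \<open>LP\<close> in constant
  time per set.\<close>

definition listing :: "store \<Rightarrow> bool" where
  "listing s \<longleftrightarrow> 0 < scalar s ''N'' \<and> code_set s 0 = {arr s ''LV'' 0} \<and>
     (\<forall>i<scalar s ''N''. 0 < i \<longrightarrow>
        arr s ''LP'' i < i \<and> code_set s i = insert (arr s ''LV'' i) (code_set s (arr s ''LP'' i)))"

definition column_prog :: com where
  "column_prog =
     Cond (Eq (Arr ''LV'' (Num 0)) (Var ''b'')) (Store ''col'' (Num 0) (Num 1)) (Store ''col'' (Num 0) (Num 0)) ;;
     For ''i'' (Num 1) (Var ''N'')
       (Cond (Eq (Arr ''LV'' (Var ''i'')) (Var ''b''))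
          (Store ''col'' (Var ''i'') (Num 1))
          (Store ''col'' (Var ''i'') (Arr ''col'' (Arr ''LP'' (Var ''i'')))))"

lemma runs_column:
  assumes l: "listing s" and b: "scalar s ''b'' = b" and N: "scalar s ''N'' \<le> M"
  shows "runs F column_prog s (4 + 4 * M)
    (\<lambda>s'. \<forall>i<scalar s ''N''. 0 < arr s' ''col'' i \<longleftrightarrow> b \<in> code_set s i)"
  unfolding column_prog_def
proof (rule runs_Seq)
  let ?first = "Cond (Eq (Arr ''LV'' (Num 0)) (Var ''b'')) (Store ''col'' (Num 0) (Num 1)) (Store ''col'' (Num 0) (Num 0))"
  let ?body = "Cond (Eq (Arr ''LV'' (Var ''i'')) (Var ''b''))
          (Store ''col'' (Var ''i'') (Num 1))
          (Store ''col'' (Var ''i'') (Arr ''col'' (Arr ''LP'' (Var ''i''))))"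
  let ?I = "\<lambda>j s'. \<forall>i<j. 0 < arr s' ''col'' i \<longleftrightarrow> b \<in> code_set s i"
  show "runs F ?first s 2 (?I 1)"
    by (rule runs_straight) (use l b in \<open>auto simp: listing_def\<close>)
  fix s1 assume fr1: "frame ?first s s1" and I1: "?I 1 s1"
  show "runs F (For ''i'' (Num 1) (Var ''N'') ?body) s1 (2 + 4 * M) (?I (scalar s ''N''))"
  proof (rule runs_For[where l = 1 and B = "scalar s ''N''" and m = 2 and I = ?I])
    fix j s' assume j: "1 \<le> j" "j < scalar s ''N''" "scalar s' ''i'' = j"
      and fr: "frame (For ''i'' (Num 1) (Var ''N'') ?body) s1 s'" and I: "?I j s'"
    have st: "arr s' ''LV'' = arr s ''LV''" "arr s' ''LP'' = arr s ''LP''" "scalar s' ''b'' = b"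
      using fr fr1 b by (simp_all add: frame_def)
    have "arr s ''LP'' j < j" "code_set s j = insert (arr s ''LV'' j) (code_set s (arr s ''LP'' j))"
      using l j by (auto simp: listing_def)
    then show "runs F ?body s' 2 (\<lambda>s''. ?I (Suc j) (set_var s'' ''i'' (Suc j)))"
      using I by (intro runs_straight) (auto simp: st j less_Suc_eq)
  qed (use l N I1 fr1 in \<open>auto simp: frame_def listing_def\<close>)
qed simp

definition enum_add :: com where
  "enum_add =
     Cond (Less (Num 0) (Arr ''col'' (Var ''i'')))
       (Store ''sets'' (Var ''N'') (Plus (Arr ''sets'' (Var ''i'')) (Arr ''p'' (Var ''v''))) ;;
        Store ''LV'' (Var ''N'') (Var ''v'') ;;
        Store ''LP'' (Var ''N'') (Var ''i'') ;;
        Assign ''N'' (Plus (Var ''N'') (Num 1)))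
       Skip"

definition enum_extend :: com where
  "enum_extend =
     Assign ''b'' (Arr ''par'' (Var ''v'')) ;;
     column_prog ;;
     Assign ''old'' (Var ''N'') ;;
     For ''i'' (Num 0) (Var ''old'') enum_add"

definition enum_vertex :: com where
  "enum_vertex =
     Assign ''v'' (Arr ''ord'' (Var ''j'')) ;;
     Cond (Less (Num 0) (Arr ''K'' (Var ''v''))) enum_extend Skip"

definition enum_init :: com where
  "enum_init =
     Store ''sets'' (Num 0) (Arr ''p'' (Var ''vs'')) ;;
     Store ''LV'' (Num 0) (Var ''vs'') ;;
     Assign ''N'' (Num 1)"

definition enum_prog :: com where
  "enum_prog = enum_init ;; For ''j'' (Num 1) (Var ''n'') enum_vertex"

lemmas enum_defs = enum_add_def enum_extend_def enum_vertex_def enum_init_def column_prog_def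

text \<open>Injectivity excludes duplicates, so the length \<open>N\<close> of the list, and with it
  the running time, is the number of sets.\<close>

definition lists_sets :: "nat set set \<Rightarrow> store \<Rightarrow> bool" where
  "lists_sets X s \<longleftrightarrow> listing s \<and> inj_on (code_set s) {..<scalar s ''N''} \<and>
     code_set s ` {..<scalar s ''N''} = X"

lemma lists_sets_card: "lists_sets X s \<Longrightarrow> scalar s ''N'' = card X"
  unfolding lists_sets_def using card_image by fastforce

lemma lists_sets_cong:
  assumes "lists_sets X s" "scalar s' ''N'' = scalar s ''N''"
    "arr s' ''sets'' = arr s ''sets''" "arr s' ''LV'' = arr s ''LV''" "arr s' ''LP'' = arr s ''LP''"
  shows "lists_sets X s'"
  using assms by (simp add: lists_sets_def listing_def)

lemma lists_sets_append:
  assumes X: "lists_sets X s" and i: "i < scalar s ''N''" and v: "v \<notin> code_set s i"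
    and new: "insert v (code_set s i) \<notin> X"
    and s': "arr s' ''sets'' = (arr s ''sets'')(scalar s ''N'' := arr s ''sets'' i + 2 ^ v)"
      "arr s' ''LV'' = (arr s ''LV'')(scalar s ''N'' := v)"
      "arr s' ''LP'' = (arr s ''LP'')(scalar s ''N'' := i)"
      "scalar s' ''N'' = Suc (scalar s ''N'')"
  shows "lists_sets (insert (insert v (code_set s i)) X) s'"
proof -
  let ?N = "scalar s ''N''"
  \<comment> \<open>Since \<open>v\<close> is absent, adding \<open>2 ^ v\<close> sets its bit
    without a carry.\<close>
  have new_set: "code_set s' ?N = insert v (code_set s i)"
    using set_decode_plus_power_2[OF v] by (simp add: s' add.commute)
  have old: "code_set s' h = code_set s h" if "h < ?N" for h using that by (simp add: s')
  have "code_set s' ` {..<?N} = X" using X old by (auto simp: lists_sets_def)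
  then have im: "code_set s' ` {..<Suc ?N} = insert (insert v (code_set s i)) X"
    using new_set by (simp add: lessThan_Suc)
  have "inj_on (code_set s') {..<?N}" using X old by (auto simp: lists_sets_def inj_on_def)
  then have inj: "inj_on (code_set s') {..<Suc ?N}"
    using new new_set \<open>code_set s' ` {..<?N} = X\<close> by (simp add: lessThan_Suc)
  have l: "listing s" "0 < ?N" using X by (auto simp: lists_sets_def listing_def)
  have "arr s' ''LP'' h < h \<and> code_set s' h = insert (arr s' ''LV'' h) (code_set s' (arr s' ''LP'' h))"
    if h: "h < Suc ?N" "0 < h" for h
  proof (cases "h = ?N")
    case True
    then show ?thesis using new_set old[OF i] i by (simp add: s'(2,3))
  next
    case False
    then have "h < ?N" using h by simp
    then have "arr s ''LP'' h < h" "code_set s h = insert (arr s ''LV'' h) (code_set s (arr s ''LP'' h))"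
      using l h by (auto simp: listing_def)
    then show ?thesis using \<open>h < ?N\<close> old by (simp add: s'(2,3))
  qed
  moreover have "code_set s' 0 = {arr s' ''LV'' 0}" using old[OF l(2)] l by (simp add: s'(2) listing_def)
  ultimately have "listing s'" by (simp add: listing_def s'(4))
  then show ?thesis using inj im by (simp add: lists_sets_def s'(4))
qed

context rooted
begin

section \<open>Growing the parent-closed sets along the search order\<close>

definition closed_below :: "nat set \<Rightarrow> nat \<Rightarrow> nat set set" where
  "closed_below K j = {S. par_closed S \<and> S \<subseteq> K \<and> S \<subseteq> ord ` {..<j}}"

lemma closed_below_full: "closed_below K n = {S. par_closed S \<and> S \<subseteq> K}"
  using ord_bij by (auto simp: closed_below_def par_closed_def bij_betw_def)

lemma card_closed_below_le: "card (closed_below K j) \<le> card {S. par_closed S \<and> S \<subseteq> K}"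
  by (rule card_mono[OF finite_par_closed]) (auto simp: closed_below_def)

lemma closed_below_1: "r \<in> K \<Longrightarrow> closed_below K 1 = {{r}}"
  using r_less ord_0 par_r by (auto simp: closed_below_def par_closed_def)

lemma ord_notin:
  assumes "j < n" "S \<subseteq> ord ` {..<j}"
  shows "ord j \<notin> S"
proof
  assume "ord j \<in> S"
  then obtain i where "i < j" "ord j = ord i" using assms(2) by blast
  then show False using rank_ord[of i] rank_ord[of j] assms(1) by simp
qed

text \<open>Parents precede their children, so \<open>ord j\<close> has no child in a set drawn from
  the first \<open>Suc j\<close> vertices: it can be removed without harming closure, and added
  whenever its parent is present.\<close>

lemma closed_below_Suc:
  assumes j: "0 < j" "j < n"
  shows "closed_below K (Suc j) = closed_below K j \<union>
    (if ord j \<in> K then insert (ord j) ` {S \<in> closed_below K j. par (ord j) \<in> S} else {})"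
    (is "?L = ?R")
proof
  let ?v = "ord j"
  show "?L \<subseteq> ?R"
  proof
    fix S assume "S \<in> ?L"
    then have S: "par_closed S" "S \<subseteq> K" "S \<subseteq> insert ?v (ord ` {..<j})"
      by (auto simp: closed_below_def lessThan_Suc)
    show "S \<in> ?R"
    proof (cases "?v \<in> S")
      case False
      then show ?thesis using S by (auto simp: closed_below_def)
    next
      case True
      let ?S = "S - {?v}"
      have "?v \<noteq> r" using j rank_ord[of j] rank_ord[of 0] ord_0 by auto
      \<comment> \<open>A child of \<open>?v\<close> would have a rank above
        \<open>j\<close>.\<close>
      have np: "par w \<noteq> ?v" if "w \<in> S" for w
      proof
        assume eq: "par w = ?v"
        then have "w \<noteq> r" using par_r \<open>?v \<noteq> r\<close> by auto
        have "w < n" using that S(1) by (auto simp: par_closed_def)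
        then have "j < rank w" using par_step(2)[OF _ \<open>w \<noteq> r\<close>] rank_ord[OF j(2)] eq by auto
        moreover have "w \<in> ord ` {..<Suc j}" using that S(3) by (auto simp: lessThan_Suc)
        then have "rank w \<le> j" using rank_ord j by fastforce
        ultimately show False by simp
      qed
      have "par_closed ?S" using S(1) np \<open>?v \<noteq> r\<close> by (auto simp: par_closed_def)
      moreover have "par ?v \<in> ?S" using S(1) True np by (auto simp: par_closed_def)
      ultimately have "?S \<in> {S \<in> closed_below K j. par ?v \<in> S}"
        using S by (auto simp: closed_below_def)
      then have "insert ?v ?S \<in> insert ?v ` {S \<in> closed_below K j. par ?v \<in> S}" by (rule image_eqI[OF refl])
      then have "S \<in> insert ?v ` {S \<in> closed_below K j. par ?v \<in> S}" by (simp only: insert_Diff[OF True])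
      moreover have "?v \<in> K" using True S(2) by blast
      ultimately show ?thesis by (simp only: if_True Un_iff simp_thms)
    qed
  qed
  show "?R \<subseteq> ?L" using j ord_less by (auto simp: closed_below_def lessThan_Suc par_closed_def)
qed

definition enum_static :: "nat set \<Rightarrow> store \<Rightarrow> bool" where
  "enum_static K s \<longleftrightarrow> scalar s ''n'' = n \<and> scalar s ''vs'' = r \<and> arr s ''par'' = par \<and>
     arr s ''ord'' = ord \<and> (\<forall>v<n. arr s ''p'' v = 2 ^ v) \<and> (\<forall>v<n. 0 < arr s ''K'' v \<longleftrightarrow> v \<in> K)"

text \<open>The loop appends to the list that it scans, so the old length is frozen in
  \<open>old\<close>, and the column is computed beforehand. New sets contain \<open>ord j\<close>
  and old ones do not; two new sets differ because the sets they extend do.\<close>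

lemma runs_enum_extend:
  assumes X: "lists_sets (closed_below K j) s" and j: "0 < j" "j < n"
    and v: "scalar s ''v'' = ord j" "ord j \<in> K" and st: "enum_static K s"
    and M: "M = card {S. par_closed S \<and> S \<subseteq> K}"
  shows "runs F enum_extend s (8 + 11 * M) (lists_sets (closed_below K (Suc j)))"
  unfolding enum_extend_def
proof (rule runs_Seq)
  let ?v = "ord j" and ?N = "scalar s ''N''"
  \<comment> \<open>Every intermediate list is at most as long as the final one, so \<open>M\<close>
    bounds the time of each round.\<close>
  have NM: "?N \<le> M" using lists_sets_card[OF X] card_closed_below_le by (simp add: M)
  show "runs F (Assign ''b'' (Arr ''par'' (Var ''v''))) s 1 (\<lambda>s1. s1 = set_var s ''b'' (par ?v))"
    by (rule runs_straight) (use v st in \<open>auto simp: enum_static_def\<close>)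
  fix s1 assume s1: "s1 = set_var s ''b'' (par ?v)"
  show "runs F (column_prog ;; Assign ''old'' (Var ''N'') ;; For ''i'' (Num 0) (Var ''old'') enum_add) s1
    (7 + 11 * M) (lists_sets (closed_below K (Suc j)))"
  proof (rule runs_Seq)
    show "runs F column_prog s1 (4 + 4 * M) (\<lambda>s2. \<forall>i<?N. 0 < arr s2 ''col'' i \<longleftrightarrow> par ?v \<in> code_set s i)"
      using runs_column[of s1 "par ?v" M F] X NM by (simp add: s1 lists_sets_def listing_def)
    fix s2 assume fr2: "frame column_prog s1 s2"
      and col: "\<forall>i<?N. 0 < arr s2 ''col'' i \<longleftrightarrow> par ?v \<in> code_set s i"
    show "runs F (Assign ''old'' (Var ''N'') ;; For ''i'' (Num 0) (Var ''old'') enum_add) s2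
      (3 + 7 * M) (lists_sets (closed_below K (Suc j)))"
    proof (rule runs_Seq)
      show "runs F (Assign ''old'' (Var ''N'')) s2 1 (\<lambda>s3. s3 = set_var s2 ''old'' ?N)"
        by (rule runs_straight) (use fr2 in \<open>auto simp: frame_def s1 enum_defs\<close>)
      fix s3 assume s3: "s3 = set_var s2 ''old'' ?N"
      let ?X = "\<lambda>i. closed_below K j \<union> {insert ?v (code_set s h) |h. h < i \<and> par ?v \<in> code_set s h}"
      let ?I = "\<lambda>i s'. ?N \<le> scalar s' ''N'' \<and> (\<forall>h<?N. arr s' ''sets'' h = arr s ''sets'' h) \<and> lists_sets (?X i) s'"
      have S: "code_set s h \<in> closed_below K j" if "h < ?N" for h
        using X that by (auto simp: lists_sets_def)
      have notin: "?v \<notin> Y" if "Y \<in> closed_below K j" for Y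
        using ord_notin[OF j(2)] that by (auto simp: closed_below_def)
      have eq3: "scalar s3 ''N'' = ?N" "arr s3 ''sets'' = arr s ''sets''" "arr s3 ''LV'' = arr s ''LV''"
        "arr s3 ''LP'' = arr s ''LP''" "arr s3 ''p'' = arr s ''p''" "scalar s3 ''v'' = ?v" "arr s3 ''col'' = arr s2 ''col''"
        using fr2 v by (simp_all add: frame_def s1 s3 enum_defs)
      have X3: "lists_sets (closed_below K j) s3" by (rule lists_sets_cong[OF X]) (simp_all add: eq3)
      have Xend: "?X ?N = closed_below K (Suc j)"
      proof -
        have img: "insert ?v ` {S \<in> f ` {..<?N}. P S} = {insert ?v (f h) |h. h < ?N \<and> P (f h)}"
          for f :: "nat \<Rightarrow> nat set" and P by blast
        have "closed_below K j = code_set s ` {..<?N}" using X by (simp only: lists_sets_def)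
        then have "insert ?v ` {S \<in> closed_below K j. par ?v \<in> S} =
            {insert ?v (code_set s h) |h. h < ?N \<and> par ?v \<in> code_set s h}"
          using img[of "code_set s" "\<lambda>S. par ?v \<in> S"] by (simp only:)
        then show ?thesis unfolding closed_below_Suc[OF j] using v(2) by (simp only: if_True)
      qed
      show "runs F (For ''i'' (Num 0) (Var ''old'') enum_add) s3 (2 + 7 * M) (lists_sets (closed_below K (Suc j)))"
      proof (rule runs_For[where l = 0 and B = ?N and m = 5 and I = ?I])
        fix i s' assume i: "i < ?N" "scalar s' ''i'' = i"
          and fr: "frame (For ''i'' (Num 0) (Var ''old'') enum_add) s3 s'" and I: "?I i s'"
        have st': "scalar s' ''v'' = ?v" "arr s' ''p'' = arr s ''p''" "arr s' ''col'' = arr s2 ''col''"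
          using fr by (simp_all add: frame_def enum_defs eq3)
        have p: "arr s ''p'' ?v = 2 ^ ?v" using st ord_less[OF j(2)] by (simp add: enum_static_def)
        have cs: "code_set s' i = code_set s i" "i < scalar s' ''N''" using I i by auto
        define s'' where "s'' = result F enum_add s'"
        have "?I (Suc i) (set_var s'' ''i'' (Suc i))"
        proof (cases "par ?v \<in> code_set s i")
          case False
          then have "s'' = s'" using col i st' by (simp add: s''_def enum_add_def)
          moreover have "?X (Suc i) = ?X i" using False by (auto simp: less_Suc_eq)
          moreover have "lists_sets (?X i) (set_var s' ''i'' (Suc i))"
            by (rule lists_sets_cong[OF conjunct2[OF conjunct2[OF I]]]) simp_all
          ultimately show ?thesis using I by simp
        next
          case True
          have "0 < arr s' ''col'' i" using True col i st' by simp
          then have s'': "arr s'' ''sets'' = (arr s' ''sets'')(scalar s' ''N'' := arr s' ''sets'' i + 2 ^ ?v)"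
            "arr s'' ''LV'' = (arr s' ''LV'')(scalar s' ''N'' := ?v)"
            "arr s'' ''LP'' = (arr s' ''LP'')(scalar s' ''N'' := i)"
            "scalar s'' ''N'' = Suc (scalar s' ''N'')"
            using i st' p by (simp_all add: s''_def enum_add_def)
          have "insert ?v (code_set s i) \<notin> ?X i"
          proof
            assume "insert ?v (code_set s i) \<in> ?X i"
            then obtain h where h: "h < i" "insert ?v (code_set s i) = insert ?v (code_set s h)"
              using notin by auto
            have "code_set s i = code_set s h"
              using h insert_ident[OF notin[OF S] notin[OF S], of i h] i(1) by simp
            have "inj_on (code_set s) {..<?N}" using X by (simp only: lists_sets_def)
            from inj_onD[OF this \<open>code_set s i = code_set s h\<close>] have "i = h" using h(1) i(1) by simp
            then show False using h(1) by simp
          qed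
          then have "lists_sets (insert (insert ?v (code_set s i)) (?X i)) (set_var s'' ''i'' (Suc i))"
            using lists_sets_append[of "?X i" s' i ?v "set_var s'' ''i'' (Suc i)"] I cs s'' notin S i by simp
          moreover have "insert (insert ?v (code_set s i)) (?X i) = ?X (Suc i)"
            using True by (auto simp: less_Suc_eq)
          ultimately show ?thesis using I s'' by simp
        qed
        then show "runs F enum_add s' 5 (\<lambda>s''. ?I (Suc i) (set_var s'' ''i'' (Suc i)))"
          unfolding s''_def by (intro runs_straight) (simp_all only:, simp_all add: enum_add_def)
      next
        show "?I 0 (set_var s3 ''i'' 0)"
          using lists_sets_cong[OF X3, of "set_var s3 ''i'' 0"] by (simp add: eq3)
      next
        fix s' assume "?I ?N s'"
        then show "lists_sets (closed_below K (Suc j)) s'" using Xend by simp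
      qed (use NM in \<open>auto simp: frame_def enum_defs s3\<close>)
    qed simp
  qed simp
qed simp

lemma runs_enum:
  assumes st: "enum_static K s" and K: "r \<in> K" and M: "M = card {S. par_closed S \<and> S \<subseteq> K}"
  shows "runs F enum_prog s (5 + n * (12 + 11 * M)) (lists_sets {S. par_closed S \<and> S \<subseteq> K})"
  unfolding enum_prog_def
proof (rule runs_Seq)
  show "runs F enum_init s 3 (lists_sets (closed_below K 1))"
    unfolding closed_below_1[OF K]
    by (rule runs_straight)
      (use st r_less in \<open>simp_all add: enum_init_def lists_sets_def listing_def enum_static_def
        set_decode_power_2 lessThan_Suc\<close>)
  fix s1 assume fr1: "frame enum_init s s1" and X1: "lists_sets (closed_below K 1) s1"
  show "runs F (For ''j'' (Num 1) (Var ''n'') enum_vertex) s1 (2 + n * (12 + 11 * M))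
    (lists_sets {S. par_closed S \<and> S \<subseteq> K})"
  proof (rule runs_For[where l = 1 and B = n and m = "10 + 11 * M" and I = "\<lambda>j. lists_sets (closed_below K j)"])
    fix j s' assume j: "1 \<le> j" "j < n" "scalar s' ''j'' = j"
      and fr: "frame (For ''j'' (Num 1) (Var ''n'') enum_vertex) s1 s'"
      and X: "lists_sets (closed_below K j) s'"
    have st': "enum_static K s'" using st fr fr1 by (simp add: enum_static_def frame_def enum_defs)
    show "runs F enum_vertex s' (10 + 11 * M) (\<lambda>s''. lists_sets (closed_below K (Suc j)) (set_var s'' ''j'' (Suc j)))"
      unfolding enum_vertex_def
    proof (rule runs_Seq)
      show "runs F (Assign ''v'' (Arr ''ord'' (Var ''j''))) s' 1 (\<lambda>s2. s2 = set_var s' ''v'' (ord j))"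
        by (rule runs_straight) (use st' j in \<open>auto simp: enum_static_def\<close>)
      fix s2 assume s2: "s2 = set_var s' ''v'' (ord j)"
      have st2: "enum_static K s2" using st' by (simp add: s2 enum_static_def)
      have X2: "lists_sets (closed_below K j) s2" by (rule lists_sets_cong[OF X]) (simp_all add: s2)
      have Kv: "0 < arr s2 ''K'' (scalar s2 ''v'') \<longleftrightarrow> ord j \<in> K"
        using st2 ord_less[OF j(2)] by (simp add: s2 enum_static_def)
      show "runs F (Cond (Less (Num 0) (Arr ''K'' (Var ''v''))) enum_extend Skip) s2 (9 + 11 * M)
        (\<lambda>s''. lists_sets (closed_below K (Suc j)) (set_var s'' ''j'' (Suc j)))"
      proof (rule runs_Cond)
        assume "bval F s2 (Less (Num 0) (Arr ''K'' (Var ''v'')))"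
        then have "ord j \<in> K" using Kv by simp
        then have "runs F enum_extend s2 (8 + 11 * M) (lists_sets (closed_below K (Suc j)))"
          using runs_enum_extend[OF X2 _ j(2) _ _ st2 M] j by (simp add: s2)
        then show "runs F enum_extend s2 (8 + 11 * M)
          (\<lambda>s''. lists_sets (closed_below K (Suc j)) (set_var s'' ''j'' (Suc j)))"
          by (rule runs_weaken) (auto elim: lists_sets_cong)
      next
        assume "\<not> bval F s2 (Less (Num 0) (Arr ''K'' (Var ''v'')))"
        then have "ord j \<notin> K" using Kv by simp
        then have "closed_below K (Suc j) = closed_below K j"
          using closed_below_Suc[of j K] j by simp
        then show "runs F Skip s2 (8 + 11 * M)
          (\<lambda>s''. lists_sets (closed_below K (Suc j)) (set_var s'' ''j'' (Suc j)))"
          using lists_sets_cong[OF X2, of "set_var s2 ''j'' (Suc j)"] by (intro runs_straight) simp_all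
      qed simp
    qed simp
  next
    fix s' assume "lists_sets (closed_below K n) s'"
    then show "lists_sets {S. par_closed S \<and> S \<subseteq> K} s'" by (simp add: closed_below_full)
  next
    show "lists_sets (closed_below K 1) (set_var s1 ''j'' 1)" by (rule lists_sets_cong[OF X1]) simp_all
  next
    fix s' assume "frame (For ''j'' (Num 1) (Var ''n'') enum_vertex) s1 s'"
    then show "aval F s' (Var ''n'') = n" using fr1 st by (simp add: frame_def enum_defs enum_static_def)
  next
    have "(n - 1) * (12 + 11 * M) \<le> n * (12 + 11 * M)" by (intro mult_right_mono) auto
    then show "2 + (n - 1) * (10 + 11 * M + 2) \<le> 2 + n * (12 + 11 * M)" by simp
  qed (use r_less in \<open>auto simp: enum_defs\<close>)
qed simp

end

section \<open>The dynamic program\<close>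

abbreviation pow_vertex :: "aexp \<Rightarrow> aexp" where
  "pow_vertex a \<equiv> Arr ''p'' (Plus (Var ''n'') a)"

abbreviation pow_count :: "aexp \<Rightarrow> aexp" where
  "pow_count a \<equiv> Arr ''p'' (Plus (Plus (Var ''n'') (Var ''n'')) a)"

abbreviation pow_time :: "aexp \<Rightarrow> aexp" where
  "pow_time a \<equiv> Arr ''p'' (Plus (Plus (Plus (Var ''n'') (Var ''n'')) (Plus (Var ''k'') (Num 1))) a)"

text \<open>\<open>w\<close> and \<open>q\<close> are one more than a cost each, so
  \<open>w + q - 1\<close> is one more than their sum. A zero entry stands for infinity and is
  replaced by any finite candidate.\<close>

definition dp_relax :: com where
  "dp_relax =
     Assign ''q'' (CostAt (Var ''a'') (Var ''b'') (Var ''t'') (Var ''y'')) ;;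
     Assign ''z'' (Plus (Var ''base'') (pow_time (Var ''y''))) ;;
     Cond (Conj (Conj (Less (Num 0) (Var ''w'')) (Less (Num 0) (Var ''q'')))
                (Neg (Conj (Less (Num 0) (Arr ''best'' (Var ''z'')))
                           (Neg (Less (Minus (Plus (Var ''w'') (Var ''q'')) (Num 1)) (Arr ''best'' (Var ''z'')))))))
       (Store ''best'' (Var ''z'') (Minus (Plus (Var ''w'') (Var ''q'')) (Num 1)))
       Skip"

text \<open>\<open>base\<close> is the target address without its time bit, the only part that
  varies in the inner loop over arrival times.\<close>

definition dp_load :: com where
  "dp_load =
     Assign ''w'' (Arr ''best'' (Plus (Plus (Plus (Arr ''sets'' (Var ''i'')) (pow_vertex (Var ''a'')))
       (pow_count (Var ''c''))) (pow_time (Var ''t'')))) ;;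
     Cond (Conj (Less (Num 0) (Var ''new'')) (Less (Var ''c'') (Var ''k'')))
       (Assign ''d'' (Plus (Var ''c'') (Num 1)))
       (Assign ''d'' (Var ''c'')) ;;
     Assign ''base'' (Plus (Plus (Var ''code'') (pow_vertex (Var ''b''))) (pow_count (Var ''d'')))"

definition dp_count :: com where
  "dp_count = dp_load ;; For ''y'' (Plus (Var ''t'') (Num 1)) (Plus (Var ''T'') (Num 1)) dp_relax"

text \<open>The new set and the freshness of the target depend neither on the counter nor on the
  arrival time, so they are computed once per set.\<close>

definition dp_target :: com where
  "dp_target =
     Cond (Less (Num 0) (Arr ''K'' (Var ''b'')))
       (Cond (Less (Num 0) (Arr ''col'' (Var ''i'')))
          (Assign ''new'' (Num 0) ;; Assign ''code'' (Arr ''sets'' (Var ''i'')))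
          (Assign ''new'' (Num 1) ;; Assign ''code'' (Plus (Arr ''sets'' (Var ''i'')) (Arr ''p'' (Var ''b'')))))
       (Assign ''code'' (Arr ''sets'' (Var ''i'')) ;;
        Cond (Eq (Arr ''par'' (Var ''b'')) (Var ''a'')) (Assign ''new'' (Num 1)) (Assign ''new'' (Num 0)))"

definition dp_set :: com where
  "dp_set = dp_target ;; For ''c'' (Num 0) (Plus (Var ''k'') (Num 1)) dp_count"

definition dp_edge :: com where
  "dp_edge =
     Assign ''a'' (Arr ''src'' (Var ''e'')) ;;
     Assign ''b'' (Arr ''dst'' (Var ''e'')) ;;
     column_prog ;;
     For ''i'' (Num 0) (Var ''N'') dp_set"

definition dp_time :: com where
  "dp_time = For ''e'' (Num 0) (Plus (Plus (Var ''n'') (Var ''n'')) (Var ''n'')) dp_edge"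

definition dp_init :: com where
  "dp_init =
     Store ''best'' (Plus (Plus (Plus (Arr ''p'' (Var ''vs'')) (pow_vertex (Var ''vs'')))
       (pow_count (Num 1))) (pow_time (Num 1))) (Num 1)"

definition dp_prog :: com where
  "dp_prog = dp_init ;; For ''t'' (Num 1) (Plus (Var ''T'') (Num 1)) dp_time"

definition answer_step :: com where
  "answer_step =
     Assign ''w'' (Arr ''best'' (Plus (Plus (Plus (Arr ''sets'' (Var ''i'')) (pow_vertex (Var ''vt'')))
       (pow_count (Var ''k''))) (pow_time (Var ''T'')))) ;;
     Cond (Conj (Less (Num 0) (Var ''w'')) (Less (Var ''w'') (Plus (Var ''f'') (Num 2))))
       (Assign ''answer'' (Num 1)) Skip"

definition answer_prog :: com where
  "answer_prog = Assign ''answer'' (Num 0) ;; For ''i'' (Num 0) (Var ''N'') answer_step"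

lemmas dp_defs = dp_relax_def dp_load_def dp_count_def dp_target_def dp_set_def dp_edge_def dp_time_def
  dp_init_def answer_step_def column_prog_def

context core
begin

section \<open>Addresses of table entries\<close>

text \<open>Four disjoint blocks of bits: the core set itself, then vertex, counter and time with a
  single bit each. The time block comes last and needs no upper limit.\<close>

definition key :: "nat \<Rightarrow> nat \<Rightarrow> nat set \<Rightarrow> nat \<Rightarrow> nat" where
  "key t v S c = set_encode (S \<union> {n + v, 2 * n + c, 2 * n + k + 1 + t})"

definition valid_state :: "nat \<Rightarrow> nat set \<Rightarrow> nat \<Rightarrow> bool" where
  "valid_state v S c \<longleftrightarrow> v < n \<and> S \<subseteq> {..<n} \<and> c \<le> k"

text \<open>No two of the bits coincide, so the address is a sum of tabulated powers of two.\<close>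

lemma key_code:
  assumes "valid_state v S c" "set_decode m = S"
  shows "key t v S c = m + 2 ^ (n + v) + 2 ^ (2 * n + c) + 2 ^ (2 * n + k + 1 + t)"
proof -
  let ?x = "n + v" and ?y = "2 * n + c" and ?z = "2 * n + k + 1 + t"
  have S: "finite S" "?x \<notin> S" "?y \<notin> S" "?z \<notin> S"
    using assms(1) by (auto simp: valid_state_def intro: finite_subset)
  have ne: "?x \<noteq> ?y" "?x \<noteq> ?z" "?y \<noteq> ?z" using assms(1) by (auto simp: valid_state_def)
  have "key t v S c = set_encode (insert ?z (insert ?y (insert ?x S)))"
    by (simp add: key_def insert_commute)
  also have "\<dots> = 2 ^ ?z + (2 ^ ?y + (2 ^ ?x + set_encode S))"
    using S ne by (subst set_encode_insert; simp)+
  also have "set_encode S = m" using assms(2) by auto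
  finally show ?thesis by simp
qed

lemma key_inj:
  assumes "valid_state v S c" "valid_state v' S' c'" "key t v S c = key t' v' S' c'"
  shows "t = t' \<and> v = v' \<and> S = S' \<and> c = c'"
proof -
  let ?A = "\<lambda>t v S c. S \<union> {n + v, 2 * n + c, 2 * n + k + 1 + t}"
  have fin: "finite S" "finite S'" using assms(1,2) by (auto simp: valid_state_def intro: finite_subset)
  then have eq: "?A t v S c = ?A t' v' S' c'"
    using assms(3) unfolding key_def by (subst (asm) set_encode_eq) auto
  have lt: "v < n" "v' < n" "c \<le> k" "c' \<le> k" "\<And>x. x \<in> S \<Longrightarrow> x < n" "\<And>x. x \<in> S' \<Longrightarrow> x < n"
    using assms(1,2) by (auto simp: valid_state_def)
  have "n + v \<in> ?A t' v' S' c'" using eq by blast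
  then have "v = v'" using lt by (auto dest: lt(6))
  have "2 * n + c \<in> ?A t' v' S' c'" using eq by blast
  then have "c = c'" using lt by (auto dest: lt(6))
  have "2 * n + k + 1 + t \<in> ?A t' v' S' c'" using eq by blast
  then have "t = t'" using lt by (auto dest: lt(6))
  have inter: "?A t v S c \<inter> {..<n} = S" if "valid_state v S c" for t v S c
    using that by (auto simp: valid_state_def)
  have "S = ?A t v S c \<inter> {..<n}" by (rule inter[OF assms(1), symmetric])
  also have "\<dots> = ?A t' v' S' c' \<inter> {..<n}" by (simp only: eq)
  also have "\<dots> = S'" by (rule inter[OF assms(2)])
  finally have "S = S'" .
  then show ?thesis using \<open>v = v'\<close> \<open>c = c'\<close> \<open>t = t'\<close> by simp
qed

section \<open>Relaxation and the invariants of the table\<close>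

definition step_set :: "nat set \<Rightarrow> nat \<Rightarrow> nat set" where
  "step_set S b = (if b \<in> K then insert b S else S)"

definition step_count :: "nat set \<Rightarrow> nat \<Rightarrow> nat \<Rightarrow> nat \<Rightarrow> nat" where
  "step_count S a b c = (if fresh S a b \<and> c < k then Suc c else c)"

lemma valid_step: "valid_state a S c \<Longrightarrow> b < n \<Longrightarrow> valid_state b (step_set S b) (step_count S a b c)"
  by (auto simp: valid_state_def step_set_def step_count_def)

text \<open>A table entry is one more than a cost, with \<open>0\<close> standing for \<open>\<infinity>\<close>.\<close>

definition sound :: "(nat \<Rightarrow> nat) \<Rightarrow> bool" where
  "sound A \<longleftrightarrow> (\<forall>t v S c. valid_state v S c \<longrightarrow> 0 < A (key t v S c) \<longrightarrow>
     reach t v S c (A (key t v S c) - 1))"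

text \<open>\<open>t\<close> is the departure time under treatment: writes go to later times only,
  so entries up to \<open>t\<close> are frozen, while the others can only get better.\<close>

definition improves :: "nat \<Rightarrow> (nat \<Rightarrow> nat) \<Rightarrow> (nat \<Rightarrow> nat) \<Rightarrow> bool" where
  "improves t A A' \<longleftrightarrow> (\<forall>z. 0 < A z \<longrightarrow> 0 < A' z \<and> A' z \<le> A z) \<and>
     (\<forall>t' v S c. t' \<le> t \<longrightarrow> valid_state v S c \<longrightarrow> A' (key t' v S c) = A (key t' v S c))"

text \<open>The triangle inequality for one move. Both entries are one more than a cost, so the
  bound by \<open>y\<close> needs no correction.\<close>

definition relaxed :: "(nat \<Rightarrow> nat) \<Rightarrow> nat \<Rightarrow> nat \<Rightarrow> nat \<Rightarrow> nat set \<Rightarrow> nat \<Rightarrow> nat \<Rightarrow> bool" where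
  "relaxed A t a b S c t' \<longleftrightarrow> (\<forall>y. 0 < A (key t a S c) \<longrightarrow> F a b t t' = enat y \<longrightarrow>
     0 < A (key t' b (step_set S b) (step_count S a b c)) \<and>
     A (key t' b (step_set S b) (step_count S a b c)) \<le> A (key t a S c) + y)"

lemma improves_refl: "improves t A A"
  by (simp add: improves_def)

lemma improves_trans: "improves t A A' \<Longrightarrow> improves t A' A'' \<Longrightarrow> improves t A A''"
  unfolding improves_def by (metis le_trans)

lemma improves_mono: "improves t A A' \<Longrightarrow> t' \<le> t \<Longrightarrow> improves t' A A'"
  unfolding improves_def by (meson le_trans)

text \<open>The source entry belongs to time \<open>t\<close> and is frozen; the target entry can
  only decrease.\<close>

lemma relaxed_improves:
  assumes "relaxed A t a b S c t'" "improves t A A'" "valid_state a S c"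
  shows "relaxed A' t a b S c t'"
proof -
  have "A' (key t a S c) = A (key t a S c)" using assms(2,3) by (auto simp: improves_def)
  then show ?thesis using assms(1,2) unfolding relaxed_def improves_def by (metis le_trans)
qed

text \<open>Valid states have distinct addresses, so writing at \<open>z\<close> changes the entry
  of a single state; and as \<open>z\<close> carries the time \<open>t' > t\<close>, no frozen entry
  is touched.\<close>

lemma relax:
  assumes A: "sound A" and v: "valid_state a S c" "b < n" "t < t'" "t' \<le> T"
    and w: "0 < A (key t a S c)" and y: "F a b t t' = enat y"
  defines "z \<equiv> key t' b (step_set S b) (step_count S a b c)" and "x \<equiv> A (key t a S c) + y"
  defines "A' \<equiv> if A z = 0 \<or> x < A z then A(z := x) else A"
  shows "sound A' \<and> improves t A A' \<and> relaxed A' t a b S c t'"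
proof -
  note vz = valid_step[OF v(1,2)]
  have "reach t a S c (A (key t a S c) - 1)" using A v(1) w by (auto simp: sound_def)
  from reach_step[OF this v(2) _ y] v(3,4) have
    "reach t' b (step_set S b) (step_count S a b c) (A (key t a S c) - 1 + y)"
    by (simp add: step_set_def step_count_def)
  moreover have "A (key t a S c) - 1 + y = x - 1" using w by (simp add: x_def)
  ultimately have r: "reach t' b (step_set S b) (step_count S a b c) (x - 1)" by simp
  have "sound (A(z := x))" unfolding sound_def
  proof (intro allI impI)
    fix s u R d assume u: "valid_state u R d" and pos: "0 < (A(z := x)) (key s u R d)"
    show "reach s u R d ((A(z := x)) (key s u R d) - 1)"
    proof (cases "key s u R d = z")
      case True
      then have "s = t' \<and> u = b \<and> R = step_set S b \<and> d = step_count S a b c"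
        using key_inj[OF u vz] by (simp add: z_def)
      then show ?thesis using r True by simp
    next
      case False
      then show ?thesis using A u pos by (auto simp: sound_def)
    qed
  qed
  then have "sound A'" using A by (simp add: A'_def)
  moreover have ne: "key s u R d \<noteq> z" if "s \<le> t" "valid_state u R d" for s u R d
    using key_inj[OF that(2) vz, of s t'] that(1) v(3) by (auto simp: z_def)
  then have imp: "improves t A A'" using w by (auto simp: improves_def A'_def x_def)
  moreover have "A' (key t a S c) = A (key t a S c)" using imp v(1) by (auto simp: improves_def)
  then have "relaxed A' t a b S c t'"
    unfolding relaxed_def using y w by (auto simp: A'_def x_def simp flip: z_def)
  ultimately show ?thesis by blast
qed

text \<open>The common pattern of the nested loops: round \<open>j\<close> establishes
  \<open>R j\<close>, and later rounds, which only improve the table, cannot destroy it.\<close>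

lemma runs_For_table:
  assumes lo: "aval F s lo = l" "l \<le> B"
    and hi: "\<And>s'. frame (For x lo hi c) s s' \<Longrightarrow> aval F s' hi = B"
    and x: "x \<notin> written_vars c"
    and snd: "sound (arr s ''best'')"
    and persist: "\<And>j A A'. l \<le> j \<Longrightarrow> j < B \<Longrightarrow> R j A \<Longrightarrow> improves t A A' \<Longrightarrow> R j A'"
    and step: "\<And>j s'. l \<le> j \<Longrightarrow> j < B \<Longrightarrow> frame (For x lo hi c) s s' \<Longrightarrow> scalar s' x = j \<Longrightarrow>
      sound (arr s' ''best'') \<Longrightarrow> improves t (arr s ''best'') (arr s' ''best'') \<Longrightarrow>
      runs F c s' m (\<lambda>s''. sound (arr s'' ''best'') \<and> improves t (arr s' ''best'') (arr s'' ''best'') \<and>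
        R j (arr s'' ''best''))"
    and M: "2 + (B - l) * (m + 2) \<le> M"
  shows "runs F (For x lo hi c) s M (\<lambda>s'. sound (arr s' ''best'') \<and>
    improves t (arr s ''best'') (arr s' ''best'') \<and> (\<forall>j. l \<le> j \<longrightarrow> j < B \<longrightarrow> R j (arr s' ''best'')))"
proof (rule runs_For[where l = l and B = B and m = m and
      I = "\<lambda>j s'. sound (arr s' ''best'') \<and> improves t (arr s ''best'') (arr s' ''best'') \<and>
        (\<forall>i. l \<le> i \<longrightarrow> i < j \<longrightarrow> R i (arr s' ''best''))"])
  fix j s'
  assume j: "l \<le> j" "j < B" "frame (For x lo hi c) s s'" "scalar s' x = j"
    and I: "sound (arr s' ''best'') \<and> improves t (arr s ''best'') (arr s' ''best'') \<and>
        (\<forall>i. l \<le> i \<longrightarrow> i < j \<longrightarrow> R i (arr s' ''best''))"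
  have "runs F c s' m (\<lambda>s''. sound (arr s'' ''best'') \<and> improves t (arr s' ''best'') (arr s'' ''best'') \<and>
        R j (arr s'' ''best''))" using step[OF j] I by blast
  then show "runs F c s' m (\<lambda>s''. sound (arr (set_var s'' x (Suc j)) ''best'') \<and>
      improves t (arr s ''best'') (arr (set_var s'' x (Suc j)) ''best'') \<and>
      (\<forall>i. l \<le> i \<longrightarrow> i < Suc j \<longrightarrow> R i (arr (set_var s'' x (Suc j)) ''best'')))"
  proof (rule runs_weaken)
    fix s'' :: store
    assume s'': "sound (arr s'' ''best'') \<and> improves t (arr s' ''best'') (arr s'' ''best'') \<and> R j (arr s'' ''best'')"
    then have "R i (arr s'' ''best'')" if "l \<le> i" "i < Suc j" for i
      using I persist[of i "arr s' ''best''" "arr s'' ''best''"] that j by (cases "i = j") auto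
    then show "sound (arr (set_var s'' x (Suc j)) ''best'') \<and>
      improves t (arr s ''best'') (arr (set_var s'' x (Suc j)) ''best'') \<and>
      (\<forall>i. l \<le> i \<longrightarrow> i < Suc j \<longrightarrow> R i (arr (set_var s'' x (Suc j)) ''best''))"
      using I s'' improves_trans by auto
  qed simp
qed (use assms improves_refl in auto)

definition dp_static :: "store \<Rightarrow> bool" where
  "dp_static s \<longleftrightarrow> scalar s ''n'' = n \<and> scalar s ''T'' = T \<and> scalar s ''k'' = k \<and>
     (\<forall>i\<le>2 * n + k + T + 1. arr s ''p'' i = 2 ^ i) \<and> arr s ''par'' = par \<and>
     (\<forall>v<n. 0 < arr s ''K'' v \<longleftrightarrow> v \<in> K) \<and> lists_sets {S. par_closed S \<and> S \<subseteq> K} s \<and>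
     (\<forall>e<3 * n. arr s ''src'' e < n \<and> arr s ''dst'' e < n) \<and>
     (\<forall>a b. a < n \<longrightarrow> b < n \<longrightarrow> a = b \<or> par a = b \<or> par b = a \<longrightarrow>
       (\<exists>e<3 * n. arr s ''src'' e = a \<and> arr s ''dst'' e = b))"

lemma dp_static_cong:
  assumes "dp_static s"
    "scalar s' ''n'' = scalar s ''n''" "scalar s' ''T'' = scalar s ''T''"
    "scalar s' ''k'' = scalar s ''k''" "scalar s' ''N'' = scalar s ''N''"
    "arr s' ''p'' = arr s ''p''" "arr s' ''par'' = arr s ''par''" "arr s' ''K'' = arr s ''K''"
    "arr s' ''sets'' = arr s ''sets''" "arr s' ''LV'' = arr s ''LV''" "arr s' ''LP'' = arr s ''LP''"
    "arr s' ''src'' = arr s ''src''" "arr s' ''dst'' = arr s ''dst''"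
  shows "dp_static s'"
  using assms lists_sets_cong[of _ s s'] unfolding dp_static_def by simp

lemma dp_static_pow:
  assumes "dp_static s"
  shows "v < n \<Longrightarrow> arr s ''p'' v = 2 ^ v" "v < n \<Longrightarrow> arr s ''p'' (n + v) = 2 ^ (n + v)"
    "c \<le> k \<Longrightarrow> arr s ''p'' (2 * n + c) = 2 ^ (2 * n + c)"
    "t \<le> T \<Longrightarrow> arr s ''p'' (2 * n + k + 1 + t) = 2 ^ (2 * n + k + 1 + t)"
  using assms by (auto simp: dp_static_def)

section \<open>The nested loops\<close>

lemma runs_dp_relax:
  assumes st: "dp_static s" and A: "sound (arr s ''best'')"
    and v: "valid_state a S c" "b < n" "t < t'" "t' \<le> T"
    and s: "scalar s ''a'' = a" "scalar s ''b'' = b" "scalar s ''t'' = t" "scalar s ''y'' = t'"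
      "scalar s ''w'' = arr s ''best'' (key t a S c)"
    and base: "scalar s ''base'' + 2 ^ (2 * n + k + 1 + t') = key t' b (step_set S b) (step_count S a b c)"
  shows "runs F dp_relax s 4 (\<lambda>s'. sound (arr s' ''best'') \<and>
    improves t (arr s ''best'') (arr s' ''best'') \<and> relaxed (arr s' ''best'') t a b S c t')"
proof -
  let ?A = "arr s ''best''" and ?z = "key t' b (step_set S b) (step_count S a b c)"
  have sc: "scalar s ''n'' = n" "scalar s ''k'' = k" using st by (auto simp: dp_static_def)
  have pt: "arr s ''p'' (2 * n + k + 1 + t') = 2 ^ (2 * n + k + 1 + t')"
    using dp_static_pow(4)[OF st v(4)] .
  have z: "scalar s ''base'' + arr s ''p'' (n + n + (k + 1) + t') = ?z"
    using base pt by (simp add: mult_2 add.assoc)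
  show ?thesis
  proof (cases "0 < ?A (key t a S c) \<and> F a b t t' \<noteq> \<infinity>")
    case False
    then have "arr (result F dp_relax s) ''best'' = ?A"
      by (auto simp: dp_relax_def s encode_cost_def)
    moreover have "relaxed ?A t a b S c t'" using False by (auto simp: relaxed_def)
    ultimately show ?thesis using A improves_refl
      by (intro runs_straight) (simp_all only:, simp_all add: dp_relax_def)
  next
    case True
    then obtain y where y: "F a b t t' = enat y" by auto
    let ?x = "?A (key t a S c) + y"
    have "arr (result F dp_relax s) ''best'' = (if ?A ?z = 0 \<or> ?x < ?A ?z then ?A(?z := ?x) else ?A)"
      using True z y by (auto simp: dp_relax_def s sc encode_cost_def)
    with relax[OF A v _ y] True show ?thesis
      by (intro runs_straight) (simp_all only:, simp_all add: dp_relax_def)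
  qed
qed

lemma runs_dp_count:
  assumes st: "dp_static s" and A: "sound (arr s ''best'')"
    and v: "valid_state a S c" "b < n" "1 \<le> t" "t \<le> T"
    and s: "scalar s ''a'' = a" "scalar s ''b'' = b" "scalar s ''t'' = t" "scalar s ''c'' = c"
    and code: "code_set s (scalar s ''i'') = S" "set_decode (scalar s ''code'') = step_set S b"
      "0 < scalar s ''new'' \<longleftrightarrow> fresh S a b"
  shows "runs F dp_count s (6 + 6 * T) (\<lambda>s'. sound (arr s' ''best'') \<and>
    improves t (arr s ''best'') (arr s' ''best'') \<and>
    (\<forall>y\<in>{t<..T}. relaxed (arr s' ''best'') t a b S c y))"
proof -
  let ?A = "arr s ''best''" and ?d = "step_count S a b c"
  let ?loop = "For ''y'' (Plus (Var ''t'') (Num 1)) (Plus (Var ''T'') (Num 1)) dp_relax"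
  have sc: "scalar s ''n'' = n" "scalar s ''k'' = k" "scalar s ''T'' = T" using st by (auto simp: dp_static_def)
  have v': "a < n" "c \<le> k" using v(1) by (auto simp: valid_state_def)
  note vz = valid_step[OF v(1,2)]
  have dk: "?d \<le> k" using vz by (simp add: valid_state_def)
  have pw: "arr s ''p'' (n + a) = 2 ^ (n + a)" "arr s ''p'' (n + b) = 2 ^ (n + b)"
    "arr s ''p'' (n + n + c) = 2 ^ (2 * n + c)" "arr s ''p'' (n + n + ?d) = 2 ^ (2 * n + ?d)"
    "arr s ''p'' (n + n + (k + 1) + t) = 2 ^ (2 * n + k + 1 + t)"
    using dp_static_pow[OF st] v v' dk by (simp_all add: mult_2 add.assoc)
  have kt: "key t a S c = arr s ''sets'' (scalar s ''i'') + 2 ^ (n + a) + 2 ^ (2 * n + c) + 2 ^ (2 * n + k + 1 + t)"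
    using key_code[OF v(1) code(1)] .
  have w: "arr s ''sets'' (scalar s ''i'') + arr s ''p'' (n + a) + arr s ''p'' (n + n + c) +
      arr s ''p'' (n + n + (k + 1) + t) = key t a S c"
    unfolding pw kt ..
  define s1 where "s1 = result F dp_load s"
  have s1: "scalar s1 ''w'' = ?A (key t a S c)" "arr s1 = arr s"
    "scalar s1 ''base'' = scalar s ''code'' + 2 ^ (n + b) + 2 ^ (2 * n + ?d)"
    "scalar s1 ''n'' = n" "scalar s1 ''k'' = k" "scalar s1 ''T'' = T" "scalar s1 ''N'' = scalar s ''N''"
    "scalar s1 ''a'' = a" "scalar s1 ''b'' = b" "scalar s1 ''t'' = t"
    using w pw code(3) by (auto simp: s1_def dp_load_def s sc step_count_def)
  have st1: "dp_static s1" by (rule dp_static_cong[OF st]) (simp_all add: s1 sc)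
  have base: "scalar s1 ''base'' + 2 ^ (2 * n + k + 1 + y) = key y b (step_set S b) ?d" for y
    unfolding s1(3) key_code[OF vz code(2)] ..
  have pre: "runs F dp_load s 4 (\<lambda>s'. s' = s1)"
    by (rule runs_straight, simp add: dp_load_def, simp add: dp_load_def, simp add: s1_def)
  have loop: "runs F ?loop s1 (2 + 6 * T) (\<lambda>s'. sound (arr s' ''best'') \<and>
    improves t (arr s1 ''best'') (arr s' ''best'') \<and>
    (\<forall>y. t + 1 \<le> y \<longrightarrow> y < T + 1 \<longrightarrow> relaxed (arr s' ''best'') t a b S c y))"
  proof (rule runs_For_table[where m = 4])
    fix y s' assume y: "t + 1 \<le> y" "y < T + 1" "scalar s' ''y'' = y"
      and fr: "frame ?loop s1 s'" and A': "sound (arr s' ''best'')"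
      and imp: "improves t (arr s1 ''best'') (arr s' ''best'')"
    have st': "dp_static s'" by (rule dp_static_cong[OF st1]) (use fr in \<open>simp_all add: frame_def dp_defs\<close>)
    have s': "scalar s' ''w'' = scalar s1 ''w''" "scalar s' ''base'' = scalar s1 ''base''"
      "scalar s' ''a'' = a" "scalar s' ''b'' = b" "scalar s' ''t'' = t"
      using fr by (simp_all add: frame_def dp_defs s1(8-))
    have "arr s' ''best'' (key t a S c) = arr s1 ''best'' (key t a S c)"
      using imp v(1) by (auto simp: improves_def)
    then show "runs F dp_relax s' 4 (\<lambda>s''. sound (arr s'' ''best'') \<and>
        improves t (arr s' ''best'') (arr s'' ''best'') \<and> relaxed (arr s'' ''best'') t a b S c y)"
      by (intro runs_dp_relax[OF st' A' v(1,2)]) (use y s' s1 base in auto)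
  next
    show "2 + (T + 1 - (t + 1)) * (4 + 2) \<le> 2 + 6 * T" by simp
  qed (use v A relaxed_improves in \<open>auto simp: s1 frame_def dp_defs\<close>)
  show ?thesis unfolding dp_count_def
  proof (rule runs_Seq[OF pre])
    fix s' assume "s' = s1"
    then show "runs F ?loop s' (2 + 6 * T) (\<lambda>s'. sound (arr s' ''best'') \<and>
        improves t (arr s ''best'') (arr s' ''best'') \<and>
        (\<forall>y\<in>{t<..T}. relaxed (arr s' ''best'') t a b S c y))"
      using loop by (auto simp: s1(2) elim!: runs_weaken)
  qed simp
qed

lemma runs_dp_set:
  assumes st: "dp_static s" and A: "sound (arr s ''best'')"
    and v: "a < n" "b < n" "1 \<le> t" "t \<le> T"
    and s: "scalar s ''a'' = a" "scalar s ''b'' = b" "scalar s ''t'' = t" "scalar s ''i'' = i"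
    and S: "code_set s i = S" "S \<subseteq> {..<n}" and col: "0 < arr s ''col'' i \<longleftrightarrow> b \<in> S"
  shows "runs F dp_set s (6 + (k + 1) * (8 + 6 * T)) (\<lambda>s'. sound (arr s' ''best'') \<and>
    improves t (arr s ''best'') (arr s' ''best'') \<and>
    (\<forall>c\<le>k. \<forall>y\<in>{t<..T}. relaxed (arr s' ''best'') t a b S c y))"
  unfolding dp_set_def
proof (rule runs_Seq)
  let ?loop = "For ''c'' (Num 0) (Plus (Var ''k'') (Num 1)) dp_count"
  define s1 where "s1 = result F dp_target s"
  show "runs F dp_target s 4 (\<lambda>s'. s' = s1)"
    by (rule runs_straight, simp add: dp_target_def, simp add: dp_target_def, simp add: s1_def)
  fix s' assume s': "s' = s1"
  have Kb: "0 < arr s ''K'' b \<longleftrightarrow> b \<in> K" and par: "arr s ''par'' = par"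
    and pb: "arr s ''p'' b = 2 ^ b" and sc: "scalar s ''k'' = k"
    using st v by (auto simp: dp_static_def)
  have s1: "arr s1 = arr s" "scalar s1 ''n'' = scalar s ''n''" "scalar s1 ''k'' = scalar s ''k''"
    "scalar s1 ''T'' = scalar s ''T''" "scalar s1 ''N'' = scalar s ''N''"
    "scalar s1 ''a'' = a" "scalar s1 ''b'' = b" "scalar s1 ''t'' = t" "scalar s1 ''i'' = i"
    by (simp_all add: s1_def dp_target_def s)
  have st1: "dp_static s1" by (rule dp_static_cong[OF st]) (simp_all add: s1)
  have "set_decode (arr s ''sets'' i + 2 ^ b) = insert b S" if "b \<notin> S"
    using set_decode_plus_power_2[of b "arr s ''sets'' i"] that S(1) by (simp add: add.commute)
  then have code: "set_decode (scalar s1 ''code'') = step_set S b"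
    using S(1) col Kb by (auto simp: s1_def dp_target_def s pb step_set_def insert_absorb)
  have new: "0 < scalar s1 ''new'' \<longleftrightarrow> fresh S a b"
    using col Kb by (auto simp: s1_def dp_target_def s par fresh_def)
  have "runs F ?loop s1 (2 + (k + 1) * (8 + 6 * T)) (\<lambda>s'. sound (arr s' ''best'') \<and>
    improves t (arr s1 ''best'') (arr s' ''best'') \<and>
    (\<forall>c. 0 \<le> c \<longrightarrow> c < k + 1 \<longrightarrow> (\<forall>y\<in>{t<..T}. relaxed (arr s' ''best'') t a b S c y)))"
  proof (rule runs_For_table[where m = "6 + 6 * T"])
    fix c s' assume c: "c < k + 1" "scalar s' ''c'' = c" and fr: "frame ?loop s1 s'"
      and A': "sound (arr s' ''best'')"
    have st': "dp_static s'" by (rule dp_static_cong[OF st1]) (use fr in \<open>simp_all add: frame_def dp_defs\<close>)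
    have s'': "scalar s' ''new'' = scalar s1 ''new''" "scalar s' ''code'' = scalar s1 ''code''"
      "scalar s' ''a'' = a" "scalar s' ''b'' = b" "scalar s' ''t'' = t" "scalar s' ''i'' = i"
      "arr s' ''sets'' = arr s ''sets''"
      using fr by (simp_all add: frame_def dp_defs s1)
    show "runs F dp_count s' (6 + 6 * T) (\<lambda>s''. sound (arr s'' ''best'') \<and>
        improves t (arr s' ''best'') (arr s'' ''best'') \<and>
        (\<forall>y\<in>{t<..T}. relaxed (arr s'' ''best'') t a b S c y))"
      by (rule runs_dp_count[OF st' A' _ v(2-4)]) (use c v S code new s'' in \<open>simp_all add: valid_state_def\<close>)
  next
    fix c A A' assume "c < k + 1" "\<forall>y\<in>{t<..T}. relaxed A t a b S c y" "improves t A A'"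
    then show "\<forall>y\<in>{t<..T}. relaxed A' t a b S c y"
      using relaxed_improves v(1) S(2) by (auto simp: valid_state_def)
  qed (use A sc in \<open>auto simp: s1 frame_def dp_defs\<close>)
  then show "runs F ?loop s' (2 + (k + 1) * (8 + 6 * T)) (\<lambda>s'. sound (arr s' ''best'') \<and>
    improves t (arr s ''best'') (arr s' ''best'') \<and>
    (\<forall>c\<le>k. \<forall>y\<in>{t<..T}. relaxed (arr s' ''best'') t a b S c y))"
    unfolding s' by (rule runs_weaken) (auto simp: s1(1))
qed simp

definition all_relaxed :: "(nat \<Rightarrow> nat) \<Rightarrow> nat \<Rightarrow> nat \<Rightarrow> nat \<Rightarrow> bool" where
  "all_relaxed A t a b \<longleftrightarrow> (\<forall>S c. par_closed S \<longrightarrow> S \<subseteq> K \<longrightarrow> c \<le> k \<longrightarrow>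
     (\<forall>y\<in>{t<..T}. relaxed A t a b S c y))"

lemma all_relaxed_improves:
  assumes "all_relaxed A t a b" "improves t A A'" "a < n"
  shows "all_relaxed A' t a b"
  using assms(1) relaxed_improves[OF _ assms(2)] assms(3) unfolding all_relaxed_def
  by (auto simp: valid_state_def par_closed_def)

text \<open>One membership column for the target serves all sets and counters, at a cost linear in
  \<open>M\<close> per time and move.\<close>

lemma runs_dp_edge:
  assumes st: "dp_static s" and A: "sound (arr s ''best'')"
    and t: "1 \<le> t" "t \<le> T" "scalar s ''t'' = t" and e: "e < 3 * n" "scalar s ''e'' = e"
    and M: "M = card {S. par_closed S \<and> S \<subseteq> K}" and W: "W = 8 + (k + 1) * (8 + 6 * T)"
  shows "runs F dp_edge s (8 + 4 * M + M * W) (\<lambda>s'. sound (arr s' ''best'') \<and>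
    improves t (arr s ''best'') (arr s' ''best'') \<and>
    all_relaxed (arr s' ''best'') t (arr s ''src'' e) (arr s ''dst'' e))"
proof -
  let ?a = "arr s ''src'' e" and ?b = "arr s ''dst'' e" and ?C = "{S. par_closed S \<and> S \<subseteq> K}"
  let ?loop = "For ''i'' (Num 0) (Var ''N'') dp_set"
  let ?s1 = "set_var (set_var s ''a'' ?a) ''b'' ?b"
  have ab: "?a < n" "?b < n" and X: "lists_sets ?C s" using st e by (auto simp: dp_static_def)
  have N: "scalar s ''N'' = M" using lists_sets_card[OF X] by (simp add: M)
  have sets: "code_set s i \<in> ?C" if "i < M" for i
    using X that N unfolding lists_sets_def by blast
  have X1: "lists_sets ?C ?s1" by (rule lists_sets_cong[OF X]) simp_all
  have st1: "dp_static ?s1" by (rule dp_static_cong[OF st]) simp_all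
  have rest: "runs F (column_prog ;; ?loop) ?s1 ((4 + 4 * M) + (2 + M * W)) (\<lambda>s'. sound (arr s' ''best'') \<and>
    improves t (arr s ''best'') (arr s' ''best'') \<and> all_relaxed (arr s' ''best'') t ?a ?b)"
  proof (rule runs_Seq)
    show "runs F column_prog ?s1 (4 + 4 * M) (\<lambda>s2. \<forall>i<M. 0 < arr s2 ''col'' i \<longleftrightarrow> ?b \<in> code_set s i)"
      using runs_column[of ?s1 ?b M F] X1 N by (simp add: lists_sets_def)
    fix s2 assume fr2: "frame column_prog ?s1 s2"
      and col: "\<forall>i<M. 0 < arr s2 ''col'' i \<longleftrightarrow> ?b \<in> code_set s i"
    have st2: "dp_static s2" by (rule dp_static_cong[OF st1]) (use fr2 in \<open>simp_all add: frame_def dp_defs\<close>)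
    have s2: "scalar s2 ''a'' = ?a" "scalar s2 ''b'' = ?b" "scalar s2 ''t'' = t" "scalar s2 ''N'' = M"
      "arr s2 ''best'' = arr s ''best''" "arr s2 ''sets'' = arr s ''sets''"
      using fr2 t N by (simp_all add: frame_def dp_defs)
    have "runs F ?loop s2 (2 + M * W) (\<lambda>s'. sound (arr s' ''best'') \<and>
      improves t (arr s2 ''best'') (arr s' ''best'') \<and>
      (\<forall>i. 0 \<le> i \<longrightarrow> i < M \<longrightarrow>
        (\<forall>c\<le>k. \<forall>y\<in>{t<..T}. relaxed (arr s' ''best'') t ?a ?b (code_set s i) c y)))"
    proof (rule runs_For_table[where m = "6 + (k + 1) * (8 + 6 * T)"])
      fix i s' assume i: "i < M" "scalar s' ''i'' = i" and fr: "frame ?loop s2 s'"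
        and A': "sound (arr s' ''best'')"
      have st': "dp_static s'" by (rule dp_static_cong[OF st2]) (use fr in \<open>simp_all add: frame_def dp_defs\<close>)
      have s': "scalar s' ''a'' = ?a" "scalar s' ''b'' = ?b" "scalar s' ''t'' = t"
        "arr s' ''sets'' = arr s ''sets''" "arr s' ''col'' = arr s2 ''col''"
        using fr by (simp_all add: frame_def dp_defs s2)
      have "code_set s i \<subseteq> {..<n}" using sets[OF i(1)] by (simp add: par_closed_def)
      then show "runs F dp_set s' (6 + (k + 1) * (8 + 6 * T)) (\<lambda>s''. sound (arr s'' ''best'') \<and>
          improves t (arr s' ''best'') (arr s'' ''best'') \<and>
          (\<forall>c\<le>k. \<forall>y\<in>{t<..T}. relaxed (arr s'' ''best'') t ?a ?b (code_set s i) c y))"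
        by (intro runs_dp_set[OF st' A' ab t(1,2)]) (use i col[rule_format, OF i(1)] s' in simp_all)
    next
      fix i A A' assume "i < M" and imp: "improves t A A'"
        and R: "\<forall>c\<le>k. \<forall>y\<in>{t<..T}. relaxed A t ?a ?b (code_set s i) c y"
      have "valid_state ?a (code_set s i) c" if "c \<le> k" for c
        using sets[OF \<open>i < M\<close>] ab(1) that by (simp add: valid_state_def par_closed_def)
      then show "\<forall>c\<le>k. \<forall>y\<in>{t<..T}. relaxed A' t ?a ?b (code_set s i) c y"
        using relaxed_improves[OF _ imp] R by blast
    next
      fix s' assume "frame ?loop s2 s'"
      then show "aval F s' (Var ''N'') = M" by (simp add: frame_def dp_defs s2)
    qed (use A s2 W in \<open>auto simp: dp_defs\<close>)
    then show "runs F ?loop s2 (2 + M * W) (\<lambda>s'. sound (arr s' ''best'') \<and>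
      improves t (arr s ''best'') (arr s' ''best'') \<and> all_relaxed (arr s' ''best'') t ?a ?b)"
    proof (rule runs_weaken)
      fix s' assume s': "sound (arr s' ''best'') \<and>
        improves t (arr s2 ''best'') (arr s' ''best'') \<and>
        (\<forall>i. 0 \<le> i \<longrightarrow> i < M \<longrightarrow>
          (\<forall>c\<le>k. \<forall>y\<in>{t<..T}. relaxed (arr s' ''best'') t ?a ?b (code_set s i) c y))"
      have "all_relaxed (arr s' ''best'') t ?a ?b" unfolding all_relaxed_def
      proof (intro allI impI)
        fix S c assume "par_closed S" "S \<subseteq> K" "c \<le> k"
        then have "S \<in> code_set s ` {..<M}" using X N unfolding lists_sets_def by blast
        then obtain i where "i < M" "S = code_set s i" by blast
        then show "\<forall>y\<in>{t<..T}. relaxed (arr s' ''best'') t ?a ?b S c y" using s' \<open>c \<le> k\<close> by simp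
      qed
      then show "sound (arr s' ''best'') \<and> improves t (arr s ''best'') (arr s' ''best'') \<and>
        all_relaxed (arr s' ''best'') t ?a ?b" using s' s2(5) by simp
    qed simp
  qed simp
  show ?thesis unfolding dp_edge_def
  proof (rule runs_Seq)
    show "runs F (Assign ''a'' (Arr ''src'' (Var ''e''))) s 1 (\<lambda>s'. s' = set_var s ''a'' ?a)"
      by (rule runs_straight) (simp_all add: e)
    fix s' assume s': "s' = set_var s ''a'' ?a"
    show "runs F (Assign ''b'' (Arr ''dst'' (Var ''e'')) ;; column_prog ;; ?loop) s' (7 + 4 * M + M * W)
      (\<lambda>s'. sound (arr s' ''best'') \<and> improves t (arr s ''best'') (arr s' ''best'') \<and>
        all_relaxed (arr s' ''best'') t ?a ?b)"
    proof (rule runs_Seq)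
      show "runs F (Assign ''b'' (Arr ''dst'' (Var ''e''))) s' 1 (\<lambda>s1. s1 = ?s1)"
        by (rule runs_straight) (simp_all add: e s')
    qed (use rest in auto)
  qed simp
qed

text \<open>Scanning \<open>3 * n\<close> moves suffices: in a tree a finite cost occurs only for
  waiting and for moves to or from the parent.\<close>

lemma runs_dp_time:
  assumes st: "dp_static s" and A: "sound (arr s ''best'')"
    and t: "1 \<le> t" "t \<le> T" "scalar s ''t'' = t"
    and M: "M = card {S. par_closed S \<and> S \<subseteq> K}" and W: "W = 8 + (k + 1) * (8 + 6 * T)"
  shows "runs F dp_time s (2 + 3 * n * (10 + 4 * M + M * W)) (\<lambda>s'. sound (arr s' ''best'') \<and>
    improves t (arr s ''best'') (arr s' ''best'') \<and>
    (\<forall>a b. a < n \<longrightarrow> b < n \<longrightarrow> a = b \<or> par a = b \<or> par b = a \<longrightarrow> all_relaxed (arr s' ''best'') t a b))"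
  unfolding dp_time_def
proof (rule runs_weaken)
  let ?loop = "For ''e'' (Num 0) (Plus (Plus (Var ''n'') (Var ''n'')) (Var ''n'')) dp_edge"
  have ab: "\<forall>e<3 * n. arr s ''src'' e < n \<and> arr s ''dst'' e < n"
    and n: "scalar s ''n'' = n" using st by (auto simp: dp_static_def)
  show "runs F ?loop s (2 + 3 * n * (10 + 4 * M + M * W)) (\<lambda>s'. sound (arr s' ''best'') \<and>
    improves t (arr s ''best'') (arr s' ''best'') \<and>
    (\<forall>e. 0 \<le> e \<longrightarrow> e < 3 * n \<longrightarrow> all_relaxed (arr s' ''best'') t (arr s ''src'' e) (arr s ''dst'' e)))"
  proof (rule runs_For_table[where m = "8 + 4 * M + M * W"])
    fix e s' assume e: "e < 3 * n" "scalar s' ''e'' = e" and fr: "frame ?loop s s'"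
      and A': "sound (arr s' ''best'')"
    have st': "dp_static s'" by (rule dp_static_cong[OF st]) (use fr in \<open>simp_all add: frame_def dp_defs\<close>)
    have "scalar s' ''t'' = t" "arr s' ''src'' = arr s ''src''" "arr s' ''dst'' = arr s ''dst''"
      using fr t by (simp_all add: frame_def dp_defs)
    with runs_dp_edge[OF st' A' t(1,2) _ e M W]
    show "runs F dp_edge s' (8 + 4 * M + M * W) (\<lambda>s''. sound (arr s'' ''best'') \<and>
      improves t (arr s' ''best'') (arr s'' ''best'') \<and>
      all_relaxed (arr s'' ''best'') t (arr s ''src'' e) (arr s ''dst'' e))" by simp
  next
    fix e A A' assume "e < 3 * n" "all_relaxed A t (arr s ''src'' e) (arr s ''dst'' e)" "improves t A A'"
    then show "all_relaxed A' t (arr s ''src'' e) (arr s ''dst'' e)"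
      using all_relaxed_improves ab by blast
  next
    fix s' assume "frame ?loop s s'"
    then show "aval F s' (Plus (Plus (Var ''n'') (Var ''n'')) (Var ''n'')) = 3 * n"
      using n by (simp add: frame_def dp_defs)
  qed (use A in \<open>auto simp: dp_defs\<close>)
  fix s' assume s': "sound (arr s' ''best'') \<and> improves t (arr s ''best'') (arr s' ''best'') \<and>
    (\<forall>e. 0 \<le> e \<longrightarrow> e < 3 * n \<longrightarrow> all_relaxed (arr s' ''best'') t (arr s ''src'' e) (arr s ''dst'' e))"
  have "all_relaxed (arr s' ''best'') t a b" if move: "a < n" "b < n" "a = b \<or> par a = b \<or> par b = a" for a b
  proof -
    obtain e where "e < 3 * n" "arr s ''src'' e = a" "arr s ''dst'' e = b"
      using st move unfolding dp_static_def by blast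
    then show ?thesis using s' by auto
  qed
  then show "sound (arr s' ''best'') \<and> improves t (arr s ''best'') (arr s' ''best'') \<and>
    (\<forall>a b. a < n \<longrightarrow> b < n \<longrightarrow> a = b \<or> par a = b \<or> par b = a \<longrightarrow> all_relaxed (arr s' ''best'') t a b)"
    using s' by blast
qed simp

section \<open>Completeness and the verdict\<close>

definition complete :: "(nat \<Rightarrow> nat) \<Rightarrow> bool" where
  "complete A \<longleftrightarrow> (\<forall>t v S c x. reach t v S c x \<longrightarrow> 0 < A (key t v S c) \<and> A (key t v S c) \<le> Suc x)"

text \<open>Induction along \<open>reach\<close>: each of its steps is among the relaxed moves, so
  the bounds on the entries add up.\<close>

lemma completeI:
  assumes init: "0 < A (key 1 r {r} 1)" "A (key 1 r {r} 1) \<le> 1"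
    and rel: "\<And>t a b. 1 \<le> t \<Longrightarrow> t \<le> T \<Longrightarrow> a < n \<Longrightarrow> b < n \<Longrightarrow> a = b \<or> par a = b \<or> par b = a \<Longrightarrow>
      all_relaxed A t a b"
  shows "complete A"
proof -
  have "0 < A (key t v S c) \<and> A (key t v S c) \<le> Suc x" if "reach t v S c x" for t v S c x
    using that
  proof (induction rule: reach.induct)
    case reach_init
    then show ?case using init by simp
  next
    case (reach_step t a S c x b t' y)
    note basic = reach_basic[OF reach_step(1)]
    have "a = b \<or> par a = b \<or> par b = a"
      using F_stepD[OF basic(3) reach_step(2) basic(1) _ _ reach_step(4)] reach_step(3) by simp
    then have "relaxed A t a b S c t'"
      using rel[OF basic(1,2,3) reach_step(2)] basic reach_step(3) by (auto simp: all_relaxed_def)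
    then show ?case using reach_step.IH reach_step(4)
      unfolding relaxed_def step_set_def step_count_def by fastforce
  qed
  then show ?thesis by (simp add: complete_def)
qed

text \<open>Steps go strictly forward in time. Hence the entries at \<open>t\<close> are final when
  \<open>t\<close> is treated, and relaxations from earlier times stay valid.\<close>

lemma runs_dp:
  assumes st: "dp_static s" and r: "scalar s ''vs'' = r" and zero: "\<forall>i. arr s ''best'' i = 0"
    and M: "M = card {S. par_closed S \<and> S \<subseteq> K}" and W: "W = 8 + (k + 1) * (8 + 6 * T)"
  shows "runs F dp_prog s (3 + T * (4 + 3 * n * (10 + 4 * M + M * W)))
    (\<lambda>s'. sound (arr s' ''best'') \<and> complete (arr s' ''best''))"
  unfolding dp_prog_def
proof (rule runs_Seq)
  let ?loop = "For ''t'' (Num 1) (Plus (Var ''T'') (Num 1)) dp_time"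
  let ?k = "key 1 r {r} 1"
  have vr: "valid_state r {r} 1" using r_less k_pos by (simp add: valid_state_def)
  have sc: "scalar s ''n'' = n" "scalar s ''k'' = k" "scalar s ''T'' = T" using st by (auto simp: dp_static_def)
  have pw: "arr s ''p'' r = 2 ^ r" "arr s ''p'' (n + r) = 2 ^ (n + r)" "arr s ''p'' (n + n + 1) = 2 ^ (2 * n + 1)"
    "arr s ''p'' (n + n + (k + 1) + 1) = 2 ^ (2 * n + k + 1 + 1)"
    using dp_static_pow(1,2)[OF st r_less] dp_static_pow(3)[OF st, of 1] dp_static_pow(4)[OF st, of 1]
      k_pos T_ge by (simp_all add: mult_2 add.assoc)
  note key_code[OF vr set_decode_power_2, of 1]
  then have k1: "arr s ''p'' r + arr s ''p'' (n + r) + arr s ''p'' (n + n + 1) + arr s ''p'' (n + n + (k + 1) + 1) = ?k"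
    unfolding pw by simp
  show "runs F dp_init s 1 (\<lambda>s1. s1 = set_arr s ''best'' ?k 1)"
    by (rule runs_straight) (use k1 in \<open>simp_all add: dp_init_def r sc\<close>)
  fix s1 assume s1: "s1 = set_arr s ''best'' ?k 1"
  have b1: "arr s1 ''best'' z = (if z = ?k then 1 else 0)" for z using zero by (simp add: s1)
  have st1: "dp_static s1" by (rule dp_static_cong[OF st]) (simp_all add: s1)
  have sound1: "sound (arr s1 ''best'')" unfolding sound_def b1
    using key_inj[OF _ vr, of _ _ _ _ 1] reach_init by (auto split: if_splits)
  let ?moves = "\<lambda>A t. \<forall>a b. a < n \<longrightarrow> b < n \<longrightarrow> a = b \<or> par a = b \<or> par b = a \<longrightarrow> all_relaxed A t a b"
  \<comment> \<open>\<open>improves 0\<close> expresses the monotonicity of the entries over the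
    whole run; it keeps the initial entry positive and at most 1.\<close>
  let ?I = "\<lambda>t s'. sound (arr s' ''best'') \<and> improves 0 (arr s1 ''best'') (arr s' ''best'') \<and>
    (\<forall>q. 1 \<le> q \<longrightarrow> q < t \<longrightarrow> ?moves (arr s' ''best'') q)"
  show "runs F ?loop s1 (2 + T * (4 + 3 * n * (10 + 4 * M + M * W)))
    (\<lambda>s'. sound (arr s' ''best'') \<and> complete (arr s' ''best''))"
  proof (rule runs_For[where l = 1 and B = "T + 1" and I = ?I and m = "2 + 3 * n * (10 + 4 * M + M * W)"])
    fix t s' assume t: "1 \<le> t" "t < T + 1" "scalar s' ''t'' = t" and fr: "frame ?loop s1 s'" and I: "?I t s'"
    have st': "dp_static s'" by (rule dp_static_cong[OF st1]) (use fr in \<open>simp_all add: frame_def dp_defs\<close>)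
    have "t \<le> T" using t by simp
    from runs_dp_time[OF st' conjunct1[OF I] t(1) this t(3) M W]
    show "runs F dp_time s' (2 + 3 * n * (10 + 4 * M + M * W)) (\<lambda>s''. ?I (Suc t) (set_var s'' ''t'' (Suc t)))"
    proof (rule runs_weaken)
      fix s'' :: store assume s'': "sound (arr s'' ''best'') \<and> improves t (arr s' ''best'') (arr s'' ''best'') \<and>
        ?moves (arr s'' ''best'') t"
      have "?moves (arr s'' ''best'') q" if q: "1 \<le> q" "q < Suc t" for q
      proof (cases "q = t")
        case False
        then have "improves q (arr s' ''best'') (arr s'' ''best'')" using s'' q improves_mono by auto
        moreover have "?moves (arr s' ''best'') q" using I q False by auto
        ultimately show ?thesis using all_relaxed_improves by blast
      qed (use s'' in blast)
      moreover have "improves 0 (arr s1 ''best'') (arr s'' ''best'')"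
        by (rule improves_trans[OF conjunct1[OF conjunct2[OF I]]
              improves_mono[OF conjunct1[OF conjunct2[OF s'']]]]) simp
      ultimately show "?I (Suc t) (set_var s'' ''t'' (Suc t))" using s'' by simp
    qed simp
  next
    fix s' assume I: "?I (T + 1) s'"
    have "improves 0 (arr s1 ''best'') (arr s' ''best'')" using I by blast
    moreover have "0 < arr s1 ''best'' ?k" by (simp add: b1)
    ultimately have "0 < arr s' ''best'' ?k \<and> arr s' ''best'' ?k \<le> arr s1 ''best'' ?k"
      unfolding improves_def by blast
    then have "0 < arr s' ''best'' ?k \<and> arr s' ''best'' ?k \<le> 1" by (simp add: b1)
    then have "complete (arr s' ''best'')" by (intro completeI) (use I in auto)
    then show "sound (arr s' ''best'') \<and> complete (arr s' ''best'')" using I by blast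
  next
    show "?I 1 (set_var s1 ''t'' 1)" using sound1 improves_refl by simp
  next
    show "2 + (T + 1 - 1) * (2 + 3 * n * (10 + 4 * M + M * W) + 2) \<le>
        2 + T * (4 + 3 * n * (10 + 4 * M + M * W))" by (simp add: distrib_left)
  qed (use sc in \<open>auto simp: s1 frame_def dp_defs\<close>)
qed simp

text \<open>One entry per core set is inspected: at the goal, at time \<open>T\<close>, with full
  counter. As an entry is one more than a cost, \<open>w < f + 2\<close> says that the cost is at
  most \<open>f\<close>.\<close>

lemma runs_answer:
  assumes st: "dp_static s" and A: "sound (arr s ''best'')" "complete (arr s ''best'')"
    and s: "scalar s ''vt'' = goal" "scalar s ''f'' = f"
    and M: "M = card {S. par_closed S \<and> S \<subseteq> K}"
  shows "runs F answer_prog s (3 + 5 * M) (\<lambda>s'. scalar s' ''answer'' =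
    (if temporal_orienteering {..<n} T F r goal k f then 1 else 0))"
  unfolding answer_prog_def
proof (rule runs_Seq)
  let ?A = "arr s ''best''" and ?loop = "For ''i'' (Num 0) (Var ''N'') answer_step"
  show "runs F (Assign ''answer'' (Num 0)) s 1 (\<lambda>s1. s1 = set_var s ''answer'' 0)"
    by (rule runs_straight) simp_all
  fix s1 assume s1: "s1 = set_var s ''answer'' 0"
  have X: "lists_sets {S. par_closed S \<and> S \<subseteq> K} s"
    and sc: "scalar s ''n'' = n" "scalar s ''k'' = k" "scalar s ''T'' = T" using st by (auto simp: dp_static_def)
  have N: "scalar s ''N'' = M" using lists_sets_card[OF X] by (simp add: M)
  have img: "{S. par_closed S \<and> S \<subseteq> K} = code_set s ` {..<M}" using X N by (simp only: lists_sets_def)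
  have goal: "goal < n" using goal_core core_closed by (auto simp: par_closed_def)
  have valid: "valid_state goal S k" if "par_closed S" for S
    using that goal by (auto simp: valid_state_def par_closed_def)
  let ?hit = "\<lambda>S. 0 < ?A (key T goal S k) \<and> ?A (key T goal S k) \<le> Suc f"
  let ?I = "\<lambda>i s'. scalar s' ''answer'' = (if \<exists>h<i. ?hit (code_set s h) then 1 else 0)"
  have pw: "arr s ''p'' (n + goal) = 2 ^ (n + goal)" "arr s ''p'' (n + n + k) = 2 ^ (2 * n + k)"
    "arr s ''p'' (n + n + (k + 1) + T) = 2 ^ (2 * n + k + 1 + T)"
    using dp_static_pow[OF st] goal by (simp_all add: mult_2 add.assoc)
  have final: "(\<exists>h<M. ?hit (code_set s h)) \<longleftrightarrow> temporal_orienteering {..<n} T F r goal k f"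
  proof -
    have "(\<exists>h<M. ?hit (code_set s h)) \<longleftrightarrow> (\<exists>S\<in>{S. par_closed S \<and> S \<subseteq> K}. ?hit S)"
      unfolding img by blast
    also have "\<dots> \<longleftrightarrow> (\<exists>S x. reach T goal S k x \<and> x \<le> f)"
    proof
      assume "\<exists>S\<in>{S. par_closed S \<and> S \<subseteq> K}. ?hit S"
      then obtain S where S: "par_closed S" "?hit S" by blast
      then have "reach T goal S k (?A (key T goal S k) - 1)" using A(1) valid by (auto simp: sound_def)
      moreover have "?A (key T goal S k) - 1 \<le> f" using S(2) by linarith
      ultimately show "\<exists>S x. reach T goal S k x \<and> x \<le> f" by blast
    next
      assume "\<exists>S x. reach T goal S k x \<and> x \<le> f"
      then obtain S x where S: "reach T goal S k x" "x \<le> f" by blast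
      then have "?hit S" using A(2) unfolding complete_def by (meson Suc_le_mono le_trans)
      then show "\<exists>S\<in>{S. par_closed S \<and> S \<subseteq> K}. ?hit S" using reach_basic(4,5)[OF S(1)] by blast
    qed
    finally show ?thesis using reach_iff_orienteering by blast
  qed
  show "runs F ?loop s1 (2 + 5 * M) (\<lambda>s'. scalar s' ''answer'' =
    (if temporal_orienteering {..<n} T F r goal k f then 1 else 0))"
  proof (rule runs_For[where l = 0 and B = M and m = 3 and I = ?I])
    fix i s' assume i: "i < M" "scalar s' ''i'' = i" and fr: "frame ?loop s1 s'" and I: "?I i s'"
    have s': "scalar s' ''n'' = n" "scalar s' ''k'' = k" "scalar s' ''T'' = T" "scalar s' ''vt'' = goal"
      "scalar s' ''f'' = f" "arr s' = arr s"
      using fr s sc by (auto simp: frame_def dp_defs s1)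
    have "code_set s i \<in> {S. par_closed S \<and> S \<subseteq> K}" using img i by blast
    then have "key T goal (code_set s i) k =
        arr s ''sets'' i + 2 ^ (n + goal) + 2 ^ (2 * n + k) + 2 ^ (2 * n + k + 1 + T)"
      by (intro key_code valid) auto
    then have key: "arr s ''sets'' i + arr s ''p'' (n + goal) + arr s ''p'' (n + n + k) +
        arr s ''p'' (n + n + (k + 1) + T) = key T goal (code_set s i) k"
      unfolding pw by simp
    have "scalar (result F answer_step s') ''answer'' = (if ?hit (code_set s i) then 1 else scalar s' ''answer'')"
      using key by (auto simp: answer_step_def s' i)
    then have "?I (Suc i) (set_var (result F answer_step s') ''i'' (Suc i))"
      using I by (auto simp: less_Suc_eq)
    then show "runs F answer_step s' 3 (\<lambda>s''. ?I (Suc i) (set_var s'' ''i'' (Suc i)))"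
      by (intro runs_straight) (simp_all only:, simp_all add: answer_step_def)
  next
    fix s' assume "?I M s'"
    then show "scalar s' ''answer'' = (if temporal_orienteering {..<n} T F r goal k f then 1 else 0)"
      unfolding final .
  qed (use N in \<open>auto simp: s1 frame_def dp_defs\<close>)
qed simp

end

section \<open>The main result\<close>

text \<open>Each traversal takes at least one time unit. This makes the set under the
  \<open>Max\<close> in \<open>max_traversal_number\<close> finite.\<close>

lemma has_traversals_le:
  assumes lt: "\<And>x y. x \<in> {1..T} \<Longrightarrow> y \<in> {1..T} \<Longrightarrow> linked F a v x y \<Longrightarrow> x < y"
  shows "y \<le> T \<Longrightarrow> has_traversals F a v y m \<Longrightarrow> m \<le> y"
proof (induction y arbitrary: m rule: less_induct)
  case (less y)
  show ?case
  proof (cases "y = 0")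
    case True
    then show ?thesis using less.prems has_traversals_0 by simp
  next
    case False
    then consider "has_traversals F a v (y - 1) m" |
      x m' where "m = Suc m'" "x < y" "has_traversals F a v x m'"
      using has_traversals_step[where T = T and F = F and a = a and v = v and y = y and m = m] lt less.prems by auto
    then show ?thesis
    proof cases
      case 1
      then show ?thesis using less.IH[of "y - 1" m] less.prems False by linarith
    next
      case 2
      then show ?thesis using less.IH[of x m'] less.prems by linarith
    qed
  qed
qed

lemma length_le_max_traversal_number:
  assumes lt: "\<And>x y. x \<in> {1..T} \<Longrightarrow> y \<in> {1..T} \<Longrightarrow> linked F a v x y \<Longrightarrow> x < y"
    and ts: "traversal_sequence T F a v ts"
  shows "length ts \<le> max_traversal_number T F a v"
  unfolding max_traversal_number_def
proof (rule Max_ge)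
  have "length us \<le> T" if "traversal_sequence T F a v us" for us
    using has_traversals_le[where T = T and F = F and a = a and v = v and y = T and m = "length us"] lt that
    by (auto simp: has_traversals_def)
  then have "{length ts |ts. traversal_sequence T F a v ts} \<subseteq> {..T}" by blast
  then show "finite {length ts |ts. traversal_sequence T F a v ts}"
    by (rule finite_subset) simp
qed (use ts in blast)

context rooted
begin

section \<open>Leaves below the edges of the forest\<close>

text \<open>Among the lower endpoints in \<open>desc x\<close> of edges in \<open>E'\<close>, take
  one of greatest rank. An edge of \<open>E'\<close> to one of its children would have a lower
  endpoint of still greater rank, so the edge to the parent is its only one.\<close>

lemma leaf_below:
  assumes E': "\<And>e. e \<in> E' \<Longrightarrow> \<exists>a b. e = {a, b}"
    and edge: "\<And>a b. {a, b} \<in> E' \<Longrightarrow> a < n \<and> b < n \<and> a \<noteq> b \<and> (par a = b \<or> par b = a)"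
    and x: "x < n" "x \<noteq> r" "{par x, x} \<in> E'"
  shows "\<exists>y\<in>leaves (\<Union>E') E'. y \<in> desc x"
proof -
  define D where "D = {y \<in> desc x. y \<noteq> r \<and> {par y, y} \<in> E'}"
  have D: "finite D" "x \<in> D"
    using x desc_refl by (auto simp: D_def desc_def intro: finite_subset[of _ "{..<n}"])
  then have "Max (rank ` D) \<in> rank ` D" by (intro Max_in) auto
  then obtain y where y: "y \<in> D" "rank y = Max (rank ` D)" by auto
  have yD: "y \<in> desc x" "y \<noteq> r" "{par y, y} \<in> E'" "y < n" using y(1) by (auto simp: D_def desc_def)
  have "e = {par y, y}" if e: "e \<in> E'" "y \<in> e" for e
  proof -
    obtain z where z: "e = {y, z}" using E'[OF e(1)] e(2) by auto
    then have zn: "z < n" "y \<noteq> z" "par y = z \<or> par z = y" using edge[of y z] e(1) by auto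
    show ?thesis
    proof (cases "par y = z")
      case False
      then have pz: "par z = y" using zn by simp
      then have "z \<noteq> r" using par_r yD(2) by auto
      have "z \<in> desc x"
      proof (cases "z = x")
        case True
        then show ?thesis using desc_refl x(1) by simp
      next
        case False
        then show ?thesis using desc_par[OF zn(1) False] pz yD(1) by simp
      qed
      moreover have "{par z, z} \<in> E'" using e(1) z pz by (simp add: insert_commute)
      ultimately have "z \<in> D" using \<open>z \<noteq> r\<close> by (simp add: D_def)
      then have "rank z \<le> rank y" using D(1) y(2) by simp
      then show ?thesis using par_step(2)[OF zn(1) \<open>z \<noteq> r\<close>] pz by simp
    qed (use z in auto)
  qed
  then have "{e \<in> E'. y \<in> e} = {{par y, y}}" using yD(3) by blast
  then have "y \<in> leaves (\<Union>E') E'" using yD(3) unfolding leaves_def by auto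
  then show ?thesis using yD(1) by blast
qed

lemma edges_cover:
  assumes "\<forall>v<n. src v = v \<and> dst v = v \<and> src (n + v) = v \<and> dst (n + v) = par v \<and>
    src (2 * n + v) = par v \<and> dst (2 * n + v) = v"
  shows "\<forall>e<3 * n. src e < n \<and> dst e < n"
    and "\<forall>a b. a < n \<longrightarrow> b < n \<longrightarrow> a = b \<or> par a = b \<or> par b = a \<longrightarrow> (\<exists>e<3 * n. src e = a \<and> dst e = b)"
proof -
  show "\<forall>e<3 * n. src e < n \<and> dst e < n"
  proof (intro allI impI)
    fix e assume e: "e < 3 * n"
    have "e < n \<or> (\<exists>v<n. e = n + v) \<or> (\<exists>v<n. e = 2 * n + v)" using e by presburger
    then consider "e < n" | v where "v < n" "e = n + v" | v where "v < n" "e = 2 * n + v" by blast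
    then show "src e < n \<and> dst e < n" using assms par_less by cases auto
  qed
  show "\<forall>a b. a < n \<longrightarrow> b < n \<longrightarrow> a = b \<or> par a = b \<or> par b = a \<longrightarrow> (\<exists>e<3 * n. src e = a \<and> dst e = b)"
  proof (intro allI impI)
    fix a b assume ab: "a < n" "b < n" "a = b \<or> par a = b \<or> par b = a"
    from ab(3) show "\<exists>e<3 * n. src e = a \<and> dst e = b"
    proof (elim disjE)
      assume "a = b"
      then show ?thesis using assms ab by (intro exI[of _ a]) auto
    next
      assume "par a = b"
      then show ?thesis using assms ab by (intro exI[of _ "n + a"]) auto
    next
      assume "par b = a"
      then show ?thesis using assms ab by (intro exI[of _ "2 * n + b"]) auto
    qed
  qed
qed

end

section \<open>The whole program and its running time\<close>

definition orienteering_prog :: com where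
  "orienteering_prog =
     powers_prog ;; rows_prog ;; bfs_prog ;; edges_prog ;; mtn_prog ;; closure_prog ;;
     enum_prog ;; dp_prog ;; answer_prog"

lemmas prog_defs = powers_prog_def rows_prog_def bfs_prog_def prog_simps edges_prog_def
  mtn_prog_def mtn_defs closure_prog_def enum_prog_def enum_defs dp_prog_def dp_defs

text \<open>One summand per stage of \<open>orienteering_prog\<close>; \<open>M\<close> stands for
  the number of parent-closed subsets of the core.\<close>

definition time_bound :: "nat \<Rightarrow> nat \<Rightarrow> nat \<Rightarrow> nat \<Rightarrow> nat" where
  "time_bound n T k M =
     (3 + 3 * (2 * n + k + T + 1)) + (2 + 3 * n) + (6 + n * (5 + 7 * n)) + (2 + 8 * n) +
     (4 + n * (7 + T * (5 + 4 * T))) + (2 + 5 * n) + (5 + n * (12 + 11 * M)) +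
     (3 + T * (4 + 3 * n * (10 + 4 * M + M * (8 + (k + 1) * (8 + 6 * T))))) + (3 + 5 * M)"

text \<open>271 is the sum of the coefficients of \<open>time_bound\<close>, expanded as a polynomial.\<close>

lemma time_bound_le:
  assumes "1 \<le> n" "1 \<le> T" "1 \<le> k" "M \<le> n ^ Suc l"
  shows "time_bound n T k M \<le> 271 * (k ^ 2 * T ^ 2 * n ^ (2 * l + 2))"
proof -
  define X where "X = k * T * T * n * n ^ Suc l"
  have le_mult: "a \<le> a * b" "a \<le> b * a" if "1 \<le> b" for a b :: nat using that by auto
  have N: "1 \<le> n ^ Suc l" "n \<le> n ^ Suc l" using assms(1) by (simp_all add: le_mult)
  \<comment> \<open>Every monomial of \<open>time_bound\<close> is dominated factor by factor by the
    five factors of \<open>X\<close>, with 1 in the place of an absent one.\<close>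
  have mono: "a * b * c * d * e \<le> X"
    if "a \<le> k" "b \<le> T" "c \<le> T" "d \<le> n" "e \<le> n ^ Suc l" for a b c d e
    unfolding X_def using that by (intro mult_le_mono)
  have m: "1 \<le> X" "k \<le> X" "T \<le> X" "n \<le> X" "n * n \<le> X" "n * T \<le> X" "n * T * T \<le> X"
    "M \<le> X" "n * M \<le> X" "T * n \<le> X" "T * n * M \<le> X" "T * n * M * k \<le> X"
    "T * n * M * T \<le> X" "T * n * M * k * T \<le> X"
    using mono[of 1 1 1 1 1] mono[of k 1 1 1 1] mono[of 1 T 1 1 1] mono[of 1 1 1 n 1]
      mono[of 1 1 1 n n] mono[of 1 T 1 n 1] mono[of 1 T T n 1] mono[of 1 1 1 1 M]
      mono[of 1 1 1 n M] mono[of 1 T 1 n M] mono[of k T 1 n M] mono[of 1 T T n M]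
      mono[of k T T n M] assms N by (simp_all add: ac_simps)
  have "time_bound n T k M = 33 + 3 * k + 7 * T + 46 * n + 7 * (n * n) + 5 * (n * T) +
      4 * (n * T * T) + 5 * M + 11 * (n * M) + 30 * (T * n) + 60 * (T * n * M) + 24 * (T * n * M * k) +
      18 * (T * n * M * T) + 18 * (T * n * M * k * T)"
    unfolding time_bound_def by (simp add: algebra_simps)
  also have "\<dots> \<le> 271 * X" using m by linarith
  also have "X \<le> k ^ 2 * T ^ 2 * n ^ (2 * l + 2)"
  proof -
    \<comment> \<open>Here the exponent \<open>l + 2\<close> is weakened to
      \<open>2 * l + 2\<close>, and in the next step \<open>k\<close> to its square.\<close>
    have "n * n ^ Suc l \<le> n ^ (2 * l + 2)"
      using assms(1) power_increasing[of "Suc (Suc l)" "2 * l + 2" n] by simp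
    moreover have "k * T * T \<le> k ^ 2 * T ^ 2"
      using assms(3) by (simp add: power2_eq_square)
    ultimately have "k * T * T * (n * n ^ Suc l) \<le> k ^ 2 * T ^ 2 * n ^ (2 * l + 2)"
      by (rule mult_le_mono[rotated])
    then show ?thesis by (simp add: X_def mult.assoc)
  qed
  finally show ?thesis by simp
qed

lemma runsE:
  assumes "runs F c s m P"
  obtains t s' where "exec F c s t s'" "t \<le> m" "P s'" "frame c s s'"
  using assms exec_frame unfolding runs_def by blast

text \<open>The intermediate stores are named because \<open>rooted\<close> and \<open>core\<close>
  are instantiated with arrays that the program itself has computed. The facts \<open>in1\<close> to
  \<open>in8\<close> and \<open>eq1\<close> to \<open>eq7\<close> carry the inputs and untouched
  arrays along by framing.\<close>

lemma orienteering_prog_correct: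
  assumes tree: "tree {..<n} E" and graph: "temporal_cost_graph {..<n} E T F"
    and life: "has_lifetime {..<n} F T" and E': "E' \<subseteq> E"
    and leaves: "card (leaves (\<Union>E') E') \<le> l"
    and mtn: "\<forall>u v. {u, v} \<in> E - E' \<longrightarrow> max_traversal_number T F u v = 3"
    and v: "vs < n" "vt < n" and k: "1 \<le> k"
  shows "decides_within orienteering_prog F (input_store n E T vs vt k f)
    (271 * (k ^ 2 * T ^ 2 * n ^ (2 * l + 2))) (temporal_orienteering {..<n} T F vs vt k f)"
proof -
  have fin: "t < t' \<and> (a = b \<or> {a, b} \<in> E)"
    if "a < n" "b < n" "t \<in> {1..T}" "t' \<in> {1..T}" "F a b t t' \<noteq> \<infinity>" for a b t t'
    using graph that unfolding temporal_cost_graph_def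
    by (metis lessThan_iff linorder_not_less)
  have stay: "F a a t t' = 0" if "a < n" "t \<in> {1..T}" "t' \<in> {1..T}" "t < t'" for a t t'
    using graph that unfolding temporal_cost_graph_def by auto
  \<comment> \<open>A finite cost of arriving at \<open>T\<close> needs an earlier departure, and
    departures start at 1.\<close>
  have T: "2 \<le> T"
  proof -
    obtain a b t where "a < n" "b < n" "t \<in> {1..T}" "F a b t T < \<infinity>"
      using life unfolding has_lifetime_def by auto
    then show ?thesis using fin[of a b t T] by auto
  qed
  let ?s0 = "input_store n E T vs vt k f"
  let ?inputs = "\<lambda>s. scalar s ''n'' = n \<and> scalar s ''T'' = T \<and> scalar s ''vs'' = vs \<and>
    scalar s ''vt'' = vt \<and> scalar s ''k'' = k \<and> scalar s ''f'' = f"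
  have in0: "?inputs ?s0" by (simp add: input_store_def)
  have zero: "arr ?s0 x i = 0" if "x \<noteq> ''adj''" for x i using that by (simp add: input_store_def)
  have adj: "arr ?s0 ''adj'' i = (if i < n * n \<and> {i div n, i mod n} \<in> E then 1 else 0)" for i
    by (simp add: input_store_def)

  obtain t1 s1 where 1: "exec F powers_prog ?s0 t1 s1" "t1 \<le> 3 + 3 * (2 * n + k + T + 1)"
    "\<forall>i\<le>2 * n + k + T + 1. arr s1 ''p'' i = 2 ^ i" and fr1: "frame powers_prog ?s0 s1"
    using runs_powers[of "2 * n + k + T + 1" ?s0 F] in0 by (auto elim: runsE)
  have in1: "?inputs s1" using in0 fr1 by (simp add: frame_def prog_defs)
  have eq1: "arr s1 x = arr ?s0 x" if "x \<noteq> ''p''" for x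
    using fr1 that by (simp add: frame_def prog_defs)

  obtain t2 s2 where 2: "exec F rows_prog s1 t2 s2" "t2 \<le> 2 + 3 * n"
    "\<forall>i\<le>n. arr s2 ''row'' i = i * n" and fr2: "frame rows_prog s1 s2"
    using runs_rows[of s1 n F] in1 zero by (auto simp: eq1 elim: runsE)
  have in2: "?inputs s2" using in1 fr2 by (simp add: frame_def prog_defs)
  have eq2: "arr s2 x = arr s1 x" if "x \<noteq> ''row''" for x
    using fr2 that by (simp add: frame_def prog_defs)

  have "runs F bfs_prog s2 (6 + n * (5 + 7 * n))
    (\<lambda>s'. rooted n vs (arr s' ''par'') (arr s' ''ord'') \<and>
      (\<forall>v<n. v \<noteq> vs \<longrightarrow> {arr s' ''par'' v, v} \<in> E))"
    by (rule runs_bfs[OF tree]) (use in2 v 2(3) zero adj in \<open>simp_all add: eq2 eq1\<close>)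
  then obtain t3 s3 where 3: "exec F bfs_prog s2 t3 s3" "t3 \<le> 6 + n * (5 + 7 * n)"
    and root: "rooted n vs (arr s3 ''par'') (arr s3 ''ord'')"
    and par_E: "\<forall>v<n. v \<noteq> vs \<longrightarrow> {arr s3 ''par'' v, v} \<in> E" and fr3: "frame bfs_prog s2 s3"
    by (auto elim: runsE)
  have in3: "?inputs s3" using in2 fr3 by (simp add: frame_def prog_defs)
  have eq3: "arr s3 x = arr s2 x" if "x \<notin> {''ord'', ''par'', ''seen''}" for x
    using fr3 that by (simp add: frame_def prog_defs)
  define par where "par = arr s3 ''par''"
  define ord where "ord = arr s3 ''ord''"
  interpret rooted n vs par ord using root by (simp add: par_def ord_def)
  have par_E: "{par v, v} \<in> E" if "v < n" "v \<noteq> vs" for v using par_E that by (simp add: par_def)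
  note edge = tree_edge_par[OF tree par_E]
  have lt: "x < y" if "v < n" "x \<in> {1..T}" "y \<in> {1..T}" "linked F (par v) v x y" for v x y
  proof -
    have "F (par v) v x y \<noteq> \<infinity> \<or> F v (par v) x y \<noteq> \<infinity>"
      using that(4) unfolding linked_def min_less_iff_disj by (metis less_irrefl)
    then show ?thesis
      using fin[of "par v" v x y] fin[of v "par v" x y] par_less[of v] that(1-3) by blast
  qed

  obtain t4 s4 where 4: "exec F edges_prog s3 t4 s4" "t4 \<le> 2 + 8 * n"
    and edges4: "\<forall>v<n. arr s4 ''src'' v = v \<and> arr s4 ''dst'' v = v \<and>
      arr s4 ''src'' (n + v) = v \<and> arr s4 ''dst'' (n + v) = par v \<and>
      arr s4 ''src'' (2 * n + v) = par v \<and> arr s4 ''dst'' (2 * n + v) = v"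
    and fr4: "frame edges_prog s3 s4"
    by (rule runsE[OF runs_edges[of s3 n par F]]) (use in3 in \<open>auto simp: par_def\<close>)
  have in4: "?inputs s4" using in3 fr4 by (simp add: frame_def prog_defs)
  have eq4: "arr s4 x = arr s3 x" if "x \<notin> {''src'', ''dst''}" for x
    using fr4 that by (simp add: frame_def prog_defs)

  have "runs F mtn_prog s4 (4 + n * (7 + T * (5 + 4 * T)))
    (\<lambda>s'. \<forall>v<n. 0 < arr s' ''K'' v \<longleftrightarrow> v = vs \<or> v = vt \<or> overused F T par v)"
    by (rule runs_mtn[OF lt]) (use in4 zero in \<open>simp_all add: eq4 eq3 eq2 eq1 par_def\<close>)
  then obtain t5 s5 where 5: "exec F mtn_prog s4 t5 s5" "t5 \<le> 4 + n * (7 + T * (5 + 4 * T))"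
    and K5: "\<forall>v<n. 0 < arr s5 ''K'' v \<longleftrightarrow> v = vs \<or> v = vt \<or> overused F T par v"
    and fr5: "frame mtn_prog s4 s5"
    by (rule runsE)
  have in5: "?inputs s5" using in4 fr5 by (simp add: frame_def prog_defs)
  have eq5: "arr s5 x = arr s4 x" if "x \<notin> {''mx'', ''K''}" for x
    using fr5 that by (simp add: frame_def prog_defs)

  define K0 where "K0 = {v. v < n \<and> 0 < arr s5 ''K'' v}"
  have K0: "v \<in> K0 \<longleftrightarrow> v < n \<and> (v = vs \<or> v = vt \<or> overused F T par v)" for v
    using K5 by (auto simp: K0_def)
  have "runs F closure_prog s5 (2 + 5 * n) (\<lambda>s'. par_closed {v. v < n \<and> 0 < arr s' ''K'' v} \<and>
    K0 \<subseteq> {v. v < n \<and> 0 < arr s' ''K'' v} \<and> (\<forall>v\<in>{v. v < n \<and> 0 < arr s' ''K'' v}. \<exists>x\<in>K0. x \<in> desc v))"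
    unfolding K0_def
    by (rule runs_closure) (use in5 K5 v in \<open>simp_all add: eq5 eq4 par_def ord_def\<close>)
  then obtain t6 s6 where 6: "exec F closure_prog s5 t6 s6" "t6 \<le> 2 + 5 * n"
    and K6: "par_closed {v. v < n \<and> 0 < arr s6 ''K'' v} \<and> K0 \<subseteq> {v. v < n \<and> 0 < arr s6 ''K'' v} \<and>
      (\<forall>v\<in>{v. v < n \<and> 0 < arr s6 ''K'' v}. \<exists>x\<in>K0. x \<in> desc v)"
    and fr6: "frame closure_prog s5 s6"
    by (rule runsE)
  have in6: "?inputs s6" using in5 fr6 by (simp add: frame_def prog_defs)
  have eq6: "arr s6 x = arr s5 x" if "x \<noteq> ''K''" for x
    using fr6 that by (simp add: frame_def prog_defs)
  define K where "K = {v. v < n \<and> 0 < arr s6 ''K'' v}"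
  have K: "par_closed K" "K0 \<subseteq> K" "\<And>v. v \<in> K \<Longrightarrow> \<exists>x\<in>K0. x \<in> desc v" using K6 by (auto simp: K_def)

  interpret core n vs par ord T F K vt k
  proof unfold_locales
    show "par_closed K" by (rule K(1))
    show "vt \<in> K" using K(2) K0 v by auto
    show "2 \<le> T" by (rule T)
    show "1 \<le> k" by (rule k)
    show "t < t' \<and> (a = b \<or> par a = b \<or> par b = a)"
      if "a < n" "b < n" "t \<in> {1..T}" "t' \<in> {1..T}" "F a b t t' \<noteq> \<infinity>" for a b t t'
      using fin[OF that] edge[of a b] by blast
    show "F a a t t' = 0" if "a < n" "1 \<le> t" "t < t'" "t' \<le> T" for a t t'
      using stay[of a t t'] that by auto
    show "length ts \<le> 3" if "u < n" "u \<notin> K" "traversal_sequence T F (par u) u ts" for u ts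
    proof -
      have "\<not> overused F T par u" using that K(2) K0 by auto
      then show ?thesis using that(3) unfolding overused_def by (meson linorder_not_less)
    qed
  qed

  define M where "M = card {S. par_closed S \<and> S \<subseteq> K}"
  have M_le: "M \<le> n ^ Suc l"
  proof -
    let ?L = "leaves (\<Union>E') E'"
    have E2: "\<exists>a b. e = {a, b}" if "e \<in> E'" for e
      using tree that E' unfolding tree_def forest_def simple_graph_def by blast
    have edge': "a < n \<and> b < n \<and> a \<noteq> b \<and> (par a = b \<or> par b = a)" if "{a, b} \<in> E'" for a b
      using edge that E' by blast
    have Ln: "?L \<subseteq> {..<n}"
    proof
      fix x assume "x \<in> ?L"
      then obtain e where e: "e \<in> E'" "x \<in> e" by (auto simp: leaves_def)
      then obtain a b where "e = {a, b}" using E2 by blast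
      then show "x \<in> {..<n}" using e edge'[of a b] by auto
    qed
    \<comment> \<open>A core vertex other than the source is, or lies above, the sink or the lower
      endpoint of an overused edge. Such an edge belongs to \<open>E'\<close>, as its traversal
      number is not 3, and therefore has a leaf of \<open>E'\<close> at or below its lower
      endpoint.\<close>
    have below: "\<exists>y\<in>insert vt ?L. y \<in> desc u" if u: "u \<in> K" "u \<noteq> vs" for u
    proof -
      obtain x where x: "x \<in> K0" "x \<in> desc u" using K(3) u(1) by blast
      \<comment> \<open>The source lies below no other vertex. So \<open>x\<close> has a genuine
        edge to its parent.\<close>
      have xr: "x \<noteq> vs" using x(2) root_notin_desc[OF u(2)] by auto
      show ?thesis
      proof (cases "x = vt")
        case False
        then have ov: "overused F T par x" "x < n" using x(1) xr K0 by auto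
        then obtain ts where ts: "traversal_sequence T F (par x) x ts" "3 < length ts"
          by (auto simp: overused_def)
        have "length ts \<le> max_traversal_number T F (par x) x"
          by (rule length_le_max_traversal_number[OF lt[OF ov(2)] ts(1)])
        then have "max_traversal_number T F (par x) x \<noteq> 3" using ts(2) by simp
        then have "{par x, x} \<in> E'" using mtn par_E[OF ov(2) xr] by blast
        then obtain y where "y \<in> ?L" "y \<in> desc x" using leaf_below[OF E2 edge' ov(2) xr] by blast
        then show ?thesis using desc_trans[OF _ x(2)] by blast
      qed (use x in auto)
    qed
    have finL: "finite ?L" using Ln by (rule finite_subset) simp
    have "M \<le> n ^ card (insert vt ?L)" unfolding M_def
      by (rule card_par_closed_le) (use finL Ln v below in auto)
    \<comment> \<open>The sink contributes one more ancestor chain than the at most \<open>l\<close>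
      leaves.\<close>
    also have "\<dots> \<le> n ^ Suc l" using finL leaves v
      by (intro power_increasing) (auto simp: card_insert_if)
    finally show ?thesis .
  qed

  have p6: "\<forall>i\<le>2 * n + k + T + 1. arr s6 ''p'' i = 2 ^ i" using 1(3) by (simp add: eq6 eq5 eq4 eq3 eq2)
  have es6: "enum_static K s6"
    unfolding enum_static_def K_def using in6 p6 by (simp add: eq6 eq5 eq4 par_def ord_def)
  obtain t7 s7 where 7: "exec F enum_prog s6 t7 s7" "t7 \<le> 5 + n * (12 + 11 * M)"
    and sets7: "lists_sets {S. par_closed S \<and> S \<subseteq> K} s7" and fr7: "frame enum_prog s6 s7"
    by (rule runsE[OF runs_enum[OF es6 root_core M_def]])
  have in7: "?inputs s7" using in6 fr7 by (simp add: frame_def prog_defs)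
  have eq7: "arr s7 x = arr s6 x" if "x \<notin> {''sets'', ''LV'', ''LP'', ''col''}" for x
    using fr7 that by (simp add: frame_def prog_defs)

  have st7: "dp_static s7" unfolding dp_static_def
  proof (intro conjI)
    show "\<forall>i\<le>2 * n + k + T + 1. arr s7 ''p'' i = 2 ^ i" using p6 by (simp add: eq7)
    show "arr s7 ''par'' = par" by (simp add: eq7 eq6 eq5 eq4 par_def)
    show "\<forall>v<n. 0 < arr s7 ''K'' v \<longleftrightarrow> v \<in> K" by (simp add: eq7 K_def)
    have "arr s7 ''src'' = arr s4 ''src''" "arr s7 ''dst'' = arr s4 ''dst''"
      by (simp_all add: eq7 eq6 eq5)
    then show "\<forall>e<3 * n. arr s7 ''src'' e < n \<and> arr s7 ''dst'' e < n"
      "\<forall>a b. a < n \<longrightarrow> b < n \<longrightarrow> a = b \<or> par a = b \<or> par b = a \<longrightarrow>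
        (\<exists>e<3 * n. arr s7 ''src'' e = a \<and> arr s7 ''dst'' e = b)"
      using edges_cover[OF edges4] by simp_all
  qed (use in7 sets7 in simp_all)
  have vs7: "scalar s7 ''vs'' = vs" and zero7: "\<forall>i. arr s7 ''best'' i = 0"
    using in7 zero by (simp_all add: eq7 eq6 eq5 eq4 eq3 eq2 eq1)
  obtain t8 s8 where 8: "exec F dp_prog s7 t8 s8"
    "t8 \<le> 3 + T * (4 + 3 * n * (10 + 4 * M + M * (8 + (k + 1) * (8 + 6 * T))))"
    "sound (arr s8 ''best'') \<and> complete (arr s8 ''best'')" and fr8: "frame dp_prog s7 s8"
    by (rule runsE[OF runs_dp[OF st7 vs7 zero7 M_def refl]])
  have in8: "?inputs s8" using in7 fr8 by (simp add: frame_def prog_defs)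
  have st8: "dp_static s8"
    by (rule dp_static_cong[OF st7]) (use fr8 in \<open>simp_all add: frame_def prog_defs\<close>)

  have "runs F answer_prog s8 (3 + 5 * M) (\<lambda>s'. scalar s' ''answer'' =
      (if temporal_orienteering {..<n} T F vs vt k f then 1 else 0))"
    by (rule runs_answer[OF st8]) (use 8(3) in8 M_def in auto)
  then obtain t9 s9 where 9: "exec F answer_prog s8 t9 s9" "t9 \<le> 3 + 5 * M"
    "scalar s9 ''answer'' = (if temporal_orienteering {..<n} T F vs vt k f then 1 else 0)"
    by (rule runsE)

  have "exec F orienteering_prog ?s0 (t1 + (t2 + (t3 + (t4 + (t5 + (t6 + (t7 + (t8 + t9)))))))) s9"
    unfolding orienteering_prog_def by (intro exec.Seq; fact)
  moreover have "t1 + (t2 + (t3 + (t4 + (t5 + (t6 + (t7 + (t8 + t9))))))) \<le> time_bound n T k M"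
    unfolding time_bound_def using 1(2) 2(2) 3(2) 4(2) 5(2) 6(2) 7(2) 8(2) 9(2) by linarith
  moreover have "time_bound n T k M \<le> 271 * (k ^ 2 * T ^ 2 * n ^ (2 * l + 2))"
    by (rule time_bound_le) (use v T k M_le in auto)
  ultimately show ?thesis unfolding decides_within_def using 9(3) le_trans by blast
qed

theorem theorem2:
  shows "\<exists>(prog :: com) (C :: nat).
    \<forall>(n :: nat) (E :: nat set set) (T :: nat) (F :: nat cost) (E' :: nat set set) (l :: nat)
     (vs :: nat) (vt :: nat) (k :: nat) (f :: nat).
      tree {..<n} E \<longrightarrow>
      temporal_cost_graph {..<n} E T F \<longrightarrow>
      has_lifetime {..<n} F T \<longrightarrow>
      E' \<subseteq> E \<longrightarrow>
      forest (\<Union>E') E' \<longrightarrow>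
      card (leaves (\<Union>E') E') \<le> l \<longrightarrow>
      (\<forall>u v. {u, v} \<in> E - E' \<longrightarrow> max_traversal_number T F u v = 3) \<longrightarrow>
      vs \<in> {..<n} \<longrightarrow> vt \<in> {..<n} \<longrightarrow> k \<ge> 1 \<longrightarrow>
      decides_within prog F (input_store n E T vs vt k f)
        (C * (k ^ 2 * T ^ 2 * n ^ (2 * l + 2)))
        (temporal_orienteering {..<n} T F vs vt k f)"
  by (intro exI[of _ orienteering_prog] exI[of _ 271] allI impI)
    (rule orienteering_prog_correct; simp)

end
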